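(* Let $K\neq\mathbb{Q}(\sqrt{-3})$ be an imaginary quadratic field and let $\mathcal{A}$ be any weak $K$-Apollonian group. Then $\mathcal{A}$ is thin, and its Zariski closure is either $\mathrm{O}_M$ or $\mathrm{SO}_M$.
   Context: $\text{Möb}$ is the group generated by Möbius transformations of $\widehat{\mathbb{C}}$ and complex conjugation $\mathfrak{c}$. Let $M$ be the quadratic form $M(b',b,r,m)=-b'b+r^2+m^2$ on $\mathbb{R}^4$, identified with Hermitian matrices $\begin{pmatrix} b' & r+mi\\ r-mi& b\end{pmatrix}$; there is an isomorphism $\rho:\text{Möb}\to \mathrm{O}^+_M(\mathbb{R})$ (the time-orientation-preserving orthogonal group of $M$) given by $T\mapsto\gamma T\gamma^\dagger$ for a Möbius transformation $\gamma\in\mathrm{GL}_2(\mathbb{C})$ with $|\det\gamma|=1$ and $T\mapsto\overline{T}$ for $\mathfrak{c}$; subgroups of $\langle\mathrm{PSL}_2(\mathcal{O}_K),\mathfrak{c}\rangle$ are regarded via $\rho$ as subgroups of $\mathrm{O}_M(\mathbb{Z})$. A subgroup $X$ is thin if it has infinite index in $G(\mathbb{Z})$, where $G$ is the Zariski closure of $X$ in $\mathrm{O}_M$. A $K$-Bianchi circle is $M(\widehat{\mathbb{R}})$, $M\in\mathrm{PSL}_2(\mathcal{O}_K)$; oriented circles have interior to the left of the direction of travel, and $\widehat{\mathbb{R}}$ is oriented with interior the upper half plane. A collection of circles straddles $C$ if it meets both interior and exterior of $C$; two oriented $K$-Bianchi circles are immediately tangent if they are tangent with disjoint interiors and the pair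 straddles no oriented $K$-Bianchi circle. The fundamental packing $\mathcal{P}_K$ is the smallest set of oriented $K$-Bianchi circles containing $\widehat{\mathbb{R}}$ and closed under immediate tangency. A weak $K$-Apollonian group is a finitely generated Kleinian (discrete) group $\mathcal{A}<\langle\mathrm{PSL}_2(\mathcal{O}_K),\mathfrak{c}\rangle<\text{Möb}$ whose limit set (the accumulation set of the orbit of a point) equals the closure in $\widehat{\mathbb{C}}$ of the union of the circles of $\mathcal{P}_K$. *)

theory Defs
  imports "HOL-Analysis.Analysis" "HOL-Computational_Algebra.Polynomial"
    "HOL-Algebra.Bij" "HOL-Algebra.Generated_Groups"
begin

section \<open>Imaginary quadratic fields\<close>

definition quadratic_field :: "int \<Rightarrow> complex set" where
  "quadratic_field D = {of_rat a + of_rat b * csqrt (of_int D) | a b. True}"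

definition imaginary_quadratic_field :: "complex set \<Rightarrow> bool" where
  "imaginary_quadratic_field K \<longleftrightarrow> (\<exists>D<0. K = quadratic_field D)"

definition ring_of_integers :: "complex set \<Rightarrow> complex set" where
  "ring_of_integers K = {x \<in> K. algebraic_int x}"


section \<open>The Riemann sphere and the group of Moebius and anti-Moebius maps\<close>

text \<open>The value \<^const>\<open>None\<close> is the point at infinity.\<close>

type_synonym riemann_sphere = "complex option"

definition sphere_topology :: "riemann_sphere topology" where
  "sphere_topology = Alexandroff_compactification euclidean"

definition moebius :: "complex^2^2 \<Rightarrow> riemann_sphere \<Rightarrow> riemann_sphere" where
  "moebius \<gamma> z =
    (case z of
       None \<Rightarrow> if \<gamma>$2$1 = 0 then None else Some (\<gamma>$1$1 / \<gamma>$2$1)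
     | Some w \<Rightarrow> if \<gamma>$2$1 * w + \<gamma>$2$2 = 0 then None
                 else Some ((\<gamma>$1$1 * w + \<gamma>$1$2) / (\<gamma>$2$1 * w + \<gamma>$2$2)))"

definition conjugation :: "riemann_sphere \<Rightarrow> riemann_sphere" where
  "conjugation = map_option cnj"

definition Moeb :: "(riemann_sphere \<Rightarrow> riemann_sphere) monoid" where
  "Moeb = subgroup_generated (BijGroup UNIV)
            (insert conjugation {moebius \<gamma> | \<gamma>. det \<gamma> \<noteq> 0})"

definition PSL2 :: "complex set \<Rightarrow> (riemann_sphere \<Rightarrow> riemann_sphere) set" where
  "PSL2 R = {moebius \<gamma> | \<gamma>. (\<forall>i j. \<gamma>$i$j \<in> R) \<and> det \<gamma> = 1}"

definition extended_bianchi_group :: "complex set \<Rightarrow> (riemann_sphere \<Rightarrow> riemann_sphere) set" where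
  "extended_bianchi_group K = generate Moeb (insert conjugation (PSL2 (ring_of_integers K)))"

text \<open>
  The group \<^const>\<open>Moeb\<close> is the disjoint union of the open subsets \<open>PSL(2, C)\<close> and
  \<open>PSL(2, C) \<circ> conjugation\<close>, each of which is covered two-to-one by \<open>SL(2, C)\<close>.  A subset is
  discrete iff its preimages under these two covering maps are discrete.
\<close>

definition kleinian_group :: "(riemann_sphere \<Rightarrow> riemann_sphere) set \<Rightarrow> bool" where
  "kleinian_group A \<longleftrightarrow>
     subgroup A Moeb \<and>
     discrete {\<gamma> :: complex^2^2. det \<gamma> = 1 \<and> moebius \<gamma> \<in> A} \<and>
     discrete {\<gamma> :: complex^2^2. det \<gamma> = 1 \<and> moebius \<gamma> \<circ> conjugation \<in> A}"

text \<open>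
  For a non-elementary Kleinian group every orbit in the sphere has the same accumulation set.
  Taking the union over all base points gives the usual limit set for elementary groups too,
  where the orbit of a fixed point does not accumulate anywhere.
\<close>

definition limit_set :: "(riemann_sphere \<Rightarrow> riemann_sphere) set \<Rightarrow> riemann_sphere set" where
  "limit_set A = (\<Union>z. sphere_topology derived_set_of ((\<lambda>f. f z) ` A))"


section \<open>Oriented Bianchi circles and the fundamental packing\<close>

text \<open>
  A direction of travel on a circle is recorded by the side that lies to its left, the interior.
\<close>

datatype oriented_circle =
  Oriented_Circle (circle_points: "riemann_sphere set") (circle_interior: "riemann_sphere set")

definition circle_exterior :: "oriented_circle \<Rightarrow> riemann_sphere set" where
  "circle_exterior C = - (circle_points C \<union> circle_interior C)"

definition extended_real_line :: "riemann_sphere set" where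
  "extended_real_line = insert None (Some ` \<real>)"

definition upper_half_plane :: "riemann_sphere set" where
  "upper_half_plane = Some ` {z. Im z > 0}"

definition lower_half_plane :: "riemann_sphere set" where
  "lower_half_plane = Some ` {z. Im z < 0}"

text \<open>Every Bianchi circle is taken with both of its orientations.\<close>

definition oriented_bianchi_circles :: "complex set \<Rightarrow> oriented_circle set" where
  "oriented_bianchi_circles K =
     {Oriented_Circle (f ` extended_real_line) (f ` H) | f H.
        f \<in> PSL2 (ring_of_integers K) \<and> H \<in> {upper_half_plane, lower_half_plane}}"

definition straddles :: "oriented_circle set \<Rightarrow> oriented_circle \<Rightarrow> bool" where
  "straddles S C \<longleftrightarrow>
     (\<Union>(circle_points ` S)) \<inter> circle_interior C \<noteq> {} \<and>
     (\<Union>(circle_points ` S)) \<inter> circle_exterior C \<noteq> {}"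

text \<open>Two circles of the Riemann sphere are tangent iff they meet in exactly one point.\<close>

definition tangent :: "oriented_circle \<Rightarrow> oriented_circle \<Rightarrow> bool" where
  "tangent C C' \<longleftrightarrow> (\<exists>z. circle_points C \<inter> circle_points C' = {z})"

definition immediately_tangent ::
    "complex set \<Rightarrow> oriented_circle \<Rightarrow> oriented_circle \<Rightarrow> bool" where
  "immediately_tangent K C C' \<longleftrightarrow>
     tangent C C' \<and> circle_interior C \<inter> circle_interior C' = {} \<and>
     \<not> (\<exists>D \<in> oriented_bianchi_circles K. straddles {C, C'} D)"

inductive_set fundamental_packing :: "complex set \<Rightarrow> oriented_circle set" for K where
  base: "Oriented_Circle extended_real_line upper_half_plane \<in> fundamental_packing K"
| step: "C \<in> fundamental_packing K \<Longrightarrow> C' \<in> oriented_bianchi_circles K \<Longrightarrow>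
           immediately_tangent K C C' \<Longrightarrow> C' \<in> fundamental_packing K"

definition weak_apollonian_group ::
    "complex set \<Rightarrow> (riemann_sphere \<Rightarrow> riemann_sphere) set \<Rightarrow> bool" where
  "weak_apollonian_group K A \<longleftrightarrow>
     kleinian_group A \<and> A \<subseteq> extended_bianchi_group K \<and>
     (\<exists>S. finite S \<and> S \<subseteq> carrier Moeb \<and> A = generate Moeb S) \<and>
     limit_set A =
       sphere_topology closure_of (\<Union>(circle_points ` fundamental_packing K))"


section \<open>The quadratic form, its orthogonal group, and Hermitian matrices\<close>

text \<open>The coordinates of a vector are \<open>(b', b, r, m)\<close>, in this order.\<close>

definition M_form :: "'a::comm_ring_1^4 \<Rightarrow> 'a" where
  "M_form v = - (v$1 * v$2) + (v$3)^2 + (v$4)^2"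

text \<open>The algebraic groups are identified with their sets of complex points.\<close>

definition O_M :: "(complex^4^4) set" where
  "O_M = {g. \<forall>v. M_form (g *v v) = M_form v}"

definition SO_M :: "(complex^4^4) set" where
  "SO_M = {g \<in> O_M. det g = 1}"

definition hermitian_matrix :: "real^4 \<Rightarrow> complex^2^2" where
  "hermitian_matrix v =
     vector [vector [of_real (v$1), Complex (v$3) (v$4)],
             vector [Complex (v$3) (- (v$4)), of_real (v$2)]]"

definition hermitian_coords :: "complex^2^2 \<Rightarrow> real^4" where
  "hermitian_coords T = vector [Re (T$1$1), Re (T$2$2), Re (T$1$2), Im (T$1$2)]"

definition conjugate_transpose :: "complex^2^2 \<Rightarrow> complex^2^2" where
  "conjugate_transpose \<gamma> = transpose (map_matrix cnj \<gamma>)"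

definition moebius_action :: "complex^2^2 \<Rightarrow> real^4 \<Rightarrow> real^4" where
  "moebius_action \<gamma> v =
     hermitian_coords (\<gamma> ** hermitian_matrix v ** conjugate_transpose \<gamma>)"

definition conjugation_action :: "real^4 \<Rightarrow> real^4" where
  "conjugation_action v = hermitian_coords (map_matrix cnj (hermitian_matrix v))"

text \<open>
  The matrix \<open>\<gamma>\<close> representing a given Moebius map is determined up to a scalar of modulus one,
  which does not affect its action.  Every orientation-reversing element of \<^const>\<open>Moeb\<close> is
  of the form \<open>moebius \<gamma> \<circ> conjugation\<close>.
\<close>

definition rho :: "(riemann_sphere \<Rightarrow> riemann_sphere) \<Rightarrow> real^4^4" where
  "rho f = (THE L. \<exists>\<gamma>. cmod (det \<gamma>) = 1 \<and>
     (f = moebius \<gamma> \<and> L = matrix (moebius_action \<gamma>) \<or>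
      f = moebius \<gamma> \<circ> conjugation \<and> L = matrix (moebius_action \<gamma> \<circ> conjugation_action)))"


section \<open>Zariski closure and thin groups\<close>

inductive matrix_polynomial :: "(complex^4^4 \<Rightarrow> complex) \<Rightarrow> bool" where
  const: "matrix_polynomial (\<lambda>g. c)"
| entry: "matrix_polynomial (\<lambda>g. g$i$j)"
| add: "matrix_polynomial p \<Longrightarrow> matrix_polynomial q \<Longrightarrow> matrix_polynomial (\<lambda>g. p g + q g)"
| mult: "matrix_polynomial p \<Longrightarrow> matrix_polynomial q \<Longrightarrow> matrix_polynomial (\<lambda>g. p g * q g)"

definition zariski_closure :: "(complex^4^4) set \<Rightarrow> (complex^4^4) set" where
  "zariski_closure X =
     {g \<in> O_M. \<forall>p. matrix_polynomial p \<longrightarrow> (\<forall>x\<in>X. p x = 0) \<longrightarrow> p g = 0}"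

definition matrix_group :: "(complex^4^4) monoid" where
  "matrix_group = \<lparr>carrier = {g. invertible g}, mult = (**), one = mat 1\<rparr>"

text \<open>
  The integral structure is that of the Hermitian matrices with entries in the ring of integers
  of \<open>K\<close>, on which \<^const>\<open>M_form\<close> is integral: with respect to a basis of this lattice,
  the matrices stabilising it are those in \<open>GL(4, Z)\<close>.  In the coordinates \<open>(b', b, r, m)\<close>
  themselves, the image of the Bianchi group need not have integral entries.
\<close>

definition hermitian_lattice :: "complex set \<Rightarrow> (complex^4) set" where
  "hermitian_lattice K =
     {v. v$1 \<in> \<int> \<and> v$2 \<in> \<int> \<and> v$3 \<in> \<real> \<and> v$4 \<in> \<real> \<and> v$3 + v$4 * \<i> \<in> ring_of_integers K}"

definition integral_points :: "complex set \<Rightarrow> (complex^4^4) set \<Rightarrow> (complex^4^4) set" where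
  "integral_points K G = {g \<in> G. (\<lambda>v. g *v v) ` hermitian_lattice K = hermitian_lattice K}"

definition thin :: "complex set \<Rightarrow> (complex^4^4) set \<Rightarrow> bool" where
  "thin K X \<longleftrightarrow>
     (let GZ = matrix_group\<lparr>carrier := integral_points K (zariski_closure X)\<rparr>
      in subgroup X GZ \<and> infinite (rcosets\<^bsub>GZ\<^esub> X))"

definition rho_image :: "(riemann_sphere \<Rightarrow> riemann_sphere) set \<Rightarrow> (complex^4^4) set" where
  "rho_image A = map_matrix of_real ` rho ` A"

end

theory Submission
  imports Defs
begin

text \<open>
  A Bianchi circle is the zero set of a Hermitian form \<open>(A, B, C)\<close> with \<open>\<bar>B\<bar>\<^sup>2 - A C = 1/4\<close>. The value
  \<open>Q = 1 + 2 (Im a Im d - Im b Im c)\<close> measures the angle with the real line, and it lies in \<open>(-1, 1)\<close>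
  only if the imaginary parts of integers can be smaller than 1, that is for \<open>\<rat>(\<surd>-3)\<close>. Otherwise no
  circle crosses the real line. Hence the packing never enters the upper half plane, but it does contain a
  second circle, the line immediately tangent to the real line.

  Let \<open>\<Gamma>\<close> be the orientation preserving part of \<open>\<A>\<close>. Limits of rescaled elements of \<open>\<Gamma>\<close> are matrices
  of rank one whose images contain the limit set; they produce loxodromic elements with many different
  axes. Powers of a loxodromic element grow like an exponential sum, so that the Zariski closure contains
  the whole one-parameter group of boosts along its axis. The tangent vectors of these boosts span
  \<open>sl\<^sub>2(\<complex>)\<close> over the reals because the limit set is not contained in a circle. So all
  unipotents lie in the closure, and with their complexifications they generate \<open>SO_M\<close>.

  The Zariski closure of \<open>\<A>\<close> therefore has index at most 2 in \<open>O_M\<close>. A parabolic element of the Bianchi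
  group fixing a point of the upper half plane has no power in \<open>\<A>\<close>, as that point is not in the limit
  set. Hence \<open>\<A>\<close> has infinite index in the integral points.
\<close>

text \<open>No element of \<Gamma> need have two prescribed limit points p and q as fixed points.
  Rescaled limits get around this: if E1 and E2 have their images on the lines of p and q, then
  \<open>E1 ** k ** adj2 E2\<close> has image p and kernel q, and irreducibility of \<Gamma>
  supplies a k that makes it nonzero. The tangent space is a finite-dimensional, hence closed,
  subspace, so limits of velocities of boosts are tangent too. With p and q among infinity, 0, 1 and
  -\<omega>, differences of such velocities are nilpotent, and only nilpotent vectors have to be
  exponentiated; products of curves and n-th powers at time 1/n replace Lie theory. The rotational
  part of a loxodromic element may have infinite order and hides the boosts. Its powers return near
  1 while the moduli grow, which separates the two. Up to here everything is real. Unipotents occur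
  as pairs (c, cnj c), polynomial in Re c and Im c; complex values of these make the pair arbitrary,
  and SL2 x SL2 acts on 2x2 matrices preserving -det.\<close>

section \<open>Integers of an imaginary quadratic field\<close>

lemma Ints_if_bounded_denominators:
  fixes r :: rat and N :: int
  assumes "N > 0" and "\<And>k. of_int N * r ^ k \<in> \<int>"
  shows "r \<in> \<int>"
proof -
  obtain a b where ab: "quotient_of r = (a, b)" by fastforce
  then have b: "b > 0" "coprime a b" and r: "r = of_int a / of_int b"
    by (auto simp: quotient_of_denom_pos quotient_of_coprime quotient_of_div)
  \<comment> \<open>N a^k is a multiple of b^k with a and b coprime; a denominator b >= 2 would give
    N arbitrarily large divisors.\<close>
  have "b ^ k dvd N" for k
  proof -
    obtain m where "of_int N * r ^ k = of_int m" using assms(2) Ints_cases by metis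
    then have "of_int (N * a ^ k) = (of_int (m * b ^ k) :: rat)"
      using b by (simp add: r power_divide field_simps)
    then have "N * a ^ k = m * b ^ k" by (simp only: of_int_eq_iff)
    then have "b ^ k dvd N * a ^ k" by simp
    then show ?thesis using b(2)
      by (meson coprime_commute coprime_dvd_mult_left_iff coprime_power_left_iff coprime_power_right_iff)
  qed
  then have le: "b ^ k \<le> N" for k using assms(1) zdvd_imp_le by blast
  have "b = 1"
  proof (rule ccontr)
    assume "b \<noteq> 1"
    then have "b \<ge> 2" using b by simp
    then have "2 ^ nat N \<le> b ^ nat N" by (intro power_mono) auto
    moreover have "int (nat N) < int (2 ^ nat N)" by (subst of_nat_less_iff) (rule less_exp)
    ultimately show False using le[of "nat N"] assms(1) by simp
  qed
  then show ?thesis using r by simp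
qed

lemma complex_of_rat_eq: "of_rat r = complex_of_real (of_rat r)"
proof -
  obtain a b where "quotient_of r = (a, b)" by fastforce
  then have "r = of_int a / of_int b" by (rule quotient_of_div)
  then show ?thesis by (simp add: of_rat_divide)
qed

lemma cnj_of_rat: "cnj (of_rat r) = of_rat r"
  by (simp add: complex_of_rat_eq)

text \<open>The order Z[sqrt D]. It may be smaller than the ring of integers, and D need not be
  squarefree; it only serves as the lattice against which denominators are measured.\<close>

definition quadratic_order :: "int \<Rightarrow> complex set" where
  "quadratic_order D = {of_int a + of_int b * csqrt (of_int D) | a b. True}"

lemma csqrt_of_int_neg:
  assumes "D < 0" shows "csqrt (of_int D) = \<i> * of_real (sqrt (- of_int D))"
proof -
  have "csqrt (of_real (of_int D)) = \<i> * sqrt \<bar>of_int D\<bar>"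
    using assms by (subst csqrt_of_real_nonpos) auto
  then show ?thesis using assms by simp
qed

lemma csqrt_of_int_mult_self: "csqrt (of_int D) * csqrt (of_int D) = of_int D"
  by (metis power2_csqrt power2_eq_square)

lemma cnj_csqrt_of_int: "D < 0 \<Longrightarrow> cnj (csqrt (of_int D)) = - csqrt (of_int D)"
  by (simp add: csqrt_of_int_neg)

lemma quadratic_order_of_int: "of_int a \<in> quadratic_order D"
  unfolding quadratic_order_def by (rule CollectI, intro exI[of _ a] exI[of _ 0]) simp

lemma quadratic_order_add:
  "x \<in> quadratic_order D \<Longrightarrow> y \<in> quadratic_order D \<Longrightarrow> x + y \<in> quadratic_order D"
proof -
  assume "x \<in> quadratic_order D" "y \<in> quadratic_order D"
  then obtain a b c d where xy: "x = of_int a + of_int b * csqrt (of_int D)"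
    "y = of_int c + of_int d * csqrt (of_int D)" unfolding quadratic_order_def by blast
  show ?thesis unfolding quadratic_order_def
    by (rule CollectI, intro exI[of _ "a+c"] exI[of _ "b+d"]) (simp add: xy algebra_simps)
qed

lemma quadratic_order_mult:
  "x \<in> quadratic_order D \<Longrightarrow> y \<in> quadratic_order D \<Longrightarrow> x * y \<in> quadratic_order D"
proof -
  assume "x \<in> quadratic_order D" "y \<in> quadratic_order D"
  then obtain a b c d where xy: "x = of_int a + of_int b * csqrt (of_int D)"
    "y = of_int c + of_int d * csqrt (of_int D)" unfolding quadratic_order_def by blast
  have "x * y = of_int (a*c) + of_int (b*d) * (csqrt (of_int D) * csqrt (of_int D))
       + of_int (a*d+b*c) * csqrt (of_int D)"
    by (simp add: xy algebra_simps)
  then have "x * y = of_int (a*c+b * d * D) + of_int (a*d+b*c) * csqrt (of_int D)"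
    by (simp only: csqrt_of_int_mult_self) simp
  then show ?thesis unfolding quadratic_order_def by blast
qed

lemma quadratic_order_power: "x \<in> quadratic_order D \<Longrightarrow> x ^ k \<in> quadratic_order D"
  by (induction k) (use quadratic_order_of_int[of 1] in \<open>auto intro: quadratic_order_mult\<close>)

lemma quadratic_order_sum:
  "(\<And>i. i \<in> I \<Longrightarrow> f i \<in> quadratic_order D) \<Longrightarrow> sum f I \<in> quadratic_order D"
  by (induction I rule: infinite_finite_induct)
    (use quadratic_order_of_int[of 0] in \<open>auto intro: quadratic_order_add\<close>)

lemma quadratic_order_cnj:
  assumes "D < 0" "x \<in> quadratic_order D" shows "cnj x \<in> quadratic_order D"
proof -
  obtain a b where x: "x = of_int a + of_int b * csqrt (of_int D)"
    using assms(2) unfolding quadratic_order_def by blast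
  have "cnj x = of_int a + of_int (-b) * csqrt (of_int D)"
    by (simp add: x cnj_csqrt_of_int assms(1))
  then show ?thesis unfolding quadratic_order_def by blast
qed

lemma quadratic_order_of_rat:
  assumes "D < 0" "of_rat r \<in> quadratic_order D" shows "r \<in> \<int>"
proof -
  obtain a b where x: "of_rat r = of_int a + of_int b * csqrt (of_int D)"
    using assms(2) unfolding quadratic_order_def by blast
  have rr: "of_rat r = complex_of_real (of_rat r)" by (rule complex_of_rat_eq)
  then have "b = 0" using arg_cong[OF x, of Im] assms(1) by (simp add: csqrt_of_int_neg)
  then have "of_rat r = (of_rat (of_int a) :: complex)" using x by simp
  then have "r = of_int a" by (simp only: of_rat_eq_iff)
  then show ?thesis by simp
qed

lemma quadratic_field_add:
  "x \<in> quadratic_field D \<Longrightarrow> y \<in> quadratic_field D \<Longrightarrow> x + y \<in> quadratic_field D"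
proof -
  assume "x \<in> quadratic_field D" "y \<in> quadratic_field D"
  then obtain a b c d where xy: "x = of_rat a + of_rat b * csqrt (of_int D)"
    "y = of_rat c + of_rat d * csqrt (of_int D)" unfolding quadratic_field_def by blast
  show ?thesis unfolding quadratic_field_def
    by (rule CollectI, intro exI[of _ "a+c"] exI[of _ "b+d"]) (simp add: xy algebra_simps of_rat_add)
qed

lemma quadratic_field_mult:
  "x \<in> quadratic_field D \<Longrightarrow> y \<in> quadratic_field D \<Longrightarrow> x * y \<in> quadratic_field D"
proof -
  assume "x \<in> quadratic_field D" "y \<in> quadratic_field D"
  then obtain a b c d where xy: "x = of_rat a + of_rat b * csqrt (of_int D)"
    "y = of_rat c + of_rat d * csqrt (of_int D)" unfolding quadratic_field_def by blast
  have "x * y = of_rat (a*c) + of_rat (b*d) * (csqrt (of_int D) * csqrt (of_int D))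
       + of_rat (a*d+b*c) * csqrt (of_int D)"
    by (simp add: xy algebra_simps of_rat_add of_rat_mult)
  then have "x * y = of_rat (a*c+b * d * of_int D) + of_rat (a*d+b*c) * csqrt (of_int D)"
    by (simp only: csqrt_of_int_mult_self) (simp add: of_rat_add of_rat_mult)
  then show ?thesis unfolding quadratic_field_def by blast
qed

lemma quadratic_field_of_int: "of_int a \<in> quadratic_field D"
  unfolding quadratic_field_def by (rule CollectI, intro exI[of _ "of_int a"] exI[of _ 0]) simp

lemma quadratic_field_cnj:
  assumes "D < 0" "x \<in> quadratic_field D" shows "cnj x \<in> quadratic_field D"
proof -
  obtain a b where x: "x = of_rat a + of_rat b * csqrt (of_int D)"
    using assms(2) unfolding quadratic_field_def by blast
  note c = cnj_of_rat
  have "cnj x = of_rat a + of_rat (-b) * csqrt (of_int D)"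
    by (simp add: x c cnj_csqrt_of_int assms(1) of_rat_minus)
  then show ?thesis unfolding quadratic_field_def by blast
qed

lemma quadratic_field_denominator:
  assumes "x \<in> quadratic_field D"
  obtains M :: int where "M > 0" "of_int M * x \<in> quadratic_order D"
proof -
  obtain p q where x: "x = of_rat p + of_rat q * csqrt (of_int D)"
    using assms unfolding quadratic_field_def by blast
  obtain a b where p: "p = of_int a / of_int b" "b > 0"
    by (metis quotient_of_denom_pos quotient_of_div surj_pair)
  obtain c d where q: "q = of_int c / of_int d" "d > 0"
    by (metis quotient_of_denom_pos quotient_of_div surj_pair)
  have "of_int (b*d) * x = of_int (a*d) + of_int (c*b) * csqrt (of_int D)"
    using p(2) q(2) by (simp add: x p(1) q(1) of_rat_divide field_simps)
  then have "of_int (b*d) * x \<in> quadratic_order D" unfolding quadratic_order_def by blast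
  then show thesis using that[of "b*d"] p(2) q(2) by simp
qed

text \<open>For elements of the field this is integrality, in a form that makes closure under sums and
  products evident.\<close>

definition bounded_denominators :: "int \<Rightarrow> complex \<Rightarrow> bool" where
  "bounded_denominators D z \<longleftrightarrow> (\<exists>N>0. \<forall>k. of_int N * z ^ k \<in> quadratic_order D)"

text \<open>One common denominator M N serves all monomials x^i y^j, hence by the binomial theorem
  all powers of x + y.\<close>

lemma bounded_denominators_add_mult:
  assumes "bounded_denominators D x" "bounded_denominators D y"
  shows "bounded_denominators D (x + y)" "bounded_denominators D (x * y)"
proof -
  obtain M N :: int where MN: "M > 0" "N > 0" "\<And>k. of_int M * x ^ k \<in> quadratic_order D"
    "\<And>k. of_int N * y ^ k \<in> quadratic_order D"
    using assms unfolding bounded_denominators_def by blast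
  have xy: "of_int (M*N) * (x ^ i * y ^ j) \<in> quadratic_order D" for i j
    using quadratic_order_mult[OF MN(3)[of i] MN(4)[of j]] by (simp add: mult_ac)
  have "of_int (M*N) * (x * y) ^ k \<in> quadratic_order D" for k
    using xy[of k k] by (simp add: power_mult_distrib)
  then show "bounded_denominators D (x * y)"
    unfolding bounded_denominators_def using MN(1,2) by (intro exI[of _ "M*N"]) auto
  have "of_int (M*N) * (x + y) ^ k \<in> quadratic_order D" for k
  proof -
    have "of_int (M*N) * (x + y) ^ k
        = (\<Sum>i\<le>k. of_int (int (k choose i)) * (of_int (M*N) * (x ^ i * y ^ (k-i))))"
      by (simp add: binomial_ring sum_distrib_left mult_ac)
    also have "\<dots> \<in> quadratic_order D"
      by (intro quadratic_order_sum quadratic_order_mult quadratic_order_of_int xy)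
    finally show ?thesis .
  qed
  then show "bounded_denominators D (x + y)"
    unfolding bounded_denominators_def using MN(1,2) by (intro exI[of _ "M*N"]) auto
qed

lemma bounded_denominators_cnj:
  assumes "D < 0" "bounded_denominators D x" shows "bounded_denominators D (cnj x)"
proof -
  obtain N :: int where N: "N > 0" "\<And>k. of_int N * x ^ k \<in> quadratic_order D"
    using assms unfolding bounded_denominators_def by blast
  have "of_int N * cnj x ^ k \<in> quadratic_order D" for k
    using quadratic_order_cnj[OF assms(1) N(2)[of k]] by simp
  then show ?thesis using N(1) unfolding bounded_denominators_def by blast
qed

lemma bounded_denominators_of_rat:
  assumes "D < 0" "bounded_denominators D (of_rat r)" shows "r \<in> \<int>"
proof -
  obtain N :: int where N: "N > 0" "\<And>k. of_int N * of_rat r ^ k \<in> quadratic_order D"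
    using assms unfolding bounded_denominators_def by blast
  have "of_int N * r ^ k \<in> \<int>" for k
  proof (rule quadratic_order_of_rat[OF assms(1)])
    show "of_rat (of_int N * r ^ k) \<in> quadratic_order D"
      using N(2)[of k] by (simp add: of_rat_mult of_rat_power)
  qed
  then show ?thesis using Ints_if_bounded_denominators N(1) by blast
qed

text \<open>If M z lies in the order and n is the degree, then M^n clears z^k for k <= n. The monic
  equation writes every higher power as an integer combination of lower ones, so the same M^n serves
  them all.\<close>

lemma algebraic_int_bounded_denominators:
  assumes z: "z \<in> quadratic_field D" and "algebraic_int z"
  shows "bounded_denominators D z"
proof -
  obtain f :: "complex poly" where f: "\<And>i. coeff f i \<in> \<int>" "lead_coeff f = 1" "poly f z = 0"
    using assms(2) by (metis algebraic_int.cases)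
  let ?n = "degree f"
  obtain M :: int where M: "M > 0" "of_int M * z \<in> quadratic_order D"
    using quadratic_field_denominator[OF z] by blast
  have top: "z ^ ?n = (\<Sum>i<?n. - coeff f i * z ^ i)"
  proof -
    have "(\<Sum>i\<le>?n. coeff f i * z ^ i) = 0" using f(3) by (simp add: poly_altdef)
    also have "{..?n} = insert ?n {..<?n}" by auto
    finally have "z ^ ?n + (\<Sum>i<?n. coeff f i * z ^ i) = 0" using f(2) by simp
    then show ?thesis by (simp add: sum_negf eq_neg_iff_add_eq_0)
  qed
  have "of_int (M ^ ?n) * z ^ k \<in> quadratic_order D" for k
  proof (induction k rule: less_induct)
    case (less k)
    show ?case
    proof (cases "k \<le> ?n")
      case True
      have "of_int (M ^ ?n) * z ^ k = of_int (M ^ (?n - k)) * (of_int M * z) ^ k"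
        using True by (simp add: power_mult_distrib flip: mult.assoc power_add)
      then show ?thesis using M(2)
        by (simp only: quadratic_order_mult quadratic_order_of_int quadratic_order_power)
    next
      case False
      then have "z ^ k = z ^ (k - ?n) * z ^ ?n" by (simp flip: power_add)
      also have "\<dots> = (\<Sum>i<?n. - coeff f i * z ^ (k - ?n + i))"
        by (subst top) (simp add: sum_distrib_left power_add mult_ac)
      finally have "of_int (M ^ ?n) * z ^ k
          = (\<Sum>i<?n. - coeff f i * (of_int (M ^ ?n) * z ^ (k - ?n + i)))"
        by (simp add: sum_distrib_left mult_ac)
      also have "\<dots> \<in> quadratic_order D"
      proof (rule quadratic_order_sum)
        fix i assume i: "i \<in> {..<?n}"
        obtain c where "coeff f i = of_int c" using f(1) Ints_cases by metis
        then have "- coeff f i = of_int (- c)" by simp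
        moreover have "of_int (M ^ ?n) * z ^ (k - ?n + i) \<in> quadratic_order D"
          by (rule less.IH) (use i False in auto)
        ultimately show "- coeff f i * (of_int (M ^ ?n) * z ^ (k - ?n + i)) \<in> quadratic_order D"
          by (simp only: quadratic_order_mult quadratic_order_of_int)
      qed
      finally show ?thesis .
    qed
  qed
  then show ?thesis unfolding bounded_denominators_def using M(1) zero_less_power by blast
qed

text \<open>Both numbers are rational because the square root cancels, and they inherit bounded
  denominators from z and its conjugate; a rational number with bounded denominators is an
  integer.\<close>

lemma bounded_denominators_trace_norm:
  assumes "D < 0" and z: "z \<in> quadratic_field D" and "bounded_denominators D z"
  shows "z + cnj z \<in> \<int>" "z * cnj z \<in> \<int>"
proof -
  obtain p q where x: "z = of_rat p + of_rat q * csqrt (of_int D)"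
    using z unfolding quadratic_field_def by blast
  note c = cnj_of_rat
  have cz: "cnj z = of_rat p - of_rat q * csqrt (of_int D)"
    by (simp add: x c cnj_csqrt_of_int assms(1))
  have t: "z + cnj z = of_rat (2 * p)"
    by (simp only: cz) (simp add: x of_rat_mult)
  have "z * cnj z = of_rat (p * p) - of_rat (q * q) * (csqrt (of_int D) * csqrt (of_int D))"
    by (simp only: cz) (simp add: x algebra_simps of_rat_mult)
  then have n: "z * cnj z = of_rat (p * p - q * q * of_int D)"
    by (simp only: csqrt_of_int_mult_self) (simp add: of_rat_mult of_rat_diff)
  note bd = bounded_denominators_add_mult[OF assms(3) bounded_denominators_cnj[OF assms(1,3)]]
  have Z: "r \<in> \<int> \<Longrightarrow> of_rat r \<in> (\<int> :: complex set)" for r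
    by (metis Ints_cases Ints_of_int of_rat_of_int_eq)
  show "z + cnj z \<in> \<int>" using bd(1) bounded_denominators_of_rat[OF assms(1)] Z unfolding t by blast
  show "z * cnj z \<in> \<int>" using bd(2) bounded_denominators_of_rat[OF assms(1)] Z unfolding n by blast
qed

text \<open>Makes the ring of integers visibly a ring. For the converse, z is a root of the monic
  polynomial with its trace and norm as coefficients.\<close>

lemma ring_of_integers_iff_bounded_denominators:
  assumes "D < 0"
  shows "z \<in> ring_of_integers (quadratic_field D) \<longleftrightarrow>
    z \<in> quadratic_field D \<and> bounded_denominators D z"
proof (intro iffI conjI)
  assume "z \<in> ring_of_integers (quadratic_field D)"
  then show "z \<in> quadratic_field D" "bounded_denominators D z"
    by (auto simp: ring_of_integers_def algebraic_int_bounded_denominators)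
next
  assume z: "z \<in> quadratic_field D \<and> bounded_denominators D z"
  obtain t n where t: "z + cnj z = of_int t" and n: "z * cnj z = of_int n"
    using bounded_denominators_trace_norm[of D z] assms z by (metis Ints_cases)
  have "algebraic_int z"
  proof (rule algebraic_int.intros)
    let ?p = "[:of_int n, - of_int t, 1:] :: complex poly"
    show "lead_coeff ?p = 1" by simp
    show "\<forall>i. coeff ?p i \<in> \<int>" by (auto simp: coeff_pCons split: nat.split)
    have "poly ?p z = z * cnj z - (z + cnj z) * z + z * z" by (simp add: t n algebra_simps)
    also have "\<dots> = 0" by (simp add: algebra_simps)
    finally show "poly ?p z = 0" .
  qed
  then show "z \<in> ring_of_integers (quadratic_field D)" using z by (simp add: ring_of_integers_def)
qed

locale imaginary_quadratic =
  fixes K :: "complex set"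
  assumes imaginary_quadratic: "imaginary_quadratic_field K"
begin

abbreviation "OK \<equiv> ring_of_integers K"

lemma OK_of_int: "of_int a \<in> OK"
proof -
  obtain D where "K = quadratic_field D"
    using imaginary_quadratic unfolding imaginary_quadratic_field_def by blast
  then show ?thesis by (simp add: ring_of_integers_def quadratic_field_of_int)
qed

lemma OK_0: "0 \<in> OK" and OK_1: "1 \<in> OK"
  using OK_of_int[of 0] OK_of_int[of 1] by simp_all

lemma OK_add: "x \<in> OK \<Longrightarrow> y \<in> OK \<Longrightarrow> x + y \<in> OK"
  and OK_mult: "x \<in> OK \<Longrightarrow> y \<in> OK \<Longrightarrow> x * y \<in> OK"
  and OK_cnj: "x \<in> OK \<Longrightarrow> cnj x \<in> OK"
  and OK_trace: "x \<in> OK \<Longrightarrow> x + cnj x \<in> \<int>"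
  and OK_norm: "x \<in> OK \<Longrightarrow> x * cnj x \<in> \<int>"
proof -
  obtain D where D: "K = quadratic_field D" "D < 0"
    using imaginary_quadratic unfolding imaginary_quadratic_field_def by blast
  note iff = ring_of_integers_iff_bounded_denominators[OF D(2), folded D(1)]
  show "x \<in> OK \<Longrightarrow> y \<in> OK \<Longrightarrow> x + y \<in> OK" "x \<in> OK \<Longrightarrow> y \<in> OK \<Longrightarrow> x * y \<in> OK"
    "x \<in> OK \<Longrightarrow> cnj x \<in> OK" "x \<in> OK \<Longrightarrow> x + cnj x \<in> \<int>" "x \<in> OK \<Longrightarrow> x * cnj x \<in> \<int>"
    unfolding iff using D(2) bounded_denominators_trace_norm[OF D(2)]
    by (auto simp: D(1) intro: bounded_denominators_add_mult bounded_denominators_cnj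
        quadratic_field_add quadratic_field_mult quadratic_field_cnj)
qed

lemma OK_minus: "x \<in> OK \<Longrightarrow> - x \<in> OK"
  using OK_mult[OF OK_of_int[of "-1"]] by simp

lemma OK_diff: "x \<in> OK \<Longrightarrow> y \<in> OK \<Longrightarrow> x - y \<in> OK"
  using OK_add[OF _ OK_minus, of x y] by simp

lemma OK_real_Ints: "of_real a \<in> OK \<Longrightarrow> a \<in> \<int>"
proof -
  assume a: "of_real a \<in> OK"
  then have "complex_of_real a \<in> K" "bounded_denominators D (of_real a)" if "K = quadratic_field D" for D
    using that by (auto simp: ring_of_integers_def algebraic_int_bounded_denominators)
  moreover obtain D where D: "K = quadratic_field D" "D < 0"
    using imaginary_quadratic unfolding imaginary_quadratic_field_def by blast
  ultimately have "complex_of_real a \<in> quadratic_field D" "bounded_denominators D (of_real a)" by auto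
  then obtain p q where pq: "complex_of_real a = of_rat p + of_rat q * csqrt (of_int D)"
    unfolding quadratic_field_def by blast
  note rr = complex_of_rat_eq
  have "of_rat q = (0::real)" using arg_cong[OF pq, of Im] D(2) by (simp add: csqrt_of_int_neg rr)
  then have ap: "complex_of_real a = of_rat p" using pq by (simp add: rr[of q])
  then have "p \<in> \<int>" using \<open>bounded_denominators D (of_real a)\<close> bounded_denominators_of_rat[OF D(2)] by simp
  then obtain k where "p = of_int k" using Ints_cases by blast
  then have "complex_of_real a = of_real (of_int k)" using ap by simp
  then have "a = of_int k" by (simp only: of_real_eq_iff)
  then show ?thesis by simp
qed

lemma OK_Re_Im:
  assumes "x \<in> OK"
  obtains t n :: int where "2 * Re x = of_int t" "(Re x)\<^sup>2 + (Im x)\<^sup>2 = of_int n"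
proof -
  have "of_real (2 * Re x) \<in> (\<int> :: complex set)"
    using OK_trace[OF assms] by (simp add: complex_add_cnj)
  moreover have "of_real ((Re x)\<^sup>2 + (Im x)\<^sup>2) \<in> (\<int> :: complex set)"
    using OK_norm[OF assms] by (simp add: complex_mult_cnj)
  ultimately obtain t n where "of_real (2 * Re x) = (of_real (of_int t) :: complex)"
     "of_real ((Re x)\<^sup>2 + (Im x)\<^sup>2) = (of_real (of_int n) :: complex)"
    by (metis Ints_cases of_real_of_int_eq)
  then show thesis using that unfolding of_real_eq_iff by blast
qed

text \<open>4 Im(x)^2 is 4 times the norm minus the square of the trace, and squares are 0 or 1
  modulo 4. Hence 3 is the only nonzero value below 4, and this is the value that singles out the
  excluded field.\<close>

lemma OK_four_Im_square:
  assumes "x \<in> OK"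
  obtains m :: nat where "4 * (Im x)\<^sup>2 = of_nat m" "m mod 4 = 0 \<or> m mod 4 = 3"
proof -
  obtain t n :: int where tn: "2 * Re x = of_int t" "(Re x)\<^sup>2 + (Im x)\<^sup>2 = of_int n"
    using OK_Re_Im[OF assms] by blast
  have "4 * (Im x)\<^sup>2 = 4 * ((Re x)\<^sup>2 + (Im x)\<^sup>2) - (2 * Re x)\<^sup>2" by (simp add: power_mult_distrib)
  then have eq: "4 * (Im x)\<^sup>2 = of_int (4 * n - t\<^sup>2)" by (simp add: tn)
  then have ge: "4 * n - t\<^sup>2 \<ge> 0" by (metis of_int_0_le_iff zero_le_mult_iff zero_le_numeral zero_le_power2)
  have "t\<^sup>2 mod 4 = 0 \<or> t\<^sup>2 mod 4 = 1"
  proof (cases "even t")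
    case True
    then obtain s where "t = 2 * s" by blast
    then show ?thesis by (simp add: power2_eq_square)
  next
    case False
    then obtain s where "t = 2 * s + 1" using oddE by blast
    then have "t\<^sup>2 = 4 * (s * s + s) + 1" by (simp add: power2_eq_square algebra_simps)
    then show ?thesis by presburger
  qed
  then have "(4 * n - t\<^sup>2) mod 4 = 0 \<or> (4 * n - t\<^sup>2) mod 4 = 3" by presburger
  moreover obtain e where e: "4 * n - t\<^sup>2 = int e" using ge nonneg_int_cases by blast
  ultimately have "e mod 4 = 0 \<or> e mod 4 = 3" by presburger
  moreover have "4 * (Im x)\<^sup>2 = of_nat e" unfolding eq e by simp
  ultimately show thesis by (intro that[of e])
qed

text \<open>The integers 2 Re(x) and 4 Im(x)^2 are bounded and determine x up to the sign of its
  imaginary part.\<close>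

lemma OK_finite_bounded: "finite {x \<in> OK. cmod x \<le> B}"
proof -
  let ?f = "\<lambda>(t::int, m::int). {x. 2 * Re x = of_int t \<and> 4 * (Im x)\<^sup>2 = of_int m}"
  have fin: "finite (?f p)" for p
  proof -
    obtain t m where p: "p = (t, m)" by fastforce
    have "?f p \<subseteq> {Complex (of_int t / 2) (sqrt (of_int m) / 2), Complex (of_int t / 2) (- (sqrt (of_int m) / 2))}"
    proof
      fix x assume "x \<in> ?f p"
      then have x: "2 * Re x = of_int t" "4 * (Im x)\<^sup>2 = of_int m" by (auto simp: p)
      have "sqrt (of_int m) = \<bar>2 * Im x\<bar>" using x(2)
        by (metis four_x_squared real_sqrt_abs)
      then have "Im x = sqrt (of_int m) / 2 \<or> Im x = - (sqrt (of_int m) / 2)" by (auto simp: abs_if)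
      moreover have "Re x = of_int t / 2" using x(1) by simp
      ultimately show "x \<in> {Complex (of_int t / 2) (sqrt (of_int m) / 2), Complex (of_int t / 2) (- (sqrt (of_int m) / 2))}"
        by (auto simp: complex_eq_iff)
    qed
    then show ?thesis using finite_subset by blast
  qed
  let ?N = "\<lceil>2 * B\<rceil>" and ?M = "\<lceil>4 * B\<^sup>2\<rceil>"
  have "{x \<in> OK. cmod x \<le> B} \<subseteq> (\<Union>p \<in> {-?N..?N} \<times> {0..?M}. ?f p)"
  proof
    fix x assume "x \<in> {x \<in> OK. cmod x \<le> B}"
    then have x: "x \<in> OK" "cmod x \<le> B" by auto
    obtain t n :: int where tn: "2 * Re x = of_int t" using OK_Re_Im[OF x(1)] by metis
    obtain m :: nat where m: "4 * (Im x)\<^sup>2 = of_nat m" using OK_four_Im_square[OF x(1)] by metis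
    have "\<bar>2 * Re x\<bar> \<le> 2 * B" using x(2) abs_Re_le_cmod[of x] by simp
    then have "t \<in> {-?N..?N}" unfolding tn by (auto simp: abs_le_iff) linarith+
    moreover have "\<bar>Im x\<bar> \<le> B" using x(2) abs_Im_le_cmod[of x] by simp
    then have "(Im x)\<^sup>2 \<le> B\<^sup>2" by (metis abs_ge_zero power2_abs power_mono)
    then have "real m \<le> 4 * B\<^sup>2" using m by simp
    then have "int m \<in> {0..?M}" by simp linarith
    moreover have "x \<in> ?f (t, int m)" using tn m by simp
    ultimately show "x \<in> (\<Union>p \<in> {-?N..?N} \<times> {0..?M}. ?f p)" by blast
  qed
  then show ?thesis using fin by (meson finite_UN_I finite_SigmaI finite_atLeastAtMost_int finite_subset)
qed

text \<open>The number \<open>h\<close> is half the square root of the absolute value of the discriminant.\<close>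

lemma OK_Im_lattice:
  assumes "K \<noteq> quadratic_field (-3)"
  obtains h \<omega> where "h \<ge> 1" "\<omega> \<in> OK" "Im \<omega> = h" "\<And>x. x \<in> OK \<Longrightarrow> \<exists>k::int. Im x = of_int k * h"
proof -
  obtain D where D: "K = quadratic_field D" "D < 0"
    using imaginary_quadratic unfolding imaginary_quadratic_field_def by blast
  have "csqrt (of_int D) = of_rat 0 + of_rat 1 * csqrt (of_int D)" by simp
  then have sK: "csqrt (of_int D) \<in> K" unfolding D(1) quadratic_field_def by blast
  \<comment> \<open>Since 4 Im(x)^2 is a natural number, there is a least positive imaginary part;
    division with remainder then shows that it generates all of them.\<close>
  define P where "P m \<longleftrightarrow> (\<exists>x\<in>OK. Im x > 0 \<and> 4 * (Im x)\<^sup>2 = real m)" for m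
  have "\<exists>m. P m"
  proof -
    have "csqrt (of_int D) \<in> OK" using sK by (simp add: ring_of_integers_def algebraic_int_csqrt)
    moreover have "Im (csqrt (of_int D)) > 0" using D(2) by (simp add: csqrt_of_int_neg)
    ultimately show ?thesis unfolding P_def using OK_four_Im_square by metis
  qed
  then have P: "P (LEAST m. P m)" by (rule LeastI_ex)
  define m where "m = (LEAST m. P m)"
  obtain \<omega> where w: "\<omega> \<in> OK" "Im \<omega> > 0" "4 * (Im \<omega>)\<^sup>2 = real m" using P unfolding P_def m_def by blast
  have min: "Im \<omega> \<le> Im x" if xp: "x \<in> OK" "Im x > 0" for x
  proof -
    obtain m' where m': "4 * (Im x)\<^sup>2 = real m'" using OK_four_Im_square[OF xp(1)] by metis
    then have "P m'" unfolding P_def using xp by blast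
    then have "m \<le> m'" unfolding m_def by (rule Least_le)
    then have "(Im \<omega>)\<^sup>2 \<le> (Im x)\<^sup>2" using m' w(3) by linarith
    then show ?thesis using xp(2) by (meson less_imp_le power2_le_imp_le)
  qed
  have mult: "\<exists>k::int. Im x = of_int k * Im \<omega>" if x: "x \<in> OK" for x
  proof -
    define k where "k = \<lfloor>Im x / Im \<omega>\<rfloor>"
    define y where "y = x - of_int k * \<omega>"
    have y: "y \<in> OK" unfolding y_def by (intro OK_diff OK_mult OK_of_int x w(1))
    have Imy: "Im y = Im x - of_int k * Im \<omega>" by (simp add: y_def)
    have "of_int k \<le> Im x / Im \<omega>" "Im x / Im \<omega> < of_int k + 1" unfolding k_def by linarith+
    then have "of_int k * Im \<omega> \<le> Im x" "Im x < (of_int k + 1) * Im \<omega>"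
      using w(2) by (simp_all add: pos_le_divide_eq pos_divide_less_eq)
    then have "0 \<le> Im y" "Im y < Im \<omega>" unfolding Imy by (auto simp: algebra_simps)
    then have "Im y = 0" using min[OF y] by force
    then show ?thesis using Imy by (intro exI[of _ k]) simp
  qed
  have "m \<noteq> 0" using w by (metis less_numeral_extra(3) mult_eq_0_iff of_nat_0 power2_eq_square zero_neq_numeral)
  \<comment> \<open>If 4 Im(\<omega>)^2 = 3, then \<omega> minus its conjugate is a square root of
    -3 in K, and K is the excluded field. The remaining values m >= 4 give Im(\<omega>) >=
    1.\<close>
  have "m \<noteq> 3"
  proof
    assume "m = 3"
    then have "(2 * Im \<omega>)\<^sup>2 = 3" using w(3) by (simp add: power_mult_distrib)
    then have "sqrt 3 = \<bar>2 * Im \<omega>\<bar>" by (metis real_sqrt_abs)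
    then have two: "2 * Im \<omega> = sqrt 3" using w(2) by simp
    have "csqrt (of_int (-3)) = \<i> * of_real (sqrt 3)" using csqrt_of_int_neg[of "-3"] by simp
    also have "\<dots> = \<omega> - cnj \<omega>" by (simp add: two[symmetric] complex_eq_iff)
    finally have s3: "csqrt (of_int (-3)) \<in> K"
      using OK_diff[OF w(1) OK_cnj[OF w(1)]] by (simp add: ring_of_integers_def)
    then obtain p q where pq: "csqrt (of_int (-3)) = of_rat p + of_rat q * csqrt (of_int D)"
      unfolding D(1) quadratic_field_def by blast
    note rr = complex_of_rat_eq
    have "of_rat p = (0::real)" using arg_cong[OF pq, of Re] D(2) csqrt_of_int_neg[of "-3"]
      by (simp add: csqrt_of_int_neg rr)
    then have p0: "p = 0" by simp
    have q0: "q \<noteq> 0"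
    proof
      assume "q = 0"
      then have "csqrt (of_int (-3)) = 0" using pq p0 by simp
      then show False using csqrt_of_int_neg[of "-3"] by simp
    qed
    have e: "csqrt (of_int (-3)) = of_rat q * csqrt (of_int D)" using pq p0 by simp
    have e': "csqrt (of_int D) = of_rat (1/q) * csqrt (of_int (-3))"
      unfolding e using q0 by (simp add: of_rat_divide)
    have "K = quadratic_field (-3)"
    proof
      show "K \<subseteq> quadratic_field (-3)"
      proof
        fix x assume "x \<in> K"
        then obtain a b where "x = of_rat a + of_rat b * csqrt (of_int D)"
          unfolding D(1) quadratic_field_def by blast
        then have "x = of_rat a + of_rat (b * (1/q)) * csqrt (of_int (-3))" by (simp only: e' of_rat_mult mult.assoc)
        then show "x \<in> quadratic_field (-3)" unfolding quadratic_field_def by blast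
      qed
      show "quadratic_field (-3) \<subseteq> K"
      proof
        fix x assume "x \<in> quadratic_field (-3)"
        then obtain a b where "x = of_rat a + of_rat b * csqrt (of_int (-3))"
          unfolding quadratic_field_def by blast
        then have "x = of_rat a + of_rat (b * q) * csqrt (of_int D)" unfolding e by (simp only: of_rat_mult mult.assoc)
        then show "x \<in> K" unfolding D(1) quadratic_field_def by blast
      qed
    qed
    then show False using assms by simp
  qed
  obtain m' :: nat where m': "4 * (Im \<omega>)\<^sup>2 = real m'" "m' mod 4 = 0 \<or> m' mod 4 = 3"
    using OK_four_Im_square[OF w(1)] by blast
  then have "m' = m" using w(3) by simp
  then have "m \<ge> 4" using m'(2) \<open>m \<noteq> 0\<close> \<open>m \<noteq> 3\<close> by presburger
  then have "1 \<le> (Im \<omega>)\<^sup>2" using w(3) by linarith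
  then have "1 \<le> Im \<omega>" using w(2) power2_le_imp_le[of 1 "Im \<omega>"] by simp
  then show thesis using that[of "Im \<omega>" \<omega>] w(1) mult by blast
qed

end

section \<open>Two by two matrices\<close>

definition mat2 :: "'a \<Rightarrow> 'a \<Rightarrow> 'a \<Rightarrow> 'a \<Rightarrow> ('a::zero)^2^2" where
  "mat2 a b c d = vector [vector [a, b], vector [c, d]]"

lemma mat2_nth [simp]:
  "mat2 a b c d $ 1 $ 1 = a" "mat2 a b c d $ 1 $ 2 = b"
  "mat2 a b c d $ 2 $ 1 = c" "mat2 a b c d $ 2 $ 2 = d"
  by (simp_all add: mat2_def)

lemma mat2_eq_iff: "(M :: 'a^2^2) = N \<longleftrightarrow>
    M$1$1 = N$1$1 \<and> M$1$2 = N$1$2 \<and> M$2$1 = N$2$1 \<and> M$2$2 = N$2$2"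
  by (auto simp: vec_eq_iff forall_2)

lemma matrix_mult_2_nth:
  "((M :: 'a::semiring_1^2^2) ** N) $ i $ j = M$i$1 * N$1$j + M$i$2 * N$2$j"
  by (simp add: matrix_matrix_mult_def sum_2)

lemma mat_2_nth [simp]:
  "(mat s :: 'a::semiring_1^2^2)$1$1 = s" "(mat s :: 'a::semiring_1^2^2)$1$2 = 0"
  "(mat s :: 'a::semiring_1^2^2)$2$1 = 0" "(mat s :: 'a::semiring_1^2^2)$2$2 = s"
  by (simp_all add: mat_def)

lemmas mat2_simps = mat2_eq_iff matrix_mult_2_nth transpose_def

text \<open>The inverse on matrices of determinant 1. It is linear in the entries, so it passes to
  the singular limits used later, where it exchanges the roles of kernel and image.\<close>

definition adj2 :: "complex^2^2 \<Rightarrow> complex^2^2" where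
  "adj2 \<gamma> = mat2 (\<gamma>$2$2) (- \<gamma>$1$2) (- \<gamma>$2$1) (\<gamma>$1$1)"

lemma adj2_nth [simp]:
  "adj2 \<gamma> $ 1 $ 1 = \<gamma>$2$2" "adj2 \<gamma> $ 1 $ 2 = - \<gamma>$1$2"
  "adj2 \<gamma> $ 2 $ 1 = - \<gamma>$2$1" "adj2 \<gamma> $ 2 $ 2 = \<gamma>$1$1"
  by (simp_all add: adj2_def)

lemma adj2_mult: "det \<gamma> = 1 \<Longrightarrow> \<gamma> ** adj2 \<gamma> = mat 1" "det \<gamma> = 1 \<Longrightarrow> adj2 \<gamma> ** \<gamma> = mat 1"
  by (auto simp: mat2_simps det_2 algebra_simps)

lemma det_adj2 [simp]: "det (adj2 \<gamma>) = det \<gamma>"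
  by (simp add: det_2)

abbreviation cnjm :: "complex^2^2 \<Rightarrow> complex^2^2" where "cnjm \<equiv> map_matrix cnj"

lemma cnjm_mult: "cnjm (\<alpha> ** \<beta>) = cnjm \<alpha> ** cnjm \<beta>"
  by (simp add: mat2_simps)

lemma cnjm_cnjm [simp]: "cnjm (cnjm \<alpha>) = \<alpha>"
  by (simp add: mat2_simps)

lemma det_cnjm [simp]: "det (cnjm \<alpha>) = cnj (det \<alpha>)"
  by (simp add: det_2)

section \<open>Moebius maps and homogeneous coordinates\<close>

definition hv :: "riemann_sphere \<Rightarrow> complex^2" where
  "hv z = (case z of None \<Rightarrow> vector [1, 0] | Some w \<Rightarrow> vector [w, 1])"

lemma hv_simps [simp]: "hv None $ 1 = 1" "hv None $ 2 = 0" "hv (Some w) $ 1 = w" "hv (Some w) $ 2 = 1"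
  by (simp_all add: hv_def)

lemma hv_nonzero: "hv z \<noteq> 0"
  by (cases z) (auto simp: vec_eq_iff forall_2)

lemma mv2_nth: "((M :: 'a::semiring_1^2^2) *v v) $ i = M$i$1 * v$1 + M$i$2 * v$2"
  by (simp add: matrix_vector_mult_def sum_2)

lemma vec2_eq_iff: "(v :: 'a^2) = w \<longleftrightarrow> v$1 = w$1 \<and> v$2 = w$2"
  by (auto simp: vec_eq_iff forall_2)

lemma hv_eqD:
  assumes "s *s hv z = t *s hv w" "s \<noteq> 0" "t \<noteq> 0" shows "z = w"
  using assms by (cases z; cases w) (auto simp: vec2_eq_iff)

lemma mult_vector_eq_0_imp:
  assumes "det (\<gamma> :: complex^2^2) \<noteq> 0" "\<gamma> *v v = 0" shows "v = 0"
  using assms by (metis invertible_det_nz invertible_left_inverse matrix_left_invertible_ker)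

text \<open>Removes the case distinction at infinity: composition, conjugation and equality of
  Moebius maps can be read off from matrices acting on homogeneous coordinates.\<close>

lemma moebius_hv:
  assumes "det \<gamma> \<noteq> 0"
  obtains s where "s \<noteq> 0" "\<gamma> *v hv z = s *s hv (moebius \<gamma> z)"
proof -
  have d: "\<gamma>$1$1 * \<gamma>$2$2 - \<gamma>$1$2 * \<gamma>$2$1 \<noteq> 0" using assms by (simp add: det_2)
  have "\<exists>s. \<gamma> *v hv z = s *s hv (moebius \<gamma> z)"
  proof (cases "(\<gamma> *v hv z) $ 2 = 0")
    case True
    then show ?thesis
      by (intro exI[of _ "(\<gamma> *v hv z) $ 1"])
        (cases z; auto simp: moebius_def vec2_eq_iff mv2_nth)
  next
    case False
    then show ?thesis
      by (intro exI[of _ "(\<gamma> *v hv z) $ 2"])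
        (cases z; auto simp: moebius_def vec2_eq_iff mv2_nth
          simp flip: add_divide_distrib distrib_right)
  qed
  then obtain s where s: "\<gamma> *v hv z = s *s hv (moebius \<gamma> z)" by blast
  moreover have "s \<noteq> 0"
  proof
    assume "s = 0"
    then have "\<gamma> *v hv z = 0" using s by simp
    then show False using mult_vector_eq_0_imp[OF assms] hv_nonzero by blast
  qed
  ultimately show thesis using that by blast
qed

lemma moebius_eqI:
  assumes "det \<gamma> \<noteq> 0" "\<gamma> *v hv z = s *s hv w" shows "moebius \<gamma> z = w"
proof -
  obtain t where t: "t \<noteq> 0" "\<gamma> *v hv z = t *s hv (moebius \<gamma> z)" using moebius_hv[OF assms(1)] by metis
  moreover have "s \<noteq> 0"
    using t hv_nonzero[of "moebius \<gamma> z"] assms(2) by (auto simp: vec2_eq_iff)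
  ultimately show ?thesis using assms(2) hv_eqD by metis
qed

lemma moebius_mult:
  assumes "det \<alpha> \<noteq> 0" "det \<beta> \<noteq> 0" shows "moebius (\<alpha> ** \<beta>) = moebius \<alpha> \<circ> moebius \<beta>"
proof
  fix z
  obtain s where s: "s \<noteq> 0" "\<beta> *v hv z = s *s hv (moebius \<beta> z)" using moebius_hv[OF assms(2)] by metis
  obtain t where t: "t \<noteq> 0" "\<alpha> *v hv (moebius \<beta> z) = t *s hv (moebius \<alpha> (moebius \<beta> z))"
    using moebius_hv[OF assms(1)] by metis
  have "(\<alpha> ** \<beta>) *v hv z = \<alpha> *v (s *s hv (moebius \<beta> z))"
    by (simp add: s(2) flip: matrix_vector_mul_assoc)
  also have "\<dots> = (s * t) *s hv (moebius \<alpha> (moebius \<beta> z))"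
    using t(2) by (simp add: vec.scale)
  finally show "moebius (\<alpha> ** \<beta>) z = (moebius \<alpha> \<circ> moebius \<beta>) z"
    using assms by (simp add: moebius_eqI det_mul)
qed

lemma moebius_one: "moebius (mat 1) = id"
  by (rule ext) (auto simp: moebius_def split: option.split)

lemma hv_conjugation: "hv (conjugation z) $ i = cnj (hv z $ i)"
  using exhaust_2[of i] by (cases z) (auto simp: conjugation_def)

lemma conjugation_conjugation [simp]: "conjugation \<circ> conjugation = id"
  by (rule ext) (simp add: conjugation_def option.map_comp o_def option.map_ident)

lemma conjugation_moebius:
  assumes "det \<gamma> \<noteq> 0"
  shows "conjugation \<circ> moebius \<gamma> = moebius (cnjm \<gamma>) \<circ> conjugation"
proof
  fix z
  obtain s where s: "s \<noteq> 0" "\<gamma> *v hv z = s *s hv (moebius \<gamma> z)" using moebius_hv[OF assms] by metis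
  have "(cnjm \<gamma> *v hv (conjugation z)) $ i = cnj ((\<gamma> *v hv z) $ i)" for i
    by (simp add: mv2_nth hv_conjugation)
  then have "cnjm \<gamma> *v hv (conjugation z) = cnj s *s hv (conjugation (moebius \<gamma> z))"
    by (simp add: s(2) vec2_eq_iff hv_conjugation)
  then show "(conjugation \<circ> moebius \<gamma>) z = (moebius (cnjm \<gamma>) \<circ> conjugation) z"
    using assms by (simp add: moebius_eqI)
qed

text \<open>The values at infinity and 0 make the columns proportional, and the value at 1 equates
  the two factors. The three points are fixed by complex conjugation, so the lemma also compares
  Moebius maps with anti-Moebius ones.\<close>

lemma moebius_eq_on_three_points:
  assumes "det \<alpha> \<noteq> 0" "det \<beta> \<noteq> 0"
    and "\<And>z. z \<in> {None, Some 0, Some 1} \<Longrightarrow> moebius \<alpha> z = moebius \<beta> z"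
  obtains s where "\<alpha> = mat s ** \<beta>"
proof -
  have "\<exists>t. \<alpha> *v hv z = t *s (\<beta> *v hv z)" if z: "z \<in> {None, Some 0, Some 1}" for z
  proof -
    obtain s where s: "s \<noteq> 0" "\<alpha> *v hv z = s *s hv (moebius \<alpha> z)" using moebius_hv[OF assms(1)] by metis
    obtain t where t: "t \<noteq> 0" "\<beta> *v hv z = t *s hv (moebius \<beta> z)" using moebius_hv[OF assms(2)] by metis
    show ?thesis using s t assms(3)[OF z] by (intro exI[of _ "s / t"]) simp
  qed
  from this[of None] this[of "Some 0"] this[of "Some 1"] obtain p q r where
    p: "\<alpha> *v hv None = p *s (\<beta> *v hv None)" and q: "\<alpha> *v hv (Some 0) = q *s (\<beta> *v hv (Some 0))"
    and r: "\<alpha> *v hv (Some 1) = r *s (\<beta> *v hv (Some 1))" by auto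
  have P: "\<alpha>$1$1 = p * \<beta>$1$1" "\<alpha>$2$1 = p * \<beta>$2$1" using p by (auto simp: vec2_eq_iff mv2_nth)
  have Q: "\<alpha>$1$2 = q * \<beta>$1$2" "\<alpha>$2$2 = q * \<beta>$2$2" using q by (auto simp: vec2_eq_iff mv2_nth)
  have R: "\<alpha>$1$1 + \<alpha>$1$2 = r * (\<beta>$1$1 + \<beta>$1$2)" "\<alpha>$2$1 + \<alpha>$2$2 = r * (\<beta>$2$1 + \<beta>$2$2)"
    using r by (auto simp: vec2_eq_iff mv2_nth)
  have e: "(p - r) * \<beta>$1$1 + (q - r) * \<beta>$1$2 = 0" "(p - r) * \<beta>$2$1 + (q - r) * \<beta>$2$2 = 0"
    using R by (simp_all add: P Q algebra_simps)
  have "(p - r) * det \<beta> = ((p - r) * \<beta>$1$1 + (q - r) * \<beta>$1$2) * \<beta>$2$2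
      - ((p - r) * \<beta>$2$1 + (q - r) * \<beta>$2$2) * \<beta>$1$2"
    by (simp add: det_2 algebra_simps)
  then have "p = r" using assms(2) e by simp
  have "(q - r) * det \<beta> = ((p - r) * \<beta>$2$1 + (q - r) * \<beta>$2$2) * \<beta>$1$1
      - ((p - r) * \<beta>$1$1 + (q - r) * \<beta>$1$2) * \<beta>$2$1"
    by (simp add: det_2 algebra_simps)
  then have "q = r" using assms(2) e by simp
  have "\<alpha> = mat r ** \<beta>" using \<open>p = r\<close> \<open>q = r\<close> P Q
    by (simp add: mat2_simps)
  then show thesis using that by blast
qed

text \<open>The maps would agree at infinity, 0 and 1, so \<alpha> and \<beta> would be proportional
  and \<open>moebius \<beta>\<close> would take the same value at i and -i.\<close>

lemma moebius_neq_moebius_conjugation: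
  assumes "det \<alpha> \<noteq> 0" "det \<beta> \<noteq> 0" shows "moebius \<alpha> \<noteq> moebius \<beta> \<circ> conjugation"
proof
  assume eq: "moebius \<alpha> = moebius \<beta> \<circ> conjugation"
  have "moebius \<alpha> z = moebius \<beta> z" if "z \<in> {None, Some 0, Some 1}" for z
    using that eq by (auto simp: conjugation_def)
  then obtain s where s: "\<alpha> = mat s ** \<beta>" using moebius_eq_on_three_points[OF assms] by blast
  have "s \<noteq> 0" using s assms(1) by (auto simp: det_2 matrix_mult_2_nth)
  obtain t where t: "t \<noteq> 0" "\<beta> *v hv (Some \<i>) = t *s hv (moebius \<beta> (Some \<i>))"
    using moebius_hv[OF assms(2)] by metis
  have "\<alpha> *v hv (Some \<i>) = (s * t) *s hv (moebius \<beta> (Some \<i>))"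
    using t(2) by (simp add: s vec2_eq_iff mv2_nth matrix_mult_2_nth mult.assoc flip: distrib_left)
  then have "moebius \<alpha> (Some \<i>) = moebius \<beta> (Some \<i>)" using moebius_eqI[OF assms(1)] by blast
  then have e: "moebius \<beta> (Some \<i>) = moebius \<beta> (Some (-\<i>))"
    using eq by (simp add: conjugation_def)
  obtain u where u: "u \<noteq> 0" "\<beta> *v hv (Some (-\<i>)) = u *s hv (moebius \<beta> (Some (-\<i>)))"
    using moebius_hv[OF assms(2)] by metis
  have "\<beta> *v (t *s hv (Some (-\<i>)) - u *s hv (Some \<i>)) = 0"
    using t(2) u(2) e by (simp add: matrix_vector_mult_diff_distrib vec.scale)
  then have "t *s hv (Some (-\<i>)) = u *s hv (Some \<i>)"
    using mult_vector_eq_0_imp[OF assms(2)] right_minus_eq by blast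
  then have "Some (-\<i>) = Some \<i>" using hv_eqD u(1) t(1) by blast
  then show False by (simp add: complex_eq_iff)
qed

section \<open>The action of pairs of matrices on Hermitian coordinates\<close>

text \<open>The complex linear extension of \<open>hermitian_matrix\<close>. Over the complex
  numbers the off-diagonal entries are independent, so C^4 becomes the space of all 2x2 matrices,
  with the form -det.\<close>

definition herm :: "complex^4 \<Rightarrow> complex^2^2" where
  "herm v = mat2 (v$1) (v$3 + \<i> * v$4) (v$3 - \<i> * v$4) (v$2)"

definition unherm :: "complex^2^2 \<Rightarrow> complex^4" where
  "unherm T = vector [T$1$1, T$2$2, (T$1$2 + T$2$1) / 2, (T$2$1 - T$1$2) * \<i> / 2]"

text \<open>The complexification of \<open>\<rho>(\<gamma>)\<close> is the case \<open>\<alpha> = \<gamma>\<close>, \<open>\<beta> = cnj \<gamma>\<close>.\<close>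

definition Rm :: "complex^2^2 \<Rightarrow> complex^2^2 \<Rightarrow> complex^4^4" where
  "Rm \<alpha> \<beta> = matrix (\<lambda>v. unherm (\<alpha> ** herm v ** transpose \<beta>))"

lemma vec4_eq_iff: "(v :: 'a^4) = w \<longleftrightarrow> v$1 = w$1 \<and> v$2 = w$2 \<and> v$3 = w$3 \<and> v$4 = w$4"
  by (auto simp: vec_eq_iff forall_4)

lemma vector_4_nth [simp]:
  "(vector [a, b, c, d] :: ('a::zero)^4) $ 1 = a" "(vector [a, b, c, d] :: ('a::zero)^4) $ 2 = b"
  "(vector [a, b, c, d] :: ('a::zero)^4) $ 3 = c" "(vector [a, b, c, d] :: ('a::zero)^4) $ 4 = d"
  by (simp_all add: vector_def)

lemma herm_unherm [simp]: "herm (unherm T) = T"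
  by (simp add: herm_def unherm_def mat2_eq_iff field_simps)

lemma unherm_herm [simp]: "unherm (herm v) = v"
  by (simp add: herm_def unherm_def vec4_eq_iff algebra_simps flip: mult.assoc)

lemma herm_inject: "herm v = herm w \<longleftrightarrow> v = w"
  by (metis unherm_herm)

lemma Rm_vec: "Rm \<alpha> \<beta> *v v = unherm (\<alpha> ** herm v ** transpose \<beta>)"
  unfolding Rm_def
proof (rule matrix_works)
  show "Vector_Spaces.linear (*s) (*s) (\<lambda>v. unherm (\<alpha> ** herm v ** transpose \<beta>))"
    by unfold_locales
      (simp_all add: vec4_eq_iff unherm_def herm_def matrix_mult_2_nth transpose_def field_simps)
qed

lemma herm_Rm: "herm (Rm \<alpha> \<beta> *v v) = \<alpha> ** herm v ** transpose \<beta>"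
  by (simp add: Rm_vec)

lemma matrix_eqI_herm:
  fixes P Q :: "complex^4^4"
  assumes "\<And>v. herm (P *v v) = herm (Q *v v)" shows "P = Q"
proof -
  have "P *v v = Q *v v" for v using assms[of v] by (simp only: herm_inject)
  then show ?thesis unfolding matrix_eq by blast
qed

lemma Rm_mult: "Rm \<alpha> \<beta> ** Rm \<alpha>' \<beta>' = Rm (\<alpha> ** \<alpha>') (\<beta> ** \<beta>')"
  by (rule matrix_eqI_herm)
    (simp only: matrix_vector_mul_assoc[symmetric] herm_Rm matrix_transpose_mul matrix_mul_assoc)

lemma Rm_one: "Rm (mat 1) (mat 1) = mat 1"
  by (rule matrix_eqI_herm) (simp add: herm_Rm)

lemma M_form_herm: "M_form v = - det (herm v)"
  by (simp add: M_form_def herm_def det_2 algebra_simps power2_eq_square)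

lemma M_form_Rm: "M_form (Rm \<alpha> \<beta> *v v) = det \<alpha> * det \<beta> * M_form v"
  by (simp add: M_form_herm herm_Rm det_mul)

lemma Rm_in_O_M: "det \<alpha> = 1 \<Longrightarrow> det \<beta> = 1 \<Longrightarrow> Rm \<alpha> \<beta> \<in> O_M"
  by (simp add: O_M_def M_form_Rm)

text \<open>The complexification of \<rho> of complex conjugation. On 2x2 matrices it is
  transposition, which is why it swaps the two arguments of \<open>Rm\<close>.\<close>

definition Cm :: "complex^4^4" where
  "Cm = (\<chi> i j. if i = j then (if i = 4 then -1 else 1) else 0)"

lemma Cm_vec: "Cm *v v = vector [v$1, v$2, v$3, - v$4]"
  by (simp add: Cm_def vec4_eq_iff matrix_vector_mult_def sum_4)

lemma herm_Cm: "herm (Cm *v v) = transpose (herm v)"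
  by (simp add: Cm_vec herm_def mat2_eq_iff transpose_def)

lemma Cm_Rm: "Cm ** Rm \<alpha> \<beta> = Rm \<beta> \<alpha> ** Cm"
  by (rule matrix_eqI_herm)
    (simp only: matrix_vector_mul_assoc[symmetric] herm_Rm herm_Cm matrix_transpose_mul
      matrix_mul_assoc transpose_transpose)

lemma Cm_Cm: "Cm ** Cm = mat 1"
  by (rule matrix_eqI_herm)
    (simp only: matrix_vector_mul_assoc[symmetric] herm_Cm transpose_transpose matrix_vector_mul_lid)

lemma Cm_in_O_M: "Cm \<in> O_M"
  by (simp add: O_M_def M_form_def Cm_vec)

lemma complexified_moebius_action:
  "map_matrix of_real (matrix (moebius_action \<gamma>)) = Rm \<gamma> (cnjm \<gamma>)"
  unfolding vec_eq_iff nth_map_matrix Rm_def matrix_def forall_4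
  by (simp add: moebius_action_def hermitian_coords_def unherm_def conjugate_transpose_def
      matrix_mult_2_nth hermitian_matrix_def herm_def transpose_def axis_def complex_eq_iff; simp add: field_simps)

lemma conjugation_action_eq: "conjugation_action v = vector [v$1, v$2, v$3, - v$4]"
  by (simp add: conjugation_action_def hermitian_coords_def hermitian_matrix_def)

lemma moebius_action_uminus: "moebius_action \<gamma> (- v) = - moebius_action \<gamma> v"
  by (simp add: vec4_eq_iff moebius_action_def hermitian_coords_def hermitian_matrix_def
      matrix_mult_2_nth; simp add: algebra_simps)

lemma complexified_moebius_conjugation_action:
  "map_matrix of_real (matrix (moebius_action \<gamma> \<circ> conjugation_action)) = Rm \<gamma> (cnjm \<gamma>) ** Cm"
proof -
  have col: "(P ** Cm) $ i $ j = P $ i $ j * (if j = 4 then -1 else 1)" for P i j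
    using exhaust_4[of j] by (auto simp: matrix_matrix_mult_def sum_4 Cm_def)
  have axis: "conjugation_action (axis j 1) = (if j = 4 then - axis j 1 else axis j 1)" for j
    using exhaust_4[of j] by (auto simp: conjugation_action_eq vec4_eq_iff axis_def)
  show ?thesis
    unfolding complexified_moebius_action[symmetric]
    by (simp add: vec_eq_iff col matrix_def moebius_action_uminus axis)
qed

section \<open>Circles as zero sets\<close>

text \<open>With (u, v) the homogeneous coordinates of the preimage of z, this is Im(u cnj v), which
  is |v|^2 Im(u/v) for v nonzero: a Hermitian form whose sign tells the side of the circle, valid at
  infinity as well.\<close>

definition side :: "complex^2^2 \<Rightarrow> riemann_sphere \<Rightarrow> real" where
  "side \<gamma> z = Im ((adj2 \<gamma> *v hv z) $ 1 * cnj ((adj2 \<gamma> *v hv z) $ 2))"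

lemma upper_half_plane_iff: "z \<in> upper_half_plane \<longleftrightarrow> Im (hv z $ 1 * cnj (hv z $ 2)) > 0"
  and lower_half_plane_iff: "z \<in> lower_half_plane \<longleftrightarrow> Im (hv z $ 1 * cnj (hv z $ 2)) < 0"
  and extended_real_line_iff: "z \<in> extended_real_line \<longleftrightarrow> Im (hv z $ 1 * cnj (hv z $ 2)) = 0"
  by (cases z; auto simp: upper_half_plane_def lower_half_plane_def extended_real_line_def complex_is_Real_iff)+

lemma moebius_image_iff:
  assumes "det \<gamma> = 1" shows "z \<in> moebius \<gamma> ` S \<longleftrightarrow> moebius (adj2 \<gamma>) z \<in> S"
proof -
  have "moebius \<gamma> (moebius (adj2 \<gamma>) z) = z" "moebius (adj2 \<gamma>) (moebius \<gamma> z) = z" for z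
    using assms moebius_mult[of \<gamma> "adj2 \<gamma>"] moebius_mult[of "adj2 \<gamma>" \<gamma>]
    by (simp_all add: adj2_mult moebius_one pointfree_idE)
  then show ?thesis by (metis image_iff)
qed

lemma side_iff:
  assumes "det \<gamma> = 1"
  shows "z \<in> moebius \<gamma> ` extended_real_line \<longleftrightarrow> side \<gamma> z = 0"
    "z \<in> moebius \<gamma> ` upper_half_plane \<longleftrightarrow> side \<gamma> z > 0"
    "z \<in> moebius \<gamma> ` lower_half_plane \<longleftrightarrow> side \<gamma> z < 0"
proof -
  obtain s where s: "s \<noteq> 0" "adj2 \<gamma> *v hv z = s *s hv (moebius (adj2 \<gamma>) z)"
    using moebius_hv[of "adj2 \<gamma>" z] assms by auto
  let ?w = "moebius (adj2 \<gamma>) z"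
  have "side \<gamma> z = Im (of_real ((cmod s)\<^sup>2) * (hv ?w $ 1 * cnj (hv ?w $ 2)))"
    unfolding side_def s(2) complex_norm_square by (simp add: mult_ac)
  moreover have "Im (of_real r * c) = r * Im c" for r c by simp
  ultimately have "side \<gamma> z = (cmod s)\<^sup>2 * Im (hv ?w $ 1 * cnj (hv ?w $ 2))" by (simp only:)
  then show "z \<in> moebius \<gamma> ` extended_real_line \<longleftrightarrow> side \<gamma> z = 0"
    "z \<in> moebius \<gamma> ` upper_half_plane \<longleftrightarrow> side \<gamma> z > 0"
    "z \<in> moebius \<gamma> ` lower_half_plane \<longleftrightarrow> side \<gamma> z < 0"
    unfolding moebius_image_iff[OF assms] upper_half_plane_iff lower_half_plane_iff extended_real_line_iff
    using s(1) by (simp_all add: zero_less_mult_iff mult_less_0_iff)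
qed

text \<open>Coefficients of the equation A(x^2 + y^2) + P x + Q y + C = 0 of the circle. For A
  nonzero its discriminant 1 gives radius 1/(2|A|), and the centre has imaginary part -Q/(2A); so
  |Q| < 1 means that the circle crosses the real line.\<close>

definition cA :: "complex^2^2 \<Rightarrow> real" where "cA \<gamma> = - Im (\<gamma>$2$2 * cnj (\<gamma>$2$1))"
definition cP :: "complex^2^2 \<Rightarrow> real" where "cP \<gamma> = Im (\<gamma>$2$2 * cnj (\<gamma>$1$1) + \<gamma>$1$2 * cnj (\<gamma>$2$1))"
definition cQ :: "complex^2^2 \<Rightarrow> real" where "cQ \<gamma> = Re (\<gamma>$2$2 * cnj (\<gamma>$1$1) - \<gamma>$1$2 * cnj (\<gamma>$2$1))"
definition cC :: "complex^2^2 \<Rightarrow> real" where "cC \<gamma> = - Im (\<gamma>$1$2 * cnj (\<gamma>$1$1))"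

lemma side_None: "side \<gamma> None = cA \<gamma>"
  by (simp add: side_def mv2_nth cA_def)

lemma side_Some: "side \<gamma> (Some z) = cA \<gamma> * ((Re z)\<^sup>2 + (Im z)\<^sup>2) + cP \<gamma> * Re z + cQ \<gamma> * Im z + cC \<gamma>"
  by (simp add: side_def mv2_nth cA_def cP_def cQ_def cC_def power2_eq_square algebra_simps)

lemma circle_discriminant:
  assumes "det \<gamma> = 1" shows "(cP \<gamma>)\<^sup>2 + (cQ \<gamma>)\<^sup>2 - 4 * cA \<gamma> * cC \<gamma> = 1"
proof -
  have "(cP \<gamma>)\<^sup>2 + (cQ \<gamma>)\<^sup>2 - 4 * cA \<gamma> * cC \<gamma> = (Re (det \<gamma>))\<^sup>2 + (Im (det \<gamma>))\<^sup>2"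
    by (simp add: cA_def cP_def cQ_def cC_def det_2 power2_eq_square algebra_simps)
  then show ?thesis using assms by simp
qed

text \<open>At a point of the circle the gradient of \<^const>\<open>side\<close> is a unit vector.\<close>

lemma side_near_circle:
  assumes "det \<gamma> = 1" "side \<gamma> (Some u) = 0"
  obtains g where "cmod g = 1" "\<And>t::real. side \<gamma> (Some (u + of_real t * g)) = t + cA \<gamma> * t\<^sup>2"
proof -
  define g1 where "g1 = 2 * cA \<gamma> * Re u + cP \<gamma>"
  define g2 where "g2 = 2 * cA \<gamma> * Im u + cQ \<gamma>"
  have "g1\<^sup>2 + g2\<^sup>2 = 4 * cA \<gamma> * side \<gamma> (Some u) + ((cP \<gamma>)\<^sup>2 + (cQ \<gamma>)\<^sup>2 - 4 * cA \<gamma> * cC \<gamma>)"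
    by (simp add: g1_def g2_def side_Some power2_eq_square algebra_simps)
  then have g: "g1\<^sup>2 + g2\<^sup>2 = 1" using assms circle_discriminant by simp
  show thesis
  proof
    show "cmod (Complex g1 g2) = 1" using g by (simp add: cmod_def)
    fix t :: real
    have "side \<gamma> (Some (u + of_real t * Complex g1 g2))
        = side \<gamma> (Some u) + t * (g1\<^sup>2 + g2\<^sup>2) + cA \<gamma> * t\<^sup>2 * (g1\<^sup>2 + g2\<^sup>2)"
      by (simp add: side_Some power2_eq_square algebra_simps)
        (simp add: g1_def g2_def algebra_simps)
    then show "side \<gamma> (Some (u + of_real t * Complex g1 g2)) = t + cA \<gamma> * t\<^sup>2"
      using g assms(2) by simp
  qed
qed

lemma side_takes_both_signs:
  assumes "det \<gamma> = 1" "side \<gamma> (Some u) = 0" "open U" "u \<in> U"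
  shows "\<exists>z\<in>U. side \<gamma> (Some z) > 0" "\<exists>z\<in>U. side \<gamma> (Some z) < 0"
proof -
  obtain g where g: "cmod g = 1" "\<And>t::real. side \<gamma> (Some (u + of_real t * g)) = t + cA \<gamma> * t\<^sup>2"
    using side_near_circle[OF assms(1,2)] by blast
  obtain e where e: "e > 0" "ball u e \<subseteq> U" using assms(3,4) openE by blast
  \<comment> \<open>The second bound keeps |A t| below 1, so that t + A t^2 has the sign of t, both
    at t and at -t.\<close>
  define t where "t = min (e / 2) (1 / (2 * (\<bar>cA \<gamma>\<bar> + 1)))"
  have t: "t > 0" "t < e" using e(1) by (auto simp: t_def)
  have "t * (\<bar>cA \<gamma>\<bar> + 1) \<le> 1 / (2 * (\<bar>cA \<gamma>\<bar> + 1)) * (\<bar>cA \<gamma>\<bar> + 1)"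
    by (intro mult_right_mono) (simp_all add: t_def)
  also have "\<dots> = 1 / 2" by (simp add: field_simps)
  finally have "\<bar>cA \<gamma>\<bar> * t < 1" using t(1) by (simp add: algebra_simps)
  then have "\<bar>cA \<gamma> * t\<bar> < 1" using t(1) by (simp add: abs_mult)
  then have "t * (1 + cA \<gamma> * t) > 0" "t * (cA \<gamma> * t - 1) < 0" using t(1)
    by (auto simp: zero_less_mult_iff mult_less_0_iff abs_less_iff)
  then have "t + cA \<gamma> * t\<^sup>2 > 0" "- t + cA \<gamma> * (- t)\<^sup>2 < 0"
    by (simp_all add: power2_eq_square algebra_simps)
  then have "side \<gamma> (Some (u + of_real t * g)) > 0" "side \<gamma> (Some (u + of_real (- t) * g)) < 0"
    by (simp_all only: g(2))
  moreover have "u + of_real t * g \<in> U" "u + of_real (- t) * g \<in> U"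
    using e(2) t g(1) by (auto simp: dist_norm norm_mult intro!: subsetD[OF e(2)])
  ultimately show "\<exists>z\<in>U. side \<gamma> (Some z) > 0" "\<exists>z\<in>U. side \<gamma> (Some z) < 0" by blast+
qed

text \<open>A proper circle has a highest and a lowest point, which cannot both be real; a line
  inside the real line is the real line itself.\<close>

lemma circle_within_real_line:
  assumes "det \<gamma> = 1" "\<And>z. side \<gamma> z = 0 \<Longrightarrow> z \<in> extended_real_line"
  shows "cA \<gamma> = 0" "cP \<gamma> = 0" "cC \<gamma> = 0" "cQ \<gamma> = 1 \<or> cQ \<gamma> = -1"
proof -
  have real: "Im z = 0" if "side \<gamma> (Some z) = 0" for z
    using assms(2)[OF that] by (simp add: extended_real_line_iff)
  note disc = circle_discriminant[OF assms(1)]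
  show A: "cA \<gamma> = 0"
  proof (rule ccontr)
    assume A: "cA \<gamma> \<noteq> 0"
    \<comment> \<open>The two points with extreme imaginary part, for e = 1 and e = -1.\<close>
    have "side \<gamma> (Some (Complex (- cP \<gamma> / (2 * cA \<gamma>)) ((e - cQ \<gamma>) / (2 * cA \<gamma>)))) = 0"
      if e: "e\<^sup>2 = 1" for e
    proof -
      have "4 * cA \<gamma> * side \<gamma> (Some (Complex (- cP \<gamma> / (2 * cA \<gamma>)) ((e - cQ \<gamma>) / (2 * cA \<gamma>))))
          = e\<^sup>2 - ((cP \<gamma>)\<^sup>2 + (cQ \<gamma>)\<^sup>2 - 4 * cA \<gamma> * cC \<gamma>)"
        using A by (simp add: side_Some power2_eq_square field_simps)
      then show ?thesis using A e disc by simp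
    qed
    from real[OF this[of 1]] real[OF this[of "-1"]] show False using A by simp
  qed
  \<comment> \<open>The foot -C (P, Q) of the perpendicular from the origin, moved by s along the
    direction (-Q, P) of the line; (P, Q) has length 1.\<close>
  have line: "side \<gamma> (Some (Complex (- cC \<gamma> * cP \<gamma> - s * cQ \<gamma>) (- cC \<gamma> * cQ \<gamma> + s * cP \<gamma>))) = 0" for s
  proof -
    have "side \<gamma> (Some (Complex (- cC \<gamma> * cP \<gamma> - s * cQ \<gamma>) (- cC \<gamma> * cQ \<gamma> + s * cP \<gamma>)))
        = cC \<gamma> * (1 - ((cP \<gamma>)\<^sup>2 + (cQ \<gamma>)\<^sup>2))"
      by (simp add: side_Some A power2_eq_square algebra_simps)
    then show ?thesis using disc A by simp
  qed
  from real[OF line[of 0]] real[OF line[of 1]] show P: "cP \<gamma> = 0" by simp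
  then have "(cQ \<gamma>)\<^sup>2 = 1" using disc A by simp
  then show Q: "cQ \<gamma> = 1 \<or> cQ \<gamma> = -1" by (simp add: power2_eq_1_iff)
  show "cC \<gamma> = 0" using real[OF line[of 0]] Q by auto
qed

section \<open>The fundamental packing avoids the upper half plane\<close>

lemma oriented_bianchi_circlesE:
  assumes "C \<in> oriented_bianchi_circles K"
  obtains \<gamma> where "det \<gamma> = 1" "\<And>i j. \<gamma>$i$j \<in> ring_of_integers K"
    "circle_points C = {z. side \<gamma> z = 0}"
    "circle_interior C = {z. side \<gamma> z > 0} \<and> circle_exterior C = {z. side \<gamma> z < 0} \<or>
     circle_interior C = {z. side \<gamma> z < 0} \<and> circle_exterior C = {z. side \<gamma> z > 0}"
proof -
  obtain \<gamma> H where g: "det \<gamma> = 1" "\<And>i j. \<gamma>$i$j \<in> ring_of_integers K"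
    and H: "H \<in> {upper_half_plane, lower_half_plane}"
    and C: "C = Oriented_Circle (moebius \<gamma> ` extended_real_line) (moebius \<gamma> ` H)"
    using assms unfolding oriented_bianchi_circles_def PSL2_def by blast
  have im: "moebius \<gamma> ` extended_real_line = {z. side \<gamma> z = 0}"
    "moebius \<gamma> ` upper_half_plane = {z. side \<gamma> z > 0}"
    "moebius \<gamma> ` lower_half_plane = {z. side \<gamma> z < 0}"
    using side_iff[OF g(1)] by blast+
  show thesis
  proof (rule that[OF g])
    show "circle_points C = {z. side \<gamma> z = 0}" by (simp add: C im)
    show "circle_interior C = {z. side \<gamma> z > 0} \<and> circle_exterior C = {z. side \<gamma> z < 0} \<or>
      circle_interior C = {z. side \<gamma> z < 0} \<and> circle_exterior C = {z. side \<gamma> z > 0}"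
    proof (cases "H = upper_half_plane")
      case True
      have "- ({z. side \<gamma> z = 0} \<union> {z. side \<gamma> z > 0}) = {z. side \<gamma> z < 0}" by auto
      then show ?thesis by (simp add: C True im circle_exterior_def)
    next
      case False
      then have H: "H = lower_half_plane" using H by blast
      have "- ({z. side \<gamma> z = 0} \<union> {z. side \<gamma> z < 0}) = {z. side \<gamma> z > 0}" by auto
      then show ?thesis by (simp add: C H im circle_exterior_def)
    qed
  qed
qed

text \<open>The half plane is open, and near each of its points the circle has points of both
  sides.\<close>

lemma bianchi_circle_sides_meet_half_plane:
  assumes "C \<in> oriented_bianchi_circles K" "H \<in> {upper_half_plane, lower_half_plane}"
    "circle_points C \<inter> H \<noteq> {}"
  shows "circle_interior C \<inter> H \<noteq> {}"
proof -
  obtain \<gamma> where g: "det \<gamma> = 1" "circle_points C = {z. side \<gamma> z = 0}"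
    "circle_interior C = {z. side \<gamma> z > 0} \<or> circle_interior C = {z. side \<gamma> z < 0}"
    using oriented_bianchi_circlesE[OF assms(1)] by metis
  obtain U where U: "open U" "H = Some ` U"
    using assms(2) open_halfspace_Im_gt[of 0] open_halfspace_Im_lt[of 0]
    unfolding upper_half_plane_def lower_half_plane_def by blast
  obtain u where u: "u \<in> U" "side \<gamma> (Some u) = 0" using assms(3) unfolding g(2) U(2) by blast
  from side_takes_both_signs[OF g(1) u(2) U(1) u(1)] show ?thesis
    using g(3) unfolding U(2) by blast
qed

abbreviation base_circle :: oriented_circle where
  "base_circle \<equiv> Oriented_Circle extended_real_line upper_half_plane"

lemma base_circle_exterior: "circle_exterior base_circle = lower_half_plane"
  by (auto simp: circle_exterior_def extended_real_line_iff upper_half_plane_iff lower_half_plane_iff)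

lemma (in imaginary_quadratic) base_circle_in: "base_circle \<in> oriented_bianchi_circles K"
proof -
  have "(mat 1 :: complex^2^2)$i$j \<in> OK" for i j by (simp add: mat_def OK_0 OK_1)
  then have "moebius (mat 1) \<in> PSL2 OK" unfolding PSL2_def by (auto intro!: exI[of _ "mat 1"])
  then show ?thesis unfolding oriented_bianchi_circles_def moebius_one
    by (intro CollectI exI[of _ id] exI[of _ upper_half_plane]) simp
qed

text \<open>Meeting the lower half plane is what makes the invariant inductive: a tangent circle
  that met the upper half plane would make the pair straddle the real line. If the predecessor is
  the real line itself, disjointness of the interiors replaces this argument.\<close>

lemma (in imaginary_quadratic) fundamental_packing_cases:
  assumes "C \<in> fundamental_packing K"
  shows "C = base_circle \<or> C \<in> oriented_bianchi_circles K \<and>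
    circle_points C \<inter> upper_half_plane = {} \<and> circle_points C \<inter> lower_half_plane \<noteq> {}"
  using assms
proof induction
  case base
  then show ?case by simp
next
  case (step C C')
  have tang: "\<exists>z. circle_points C \<inter> circle_points C' = {z}"
    and disj: "circle_interior C \<inter> circle_interior C' = {}"
    and ns: "\<not> straddles {C, C'} base_circle"
    using step.hyps(3) base_circle_in by (auto simp: immediately_tangent_def tangent_def)
  have ns': "circle_points C \<inter> lower_half_plane \<noteq> {} \<or> circle_points C' \<inter> lower_half_plane \<noteq> {}
      \<Longrightarrow> circle_points C' \<inter> upper_half_plane = {}"
    using ns unfolding straddles_def base_circle_exterior by auto
  have missU: "circle_points C' \<inter> upper_half_plane = {}"
  proof (cases "C = base_circle")
    case True
    then show ?thesis
      using bianchi_circle_sides_meet_half_plane[OF step.hyps(2), of upper_half_plane] disj by auto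
  next
    case False
    then show ?thesis using step.IH ns' by blast
  qed
  show ?case
  proof (cases "circle_points C' \<inter> lower_half_plane = {}")
    case False
    then show ?thesis using missU step.hyps(2) by blast
  next
    case True
    obtain \<gamma> where g: "det \<gamma> = 1" "circle_points C' = {z. side \<gamma> z = 0}"
      "circle_interior C' = {z. side \<gamma> z > 0} \<or> circle_interior C' = {z. side \<gamma> z < 0}"
      using oriented_bianchi_circlesE[OF step.hyps(2)] by metis
    have "z \<in> extended_real_line" if "side \<gamma> z = 0" for z
    proof -
      have "z \<in> circle_points C'" using that g(2) by simp
      then show ?thesis using True missU
        by (metis IntI circle_exterior_def empty_iff upper_half_plane_iff lower_half_plane_iff
            extended_real_line_iff linorder_neqE_linordered_idom)
    qed
    note co = circle_within_real_line[OF g(1) this]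
    have sd: "side \<gamma> z = cQ \<gamma> * Im (hv z $ 1 * cnj (hv z $ 2))" for z
      by (cases z) (simp_all add: side_None side_Some co(1-3))
    have Q: "cQ \<gamma> \<noteq> 0" using co(4) by auto
    have pts: "circle_points C' = extended_real_line"
      using Q by (auto simp: g(2) sd extended_real_line_iff)
    have int: "circle_interior C' = upper_half_plane \<or> circle_interior C' = lower_half_plane"
    proof -
      have "{z. side \<gamma> z > 0} \<in> {upper_half_plane, lower_half_plane}"
        "{z. side \<gamma> z < 0} \<in> {upper_half_plane, lower_half_plane}"
        using co(4) by (auto simp: sd upper_half_plane_iff lower_half_plane_iff)
      then show ?thesis using g(3) by auto
    qed
    have "C \<noteq> base_circle"
    proof
      assume "C = base_circle"
      then obtain z where "extended_real_line = {z}" using tang pts by auto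
      moreover have "None \<in> extended_real_line" "Some 0 \<in> extended_real_line"
        by (auto simp: extended_real_line_def)
      ultimately show False by (metis option.distinct(1) singletonD)
    qed
    then have "C \<in> oriented_bianchi_circles K \<and> circle_points C \<inter> lower_half_plane \<noteq> {}"
      using step.IH by argo
    then have C: "C \<in> oriented_bianchi_circles K" "circle_points C \<inter> lower_half_plane \<noteq> {}" by simp_all
    \<comment> \<open>Excludes the real line with reversed orientation, whose interior is the lower
      half plane.\<close>
    have "circle_interior C \<inter> lower_half_plane \<noteq> {}"
      by (rule bianchi_circle_sides_meet_half_plane[OF C(1) _ C(2)]) simp
    then have "circle_interior C' = upper_half_plane" using int disj by blast
    then have "C' = base_circle" using pts by (cases C') simp
    then show ?thesis by blast
  qed
qed

lemma (in imaginary_quadratic) fundamental_packing_upper_half_plane: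
  "(\<Union>(circle_points ` fundamental_packing K)) \<inter> upper_half_plane = {}"
proof -
  have "circle_points base_circle \<inter> upper_half_plane = {}"
    by (auto simp: extended_real_line_iff upper_half_plane_iff)
  then show ?thesis using fundamental_packing_cases by blast
qed

section \<open>A circle immediately tangent to the real line\<close>

text \<open>The sign of A is part of the conclusion because A is the value of \<open>side\<close> at
  infinity.\<close>

lemma quadratic_weak_sign:
  fixes A P C :: real
  assumes "P\<^sup>2 \<le> 4 * A * C"
  shows "(A \<ge> 0 \<and> (\<forall>x. A * x\<^sup>2 + P * x + C \<ge> 0)) \<or> (A \<le> 0 \<and> (\<forall>x. A * x\<^sup>2 + P * x + C \<le> 0))"
proof -
  have eq: "4 * A * (A * x\<^sup>2 + P * x + C) = (2 * A * x + P)\<^sup>2 + (4 * A * C - P\<^sup>2)" for x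
    by (simp add: power2_eq_square algebra_simps)
  have nn: "4 * A * (A * x\<^sup>2 + P * x + C) \<ge> 0" for x unfolding eq using assms by simp
  consider "A > 0" | "A < 0" | "A = 0" by linarith
  then show ?thesis
  proof cases
    case 1
    then show ?thesis using nn by (auto simp: zero_le_mult_iff)
  next
    case 2
    then show ?thesis using nn by (auto simp: zero_le_mult_iff)
  next
    case 3
    then have "P = 0" using assms by simp
    then show ?thesis using 3 by auto
  qed
qed

locale bianchi = imaginary_quadratic +
  fixes h :: real and \<omega> :: complex
  assumes h: "h \<ge> 1" and \<omega>: "\<omega> \<in> OK" "Im \<omega> = h"
    and Im_OK: "\<And>x. x \<in> OK \<Longrightarrow> \<exists>k::int. Im x = of_int k * h"
begin

definition SLK :: "(complex^2^2) set" where
  "SLK = {\<gamma>. (\<forall>i j. \<gamma>$i$j \<in> OK) \<and> det \<gamma> = 1}"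

lemma SLK_mult: "\<alpha> \<in> SLK \<Longrightarrow> \<beta> \<in> SLK \<Longrightarrow> \<alpha> ** \<beta> \<in> SLK"
  by (simp add: SLK_def det_mul matrix_mult_2_nth OK_add OK_mult)

lemma SLK_iff_mat2: "\<gamma> \<in> SLK \<longleftrightarrow>
    \<gamma>$1$1 \<in> OK \<and> \<gamma>$1$2 \<in> OK \<and> \<gamma>$2$1 \<in> OK \<and> \<gamma>$2$2 \<in> OK \<and> det \<gamma> = 1"
  by (auto simp: SLK_def forall_2)

lemma Im_product:
  assumes "x \<in> OK" "y \<in> OK" obtains k :: int where "Im x * Im y = of_int k * h\<^sup>2"
proof -
  obtain k l :: int where "Im x = of_int k * h" "Im y = of_int l * h" using Im_OK assms by metis
  then have "Im x * Im y = of_int (k * l) * h\<^sup>2" by (simp add: power2_eq_square)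
  then show thesis by (rule that)
qed

text \<open>This is where \<open>\<rat>(\<surd>-3)\<close> is excluded: the circles do not cross the real line.\<close>

lemma cQ_square_ge_1:
  assumes "\<gamma> \<in> SLK" shows "(cQ \<gamma>)\<^sup>2 \<ge> 1"
proof -
  have g: "\<gamma>$i$j \<in> OK" "det \<gamma> = 1" for i j using assms by (simp_all add: SLK_def)
  obtain k l :: int where kl: "Im (\<gamma>$1$1) * Im (\<gamma>$2$2) = of_int k * h\<^sup>2"
    "Im (\<gamma>$1$2) * Im (\<gamma>$2$1) = of_int l * h\<^sup>2" using Im_product g(1) by metis
  have "cQ \<gamma> = Re (det \<gamma>) + 2 * (Im (\<gamma>$1$1) * Im (\<gamma>$2$2) - Im (\<gamma>$1$2) * Im (\<gamma>$2$1))"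
    by (simp add: cQ_def det_2 algebra_simps)
  then have Q: "cQ \<gamma> = 1 + 2 * (of_int (k - l) * h\<^sup>2)" using g(2) by (simp add: kl algebra_simps)
  have h2: "h\<^sup>2 \<ge> 1" using h by simp
  \<comment> \<open>Q is 1 plus an integer multiple of 2 h^2; a negative multiple lowers it to at
    most 1 - 2 = -1 because h >= 1.\<close>
  have "\<bar>cQ \<gamma>\<bar> \<ge> 1"
  proof (cases "k - l \<ge> 0")
    case True
    then have "of_int (k - l) * h\<^sup>2 \<ge> 0" by simp
    then show ?thesis using Q by linarith
  next
    case False
    then have "of_int (k - l) \<le> (-1 :: real)" by linarith
    then have "of_int (k - l) * h\<^sup>2 \<le> -1 * h\<^sup>2" by (intro mult_right_mono) auto
    then show ?thesis using Q h2 by linarith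
  qed
  then show ?thesis using abs_le_square_iff[of 1 "cQ \<gamma>"] by simp
qed

lemma side_weak_sign_real_line:
  assumes "\<gamma> \<in> SLK"
  shows "(\<forall>z\<in>extended_real_line. side \<gamma> z \<ge> 0) \<or> (\<forall>z\<in>extended_real_line. side \<gamma> z \<le> 0)"
proof -
  have "det \<gamma> = 1" using assms by (simp add: SLK_def)
  then have "(cP \<gamma>)\<^sup>2 \<le> 4 * cA \<gamma> * cC \<gamma>" using circle_discriminant[of \<gamma>] cQ_square_ge_1[OF assms] by linarith
  from quadratic_weak_sign[OF this] show ?thesis
    by (auto simp: extended_real_line_def side_None side_Some elim!: Reals_cases)
qed

text \<open>Translation by -\<omega>. It takes the real line to the line Im = -h; h is the least
  distance possible since all imaginary parts of integers are multiples of h.\<close>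

definition T\<omega> :: "complex^2^2" where "T\<omega> = mat2 1 (- \<omega>) 0 1"

lemma T\<omega>: "T\<omega> \<in> SLK" "adj2 T\<omega> \<in> SLK" "det T\<omega> = 1"
  using \<omega> by (simp_all add: SLK_iff_mat2 T\<omega>_def det_2 OK_0 OK_1 OK_minus)

lemma T\<omega>_image: "moebius T\<omega> ` extended_real_line = insert None {Some z | z. Im z = - h}"
proof (rule Set.set_eqI)
  fix z
  have "side T\<omega> z = 0 \<longleftrightarrow> z \<in> insert None {Some z | z. Im z = - h}"
    using \<omega> by (cases z) (auto simp: side_def mv2_nth T\<omega>_def)
  then show "z \<in> moebius T\<omega> ` extended_real_line \<longleftrightarrow> z \<in> insert None {Some z | z. Im z = - h}"
    unfolding side_iff(1)[OF T\<omega>(3)] .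
qed

lemma side_translate: "side \<gamma> (moebius T\<omega> z) = side (adj2 T\<omega> ** \<gamma>) z"
  by (cases z) (simp_all add: moebius_def T\<omega>_def side_def mv2_nth matrix_mult_2_nth algebra_simps)

abbreviation next_circle :: oriented_circle where
  "next_circle \<equiv> Oriented_Circle (moebius T\<omega> ` extended_real_line) (moebius T\<omega> ` lower_half_plane)"

text \<open>No Bianchi circle crosses either of the two lines, so D would have to separate them. As
  infinity lies on both, D would be a line parallel to them, strictly in between; but such lines
  have heights that are multiples of h.\<close>

lemma next_circle_not_straddled:
  assumes "D \<in> oriented_bianchi_circles K" shows "\<not> straddles {base_circle, next_circle} D"
proof
  assume str: "straddles {base_circle, next_circle} D"
  obtain \<gamma> where g: "det \<gamma> = 1" "\<And>i j. \<gamma>$i$j \<in> OK"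
    "circle_interior D = {z. side \<gamma> z > 0} \<and> circle_exterior D = {z. side \<gamma> z < 0} \<or>
     circle_interior D = {z. side \<gamma> z < 0} \<and> circle_exterior D = {z. side \<gamma> z > 0}"
    using oriented_bianchi_circlesE[OF assms] by metis
  have g': "\<gamma> \<in> SLK" using g by (simp add: SLK_def)
  let ?R = extended_real_line and ?L = "moebius T\<omega> ` extended_real_line"
  obtain p q where p: "p \<in> ?R \<union> ?L" "side \<gamma> p > 0" and q: "q \<in> ?R \<union> ?L" "side \<gamma> q < 0"
    using str g(3) unfolding straddles_def by auto
  have R: "(\<forall>z\<in>?R. side \<gamma> z \<ge> 0) \<or> (\<forall>z\<in>?R. side \<gamma> z \<le> 0)"
    using side_weak_sign_real_line[OF g'] .
  have L: "(\<forall>z\<in>?L. side \<gamma> z \<ge> 0) \<or> (\<forall>z\<in>?L. side \<gamma> z \<le> 0)"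
    using side_weak_sign_real_line[OF SLK_mult[OF T\<omega>(2) g']] by (simp add: side_translate)
  have None: "None \<in> ?R" "None \<in> ?L" unfolding T\<omega>_image by (simp_all add: extended_real_line_def)
  \<comment> \<open>Infinity lies on both lines: a positive value there would make both lines weakly
    positive, contradicting q, and a negative one contradicts p.\<close>
  have A: "cA \<gamma> = 0"
  proof -
    have "side \<gamma> None \<ge> 0" using R L None p by (metis Un_iff linorder_not_le)
    moreover have "side \<gamma> None \<le> 0" using R L None q by (metis Un_iff linorder_not_le)
    ultimately show ?thesis by (simp add: side_None)
  qed
  have disc: "(cP \<gamma>)\<^sup>2 + (cQ \<gamma>)\<^sup>2 = 1" using circle_discriminant[OF g(1)] A by simp
  then have P: "cP \<gamma> = 0" and Q2: "(cQ \<gamma>)\<^sup>2 = 1" using cQ_square_ge_1[OF g']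
    by (smt (verit) zero_le_power2 power_eq_0_iff zero_less_numeral)+
  then have Q: "cQ \<gamma> = 1 \<or> cQ \<gamma> = -1" by (simp add: power2_eq_1_iff)
  have "\<gamma>$1$2 * cnj (\<gamma>$1$1) \<in> OK" using g(2) by (intro OK_mult OK_cnj)
  then obtain k :: int where k: "Im (\<gamma>$1$2 * cnj (\<gamma>$1$1)) = of_int k * h" using Im_OK by blast
  then have C: "cC \<gamma> = of_int (- k) * h" by (simp add: cC_def)
  have valR: "side \<gamma> z = 0 \<or> side \<gamma> z = of_int (- k) * h" if "z \<in> ?R" for z
    using that by (auto simp: extended_real_line_def side_None side_Some A P C elim!: Reals_cases)
  have valL: "side \<gamma> z = 0 \<or> side \<gamma> z = (of_int (- k) - cQ \<gamma>) * h" if "z \<in> ?L" for z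
    using that by (auto simp: T\<omega>_image side_None side_Some A P C algebra_simps)
  have h0: "h > 0" using h by simp
  obtain c :: int where c: "cQ \<gamma> = of_int c" "c = 1 \<or> c = -1" using Q by (metis of_int_1 of_int_minus)
  have "\<not> (p \<in> ?R \<and> q \<in> ?R)" using R p(2) q(2) by (metis linorder_not_le)
  moreover have "\<not> (p \<in> ?L \<and> q \<in> ?L)" using L p(2) q(2) by (metis linorder_not_le)
  ultimately have "p \<in> ?R \<and> q \<in> ?L \<or> p \<in> ?L \<and> q \<in> ?R" using p(1) q(1) by blast
  then have "(of_int (- k) * h > 0 \<and> (of_int (- k) - cQ \<gamma>) * h < 0) \<or>
      (of_int (- k) * h < 0 \<and> (of_int (- k) - cQ \<gamma>) * h > 0)"
    using valR valL p(2) q(2) by (metis less_irrefl)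
  \<comment> \<open>As c is 1 or -1, the integers -k and -k - c are neighbours and cannot have
    strictly opposite signs.\<close>
  then have "(- k > 0 \<and> - k - c < 0) \<or> (- k < 0 \<and> - k - c > 0)"
    using h0 unfolding c(1) by (simp add: zero_less_mult_iff mult_less_0_iff) linarith
  then show False using c(2) by linarith
qed

lemma next_circle_in_fundamental_packing: "next_circle \<in> fundamental_packing K"
proof (rule fundamental_packing.step[OF fundamental_packing.base])
  have "moebius T\<omega> \<in> PSL2 OK" using T\<omega>(1) unfolding PSL2_def SLK_def by blast
  then show nc: "next_circle \<in> oriented_bianchi_circles K"
    unfolding oriented_bianchi_circles_def by blast
  have "extended_real_line \<inter> moebius T\<omega> ` extended_real_line = {None}"
    using h unfolding T\<omega>_image by (auto simp: extended_real_line_def complex_is_Real_iff)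
  then have t: "tangent base_circle next_circle" by (simp add: tangent_def)
  have "side T\<omega> z \<ge> 0" if "z \<in> upper_half_plane" for z
    using that h \<omega> by (cases z) (auto simp: upper_half_plane_iff side_def mv2_nth T\<omega>_def)
  then have "upper_half_plane \<inter> moebius T\<omega> ` lower_half_plane = {}"
    using side_iff(3)[OF T\<omega>(3)] by force
  then show "immediately_tangent K base_circle next_circle"
    unfolding immediately_tangent_def using t next_circle_not_straddled by simp
qed

text \<open>Four points that do not lie on one circle; Zariski density needs no more of the
  packing.\<close>

lemma points_of_fundamental_packing:
  "{None, Some 0, Some 1, Some (- \<omega>)} \<subseteq> \<Union>(circle_points ` fundamental_packing K)"
proof -
  have "{None, Some 0, Some 1} \<subseteq> circle_points base_circle" by (auto simp: extended_real_line_def)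
  moreover have "Some (- \<omega>) \<in> circle_points next_circle" using \<omega> by (simp add: T\<omega>_image)
  ultimately show ?thesis
    using fundamental_packing.base[of K] next_circle_in_fundamental_packing by blast
qed

end

section \<open>Zariski closure\<close>

lemma matrix_polynomial_sum:
  "finite I \<Longrightarrow> (\<And>i. i \<in> I \<Longrightarrow> matrix_polynomial (f i)) \<Longrightarrow> matrix_polynomial (\<lambda>g. \<Sum>i\<in>I. f i g)"
  by (induction I rule: finite_induct) (auto intro: matrix_polynomial.intros)

lemma matrix_polynomial_translate:
  assumes "matrix_polynomial p"
  shows "matrix_polynomial (\<lambda>g. p (x ** g))" "matrix_polynomial (\<lambda>g. p (g ** x))"
proof -
  show "matrix_polynomial (\<lambda>g. p (x ** g))"
    using assms
  proof induction
    case (entry i j)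
    show ?case unfolding matrix_matrix_mult_def
      by (simp, intro matrix_polynomial_sum matrix_polynomial.intros) auto
  qed (auto intro: matrix_polynomial.intros)
  show "matrix_polynomial (\<lambda>g. p (g ** x))"
    using assms
  proof induction
    case (entry i j)
    show ?case unfolding matrix_matrix_mult_def
      by (simp, intro matrix_polynomial_sum matrix_polynomial.intros) auto
  qed (auto intro: matrix_polynomial.intros)
qed

lemma O_M_mult: "g \<in> O_M \<Longrightarrow> h \<in> O_M \<Longrightarrow> g ** h \<in> O_M"
  by (simp add: O_M_def flip: matrix_vector_mul_assoc)

text \<open>A translate of a polynomial is a polynomial. For a fixed left factor in X the right
  factor may be moved to the closure; with the right factor fixed there, the left one
  follows.\<close>

lemma zariski_closure_mult:
  assumes X: "\<And>x y. x \<in> X \<Longrightarrow> y \<in> X \<Longrightarrow> x ** y \<in> X"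
    and gh: "g \<in> zariski_closure X" "h \<in> zariski_closure X"
  shows "g ** h \<in> zariski_closure X"
proof -
  have cl: "p k = 0" if "k \<in> zariski_closure X" "matrix_polynomial p" "\<And>x. x \<in> X \<Longrightarrow> p x = 0" for p k
    using that unfolding zariski_closure_def by blast
  have left: "p (x ** k) = 0"
    if "x \<in> X" "k \<in> zariski_closure X" "matrix_polynomial p" "\<And>x. x \<in> X \<Longrightarrow> p x = 0" for p x k
    by (rule cl[OF that(2) matrix_polynomial_translate(1)[OF that(3)]]) (use X that in blast)
  have "p (g ** h) = 0" if p: "matrix_polynomial p" "\<And>x. x \<in> X \<Longrightarrow> p x = 0" for p
    by (rule cl[OF gh(1) matrix_polynomial_translate(2)[OF p(1)]]) (use left gh(2) p in blast)
  moreover have "g ** h \<in> O_M" using gh by (simp add: zariski_closure_def O_M_mult)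
  ultimately show ?thesis unfolding zariski_closure_def by blast
qed

lemma subset_zariski_closure: "X \<subseteq> O_M \<Longrightarrow> X \<subseteq> zariski_closure X"
  by (auto simp: zariski_closure_def)

lemma continuous_on_matrix_polynomial: "matrix_polynomial p \<Longrightarrow> continuous_on UNIV p"
  by (induction rule: matrix_polynomial.induct) (auto intro!: continuous_intros)

lemma matrix_polynomial_curve:
  assumes "matrix_polynomial p" and g: "\<And>i j. \<exists>P. \<forall>x. g x $ i $ j = poly P (x :: complex)"
  shows "\<exists>P. \<forall>x. p (g x) = poly P x"
  using assms(1)
proof induction
  case (const c)
  show ?case by (rule exI[of _ "[:c:]"]) simp
next
  case (add p q)
  then obtain P Q where "\<forall>x. p (g x) = poly P x" "\<forall>x. q (g x) = poly Q x" by blast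
  then show ?case by (intro exI[of _ "P + Q"]) simp
next
  case (mult p q)
  then obtain P Q where "\<forall>x. p (g x) = poly P x" "\<forall>x. q (g x) = poly Q x" by blast
  then show ?case by (intro exI[of _ "P * Q"]) simp
qed (rule g)

lemma poly_eq_0_on_reals:
  assumes "\<And>x::real. poly P (of_real x) = (0::complex)" shows "P = 0"
proof (rule ccontr)
  assume "P \<noteq> 0"
  then have "finite {x. poly P x = 0}" by (rule poly_roots_finite)
  moreover have "range of_real \<subseteq> {x. poly P x = 0}" using assms by auto
  ultimately have "finite (range (of_real :: real \<Rightarrow> complex))" by (rule rev_finite_subset)
  then have "finite (UNIV :: real set)" using finite_imageD inj_of_real by blast
  then show False using infinite_UNIV_char_0 by blast
qed

text \<open>Along the curve every equation of X is a polynomial in one variable; having all real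
  numbers as roots, it is zero. This is how non-real matrices enter the closure of a set of real
  ones.\<close>

lemma zariski_closure_complexify:
  assumes g: "\<And>i j. \<exists>P. \<forall>x. g x $ i $ j = poly P (x :: complex)"
    and real: "\<And>x::real. g (of_real x) \<in> zariski_closure X"
    and O: "g x \<in> O_M"
  shows "g x \<in> zariski_closure X"
proof -
  have "p (g x) = 0" if p: "matrix_polynomial p" "\<forall>x\<in>X. p x = 0" for p
  proof -
    obtain P where P: "\<And>x. p (g x) = poly P x" using matrix_polynomial_curve[OF p(1) g] by blast
    have "poly P (of_real x) = 0" for x using real[of x] p by (simp add: zariski_closure_def flip: P)
    then have "P = 0" by (rule poly_eq_0_on_reals)
    then show ?thesis by (simp add: P)
  qed
  then show ?thesis using O by (simp add: zariski_closure_def)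
qed

section \<open>Powers of loxodromic elements\<close>

text \<open>Laurent polynomials in the modulus of an eigenvalue, with coefficients depending on its direction
  \<open>u\<close>. Powers of \<open>u\<close> return arbitrarily close to 1, so continuity in \<open>u\<close> is all that is needed.\<close>

definition laurent_fun :: "(complex \<Rightarrow> complex \<Rightarrow> complex) \<Rightarrow> bool" where
  "laurent_fun \<phi> \<longleftrightarrow> (\<exists>N m P. (\<forall>u. degree (P u) \<le> m) \<and> (\<forall>j. continuous_on UNIV (\<lambda>u. coeff (P u) j)) \<and>
     (\<forall>q u. q \<noteq> 0 \<longrightarrow> q ^ N * \<phi> q u = poly (P u) q))"

lemma laurent_funI:
  assumes "\<And>u. degree (P u) \<le> m" "\<And>j. continuous_on UNIV (\<lambda>u. coeff (P u) j)"
    "\<And>q u. q \<noteq> 0 \<Longrightarrow> q ^ N * \<phi> q u = poly (P u) q"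
  shows "laurent_fun \<phi>"
  using assms unfolding laurent_fun_def by blast

lemma laurent_fun_mult:
  assumes "laurent_fun \<phi>" "laurent_fun \<psi>" shows "laurent_fun (\<lambda>q u. \<phi> q u * \<psi> q u)"
proof -
  obtain N m P where P: "\<And>u. degree (P u) \<le> m" "\<And>j. continuous_on UNIV (\<lambda>u. coeff (P u) j)"
    "\<And>q u. q \<noteq> 0 \<Longrightarrow> q ^ N * \<phi> q u = poly (P u) q" using assms(1) unfolding laurent_fun_def by metis
  obtain N' m' P' where P': "\<And>u. degree (P' u) \<le> m'" "\<And>j. continuous_on UNIV (\<lambda>u. coeff (P' u) j)"
    "\<And>q u. q \<noteq> 0 \<Longrightarrow> q ^ N' * \<psi> q u = poly (P' u) q" using assms(2) unfolding laurent_fun_def by metis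
  show ?thesis
  proof (rule laurent_funI[where P = "\<lambda>u. P u * P' u" and m = "m + m'" and N = "N + N'"])
    show "degree (P u * P' u) \<le> m + m'" for u
      using degree_mult_le[of "P u" "P' u"] P(1)[of u] P'(1)[of u] by linarith
    show "continuous_on UNIV (\<lambda>u. coeff (P u * P' u) j)" for j
      unfolding coeff_mult by (intro continuous_intros P P')
    show "q ^ (N + N') * (\<phi> q u * \<psi> q u) = poly (P u * P' u) q" if "q \<noteq> 0" for q u
      by (simp add: power_add mult_ac flip: P(3)[OF that, of u] P'(3)[OF that, of u])
  qed
qed

lemma laurent_fun_add:
  assumes "laurent_fun \<phi>" "laurent_fun \<psi>" shows "laurent_fun (\<lambda>q u. \<phi> q u + \<psi> q u)"
proof -
  obtain N m P where P: "\<And>u. degree (P u) \<le> m" "\<And>j. continuous_on UNIV (\<lambda>u. coeff (P u) j)"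
    "\<And>q u. q \<noteq> 0 \<Longrightarrow> q ^ N * \<phi> q u = poly (P u) q" using assms(1) unfolding laurent_fun_def by metis
  obtain N' m' P' where P': "\<And>u. degree (P' u) \<le> m'" "\<And>j. continuous_on UNIV (\<lambda>u. coeff (P' u) j)"
    "\<And>q u. q \<noteq> 0 \<Longrightarrow> q ^ N' * \<psi> q u = poly (P' u) q" using assms(2) unfolding laurent_fun_def by metis
  show ?thesis
  proof (rule laurent_funI[where P = "\<lambda>u. monom 1 N' * P u + monom 1 N * P' u"
        and m = "max (N' + m) (N + m')" and N = "N + N'"])
    show "degree (monom 1 N' * P u + monom 1 N * P' u) \<le> max (N' + m) (N + m')" for u
    proof (rule degree_add_le)
      show "degree (monom 1 N' * P u) \<le> max (N' + m) (N + m')"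
        using degree_mult_le[of "monom 1 N'" "P u"] degree_monom_le[of "1::complex" N'] P(1)[of u] by linarith
      show "degree (monom 1 N * P' u) \<le> max (N' + m) (N + m')"
        using degree_mult_le[of "monom 1 N" "P' u"] degree_monom_le[of "1::complex" N] P'(1)[of u] by linarith
    qed
    show "continuous_on UNIV (\<lambda>u. coeff (monom 1 N' * P u + monom 1 N * P' u) j)" for j
      unfolding coeff_mult coeff_add by (intro continuous_intros P P')
    show "q ^ (N + N') * (\<phi> q u + \<psi> q u) = poly (monom 1 N' * P u + monom 1 N * P' u) q" if "q \<noteq> 0" for q u
      using P(3)[OF that, of u, symmetric] P'(3)[OF that, of u, symmetric]
      by (simp add: power_add algebra_simps poly_monom)
  qed
qed

lemma laurent_fun_continuous:
  assumes "continuous_on UNIV c" shows "laurent_fun (\<lambda>q u. c u)"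
proof (rule laurent_funI[where P = "\<lambda>u. [:c u:]" and m = 0 and N = 0])
  show "continuous_on UNIV (\<lambda>u. coeff [:c u:] j)" for j
    using assms by (cases j) simp_all
qed auto

lemma laurent_fun_q: "laurent_fun (\<lambda>q u. q)"
  by (rule laurent_funI[where P = "\<lambda>u. [:0, 1:]" and m = 1 and N = 0]) auto

lemma laurent_fun_inverse: "laurent_fun (\<lambda>q u. inverse q)"
  by (rule laurent_funI[where P = "\<lambda>u. [:1:]" and m = 0 and N = 1]) auto

lemma laurent_fun_matrix_polynomial:
  assumes "matrix_polynomial p" "\<And>i j. laurent_fun (\<lambda>q u. R q u $ i $ j)"
  shows "laurent_fun (\<lambda>q u. p (R q u))"
  using assms(1)
  by induction (auto intro: assms(2) laurent_fun_add laurent_fun_mult laurent_fun_continuous)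

text \<open>By compactness two powers of u are close to each other, so their quotient is a power
  close to 1; taking the two indices at least N apart makes its exponent at least N.\<close>

lemma unit_circle_recurrence:
  assumes "cmod u = 1" "\<epsilon> > 0"
  shows "\<exists>n\<ge>N. cmod (u ^ n - 1) < \<epsilon>"
proof -
  have "\<forall>n. u ^ n \<in> sphere 0 1" using assms(1) by (simp add: norm_power)
  then obtain l r where r: "strict_mono r" "((\<lambda>n. u ^ n) \<circ> r) \<longlonglongrightarrow> l"
    using seq_compactE[OF compact_imp_seq_compact[OF compact_sphere]] by metis
  then have "Cauchy ((\<lambda>n. u ^ n) \<circ> r)" using LIMSEQ_imp_Cauchy by blast
  then obtain M where M: "\<And>m n. m \<ge> M \<Longrightarrow> n \<ge> M \<Longrightarrow> dist (u ^ r m) (u ^ r n) < \<epsilon>"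
    unfolding Cauchy_def o_def using assms(2) by blast
  have ge: "r (M + N) \<ge> r M + N"
  proof (induction N)
    case (Suc N)
    then show ?case using strict_monoD[OF r(1), of "M + N" "M + Suc N"] by simp
  qed simp
  have "cmod (u ^ r (M + N) - u ^ r M) < \<epsilon>" using M[of "M + N" M] by (simp add: dist_norm)
  moreover have "u ^ r (M + N) - u ^ r M = u ^ r M * (u ^ (r (M + N) - r M) - 1)"
    using ge by (simp add: right_diff_distrib flip: power_add)
  ultimately have "cmod (u ^ (r (M + N) - r M) - 1) < \<epsilon>"
    using assms(1) by (simp add: norm_mult norm_power)
  then show ?thesis using ge by (intro exI[of _ "r (M + N) - r M"]) auto
qed

text \<open>The lower terms are bounded by a constant times |Q^n|^m, so the top coefficient at u^n
  is at most a constant times |Q|^(-n). A nonzero value at one n would, by recurrence and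
  continuity, come back with at least half its size at arbitrarily large n. Hence the top
  coefficient vanishes and the degree drops.\<close>

lemma exponential_sum_coefficients_vanish:
  fixes c :: "nat \<Rightarrow> complex \<Rightarrow> complex"
  assumes u: "cmod u = 1" and Q: "cmod Q > 1"
    and cont: "\<And>j. continuous_on UNIV (c j)"
    and "\<And>n. (\<Sum>j\<le>m. c j (u ^ n) * (Q ^ n) ^ j) = 0"
  shows "\<forall>j\<le>m. \<forall>n. c j (u ^ n) = 0"
  using assms(4)
proof (induction m)
  case 0
  then show ?case by simp
next
  case (Suc m)
  have "\<exists>B. \<forall>u j. cmod u = 1 \<longrightarrow> j \<le> m \<longrightarrow> cmod (c j u) \<le> B"
  proof -
    have "\<exists>B. \<forall>u\<in>sphere 0 1. cmod (c j u) \<le> B" for j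
    proof -
      have "compact (c j ` sphere 0 1)"
        by (rule compact_continuous_image[OF continuous_on_subset[OF cont] compact_sphere]) auto
      then have "bounded (c j ` sphere 0 1)" by (rule compact_imp_bounded)
      then show ?thesis unfolding bounded_iff by auto
    qed
    then obtain B where B: "\<And>j u. u \<in> sphere 0 1 \<Longrightarrow> cmod (c j u) \<le> B j" by metis
    have "cmod (c j u) \<le> Max (B ` {..m})" if "u \<in> sphere 0 1" "j \<le> m" for u j
      using that(2) by (intro order_trans[OF B[OF that(1)]] Max_ge) auto
    then show ?thesis by (intro exI[of _ "Max (B ` {..m})"]) simp
  qed
  then obtain B where B: "\<And>u j. cmod u = 1 \<Longrightarrow> j \<le> m \<Longrightarrow> cmod (c j u) \<le> B" by metis
  have B0: "B \<ge> 0" using B[OF u, of 0] norm_ge_zero order_trans by blast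
  have small: "cmod (c (Suc m) (u ^ n)) * cmod Q ^ n \<le> (m + 1) * B" for n
  proof -
    have "c (Suc m) (u ^ n) * (Q ^ n) ^ Suc m = - (\<Sum>j\<le>m. c j (u ^ n) * (Q ^ n) ^ j)"
      using Suc.prems[of n] by (simp add: add_eq_0_iff add.commute)
    then have "cmod (c (Suc m) (u ^ n)) * cmod Q ^ n * cmod (Q ^ n) ^ m
        = cmod (\<Sum>j\<le>m. c j (u ^ n) * (Q ^ n) ^ j)"
      by (simp add: mult.assoc flip: norm_power norm_mult)
    also have "\<dots> \<le> (\<Sum>j\<le>m. B * cmod (Q ^ n) ^ m)"
    proof (rule sum_norm_le)
      fix j assume "j \<in> {..m}"
      then have "j \<le> m" by simp
      have "1 \<le> cmod (Q ^ n)" using Q by (simp add: norm_power)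
      then have "cmod (Q ^ n) ^ j \<le> cmod (Q ^ n) ^ m" using \<open>j \<le> m\<close> by (rule power_increasing[rotated])
      moreover have "cmod (c j (u ^ n)) \<le> B" using B \<open>j \<le> m\<close> u by (simp add: norm_power)
      ultimately show "cmod (c j (u ^ n) * (Q ^ n) ^ j) \<le> B * cmod (Q ^ n) ^ m"
        using B0 by (simp add: norm_mult norm_power mult_mono)
    qed
    also have "\<dots> = (m + 1) * B * cmod (Q ^ n) ^ m" by simp
    finally have "cmod (c (Suc m) (u ^ n)) * cmod Q ^ n * cmod (Q ^ n) ^ m
        \<le> (m + 1) * B * cmod (Q ^ n) ^ m" .
    moreover have "0 < cmod Q" using Q by linarith
    then have "0 < cmod (Q ^ n) ^ m" by (simp add: norm_power)
    ultimately show ?thesis by (rule mult_right_le_imp_le)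
  qed
  have zero: "c (Suc m) (u ^ n) = 0" for n
  proof (rule ccontr)
    assume nz: "c (Suc m) (u ^ n) \<noteq> 0"
    define d where "d = cmod (c (Suc m) (u ^ n))"
    have d: "d > 0" using nz by (simp add: d_def)
    have "isCont (c (Suc m)) (u ^ n)" using cont by (simp add: continuous_on_eq_continuous_at)
    then obtain \<epsilon> where e: "\<epsilon> > 0" "\<And>v. dist v (u ^ n) < \<epsilon> \<Longrightarrow> dist (c (Suc m) v) (c (Suc m) (u ^ n)) < d / 2"
      unfolding continuous_at_eps_delta using d by (metis half_gt_zero)
    \<comment> \<open>Makes (d/2) |Q|^N larger than (m + 1) B + 1, against the bound
      \<open>small\<close>.\<close>
    obtain N where N: "cmod Q ^ N > 2 * ((m + 1) * B + 1) / d" using real_arch_pow[OF Q] by blast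
    obtain k where k: "k \<ge> N" "cmod (u ^ k - 1) < \<epsilon>" using unit_circle_recurrence[OF u e(1)] by blast
    have "u ^ (n + k) - u ^ n = u ^ n * (u ^ k - 1)" by (simp add: power_add right_diff_distrib)
    then have "dist (u ^ (n + k)) (u ^ n) < \<epsilon>" using k(2) u by (simp add: dist_norm norm_mult norm_power)
    then have "dist (c (Suc m) (u ^ (n + k))) (c (Suc m) (u ^ n)) < d / 2" by (rule e(2))
    then have "cmod (c (Suc m) (u ^ (n + k))) > d / 2"
      using norm_triangle_ineq2[of "c (Suc m) (u ^ n)" "c (Suc m) (u ^ (n + k))"]
      by (simp add: dist_norm norm_minus_commute d_def)
    moreover have "cmod Q ^ N \<le> cmod Q ^ (n + k)" using k(1) Q by (intro power_increasing) auto
    ultimately have "d / 2 * (2 * ((m + 1) * B + 1) / d) \<le> cmod (c (Suc m) (u ^ (n + k))) * cmod Q ^ (n + k)"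
      using N d B0 by (intro mult_mono) auto
    then show False using small[of "n + k"] d by simp
  qed
  have "\<forall>j\<le>m. \<forall>n. c j (u ^ n) = 0" using Suc.prems zero by (intro Suc.IH) simp
  then show ?case using zero le_Suc_eq by auto
qed

lemma laurent_fun_vanish:
  assumes "laurent_fun \<phi>" and u: "cmod u = 1" and Q: "cmod Q > 1"
    and zero: "\<And>n. \<phi> (Q ^ n) (u ^ n) = 0" and "q \<noteq> 0"
  shows "\<phi> q 1 = 0"
proof -
  obtain N m P where P: "\<And>u. degree (P u) \<le> m" "\<And>j. continuous_on UNIV (\<lambda>u. coeff (P u) j)"
    "\<And>q u. q \<noteq> 0 \<Longrightarrow> q ^ N * \<phi> q u = poly (P u) q" using assms(1) unfolding laurent_fun_def by metis
  have poly: "poly (P u) q = (\<Sum>j\<le>m. coeff (P u) j * q ^ j)" for u q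
    unfolding poly_altdef
    by (rule sum.mono_neutral_left) (use P(1)[of u] in \<open>auto intro: coeff_eq_0\<close>)
  have "Q \<noteq> 0" using Q by auto
  then have "(\<Sum>j\<le>m. coeff (P (u ^ n)) j * (Q ^ n) ^ j) = 0" for n
    using P(3)[of "Q ^ n" "u ^ n"] zero[of n] by (simp add: poly)
  then have "\<forall>j\<le>m. \<forall>n. coeff (P (u ^ n)) j = 0"
    by (intro exponential_sum_coefficients_vanish[OF u Q P(2)])
  \<comment> \<open>The exponent n = 0 gives the direction u^0 = 1.\<close>
  then have "coeff (P 1) j = 0" if "j \<le> m" for j using that by (metis power_0)
  then have "poly (P 1) q = 0" by (simp add: poly)
  then show ?thesis using P(3)[OF assms(5), of 1] assms(5) by simp
qed

lemma mat_mult_nth: "(mat c ** M) $ i $ j = c * (M :: 'a::comm_semiring_1^'n^'n) $ i $ j"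
  by (simp add: matrix_matrix_mult_def mat_def if_distrib if_distribR sum.delta cong: if_cong)

lemma Rm_nth: "Rm \<alpha> \<beta> $ i $ j = unherm (\<alpha> ** herm (axis j 1) ** transpose \<beta>) $ i"
  by (simp add: Rm_def matrix_def)

lemma Rm_add_nth:
  "Rm (\<alpha> + \<alpha>') \<beta> $ i $ j = Rm \<alpha> \<beta> $ i $ j + Rm \<alpha>' \<beta> $ i $ j"
  "Rm \<alpha> (\<beta> + \<beta>') $ i $ j = Rm \<alpha> \<beta> $ i $ j + Rm \<alpha> \<beta>' $ i $ j"
proof -
  have un: "unherm (S + T) = unherm S + unherm T" for S T
    by (simp add: unherm_def vec4_eq_iff field_simps)
  have "(S + T) ** U = S ** U + T ** U" "S ** (T + U) = S ** T + S ** U" for S T U :: "complex^2^2"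
    by (simp_all add: mat2_simps algebra_simps)
  moreover have "transpose (\<beta> + \<beta>') = transpose \<beta> + transpose \<beta>'"
    by (simp add: transpose_def vec_eq_iff)
  ultimately show "Rm (\<alpha> + \<alpha>') \<beta> $ i $ j = Rm \<alpha> \<beta> $ i $ j + Rm \<alpha>' \<beta> $ i $ j"
    "Rm \<alpha> (\<beta> + \<beta>') $ i $ j = Rm \<alpha> \<beta> $ i $ j + Rm \<alpha> \<beta>' $ i $ j"
    by (simp_all add: Rm_nth un)
qed

lemma Rm_scale_nth:
  "Rm (mat x ** \<alpha>) \<beta> $ i $ j = x * Rm \<alpha> \<beta> $ i $ j"
  "Rm \<alpha> (mat x ** \<beta>) $ i $ j = x * Rm \<alpha> \<beta> $ i $ j"
proof -
  have un: "unherm (mat x ** T) $ i = x * unherm T $ i" for T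
    using exhaust_4[of i] by (auto simp: unherm_def matrix_mult_2_nth field_simps)
  have "T ** transpose (mat x ** \<beta>) = mat x ** (T ** transpose \<beta>)" for T :: "complex^2^2"
    by (simp add: mat2_simps algebra_simps)
  then show "Rm (mat x ** \<alpha>) \<beta> $ i $ j = x * Rm \<alpha> \<beta> $ i $ j"
    "Rm \<alpha> (mat x ** \<beta>) $ i $ j = x * Rm \<alpha> \<beta> $ i $ j"
    by (simp_all only: Rm_nth un flip: matrix_mul_assoc)
qed

lemma Rm_bilinear:
  "Rm (mat x ** \<alpha> + mat y ** \<alpha>') (mat x' ** \<beta> + mat y' ** \<beta>') $ i $ j =
     x * x' * Rm \<alpha> \<beta> $ i $ j + x * y' * Rm \<alpha> \<beta>' $ i $ j
   + y * x' * Rm \<alpha>' \<beta> $ i $ j + y * y' * Rm \<alpha>' \<beta>' $ i $ j"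
  by (simp add: Rm_add_nth Rm_scale_nth algebra_simps)

text \<open>The element with eigenvalues \<open>\<mu>\<close> and \<open>1/\<mu>\<close> on the images of the projections \<open>P\<close> and \<open>P'\<close>.\<close>

definition diag_by :: "complex^2^2 \<Rightarrow> complex^2^2 \<Rightarrow> complex \<Rightarrow> complex^2^2" where
  "diag_by P P' \<mu> = mat \<mu> ** P + mat (inverse \<mu>) ** P'"

text \<open>The entries depend on the eigenvalue \<mu> only through |\<mu>|^2 and the direction of
  \<mu>^2. Along powers of l the first grows and the second recurs, so an equation satisfied by the
  powers holds for every modulus at direction 1, that is for the real boosts.\<close>

lemma zariski_closure_diag_by:
  assumes "cmod l > 1" "s > 0"
    and powers: "\<And>n. Rm (diag_by P P' (l ^ n)) (cnjm (diag_by P P' (l ^ n))) \<in> zariski_closure X"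
    and O: "Rm (diag_by P P' (of_real s)) (cnjm (diag_by P P' (of_real s))) \<in> O_M"
  shows "Rm (diag_by P P' (of_real s)) (cnjm (diag_by P P' (of_real s))) \<in> zariski_closure X"
proof -
  \<comment> \<open>Bilinearity splits the matrix by its four weights. \<open>cnj w\<close> stands
    for the inverse of \<open>w\<close>, which has modulus 1; in this form the coefficients are
    continuous on the whole plane, including 0.\<close>
  define R where "R q w = (\<chi> i j. q * Rm P (cnjm P) $ i $ j + w * Rm P (cnjm P') $ i $ j
    + cnj w * Rm P' (cnjm P) $ i $ j + inverse q * Rm P' (cnjm P') $ i $ j)" for q w
  have cnjm: "cnjm (diag_by P P' \<mu>) = mat (cnj \<mu>) ** cnjm P + mat (cnj (inverse \<mu>)) ** cnjm P'" for \<mu>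
    by (simp add: diag_by_def mat2_simps)
  have R: "Rm (diag_by P P' \<mu>) (cnjm (diag_by P P' \<mu>))
      = R (of_real ((cmod \<mu>)\<^sup>2)) (\<mu> * inverse (cnj \<mu>))" if "\<mu> \<noteq> 0" for \<mu>
    unfolding vec_eq_iff cnjm unfolding diag_by_def unfolding Rm_bilinear R_def complex_norm_square using that
    by (simp add: mult_ac)
  have lf: "laurent_fun (\<lambda>q w. R q w $ i $ j)" for i j
    unfolding R_def vec_lambda_beta
    by (intro laurent_fun_add laurent_fun_mult laurent_fun_q laurent_fun_inverse
        laurent_fun_continuous continuous_intros)
  let ?Q = "of_real ((cmod l)\<^sup>2) :: complex" and ?w = "l * inverse (cnj l)"
  have l0: "l \<noteq> 0" using assms(1) by auto
  have "p (R (of_real (s\<^sup>2)) 1) = 0" if p: "matrix_polynomial p" "\<forall>x\<in>X. p x = 0" for p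
  proof (rule laurent_fun_vanish[OF laurent_fun_matrix_polynomial[OF p(1) lf], where u = ?w and Q = ?Q])
    show "cmod ?w = 1" using l0 by (simp add: norm_mult norm_inverse)
    have "1 < (cmod l)\<^sup>2" using assms(1) by (simp add: one_less_power)
    then show "cmod ?Q > 1" by (simp add: norm_power)
    have "R (?Q ^ n) (?w ^ n) = Rm (diag_by P P' (l ^ n)) (cnjm (diag_by P P' (l ^ n)))" for n
      using l0 by (subst R) (simp_all add: norm_power power_mult_distrib power_inverse flip: power_mult,
          simp add: mult.commute)
    then show "p (R (?Q ^ n) (?w ^ n)) = 0" for n
      using powers[of n] p by (simp add: zariski_closure_def)
  qed (use assms(2) in auto)
  moreover have "R (of_real (s\<^sup>2)) 1 = Rm (diag_by P P' (of_real s)) (cnjm (diag_by P P' (of_real s)))"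
    using assms(2) by (subst R) auto
  ultimately show ?thesis using O by (simp add: zariski_closure_def)
qed

section \<open>Tangent space of a closed monoid of matrices\<close>

lemma bounded_bilinear_matrix_mult_2:
  "bounded_bilinear ((**) :: complex^2^2 \<Rightarrow> complex^2^2 \<Rightarrow> complex^2^2)"
proof -
  have "bilinear ((**) :: complex^2^2 \<Rightarrow> complex^2^2 \<Rightarrow> complex^2^2)"
    unfolding bilinear_def by (intro conjI allI linearI) (simp_all add: mat2_simps algebra_simps)
  then show ?thesis by (simp add: bilinear_conv_bounded_bilinear)
qed

interpretation mm: bounded_bilinear "(**) :: complex^2^2 \<Rightarrow> complex^2^2 \<Rightarrow> complex^2^2"
  by (rule bounded_bilinear_matrix_mult_2)

text \<open>A quadratic error bound instead of differentiability: no regularity of g in t is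
  required, and an error of order 1/n^2 at time 1/n survives n-fold multiplication.\<close>

definition tangent_space :: "(complex^2^2) set \<Rightarrow> (complex^2^2) set" where
  "tangent_space H = {Y. \<exists>g C d. C \<ge> 0 \<and> d > 0 \<and>
     (\<forall>t::real. \<bar>t\<bar> < d \<longrightarrow> g t \<in> H \<and> norm (g t - (mat 1 + t *\<^sub>R Y)) \<le> C * t\<^sup>2)}"

lemma tangent_spaceI:
  assumes "C \<ge> 0" "d > 0" "\<And>t::real. \<bar>t\<bar> < d \<Longrightarrow> g t \<in> H"
    "\<And>t. \<bar>t\<bar> < d \<Longrightarrow> norm (g t - (mat 1 + t *\<^sub>R Y)) \<le> C * t\<^sup>2"
  shows "Y \<in> tangent_space H"
  unfolding tangent_space_def
  by (rule CollectI, intro exI[of _ g] exI[of _ C] exI[of _ d]) (simp add: assms)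

lemma tangent_spaceE:
  assumes "Y \<in> tangent_space H"
  obtains g C d where "C \<ge> 0" "d > 0" "\<And>t::real. \<bar>t\<bar> < d \<Longrightarrow> g t \<in> H"
    "\<And>t. \<bar>t\<bar> < d \<Longrightarrow> norm (g t - (mat 1 + t *\<^sub>R Y)) \<le> C * t\<^sup>2"
proof -
  obtain g C d where "C \<ge> 0" "d > 0" "\<forall>t::real. \<bar>t\<bar> < d \<longrightarrow> g t \<in> H \<and>
      norm (g t - (mat 1 + t *\<^sub>R Y)) \<le> C * t\<^sup>2"
    using assms unfolding tangent_space_def by auto
  then show thesis by (intro that[of C d g]) auto
qed

lemma tangent_space_scale:
  assumes "Y \<in> tangent_space H" shows "c *\<^sub>R Y \<in> tangent_space H"
proof -
  obtain g C d where g: "C \<ge> 0" "d > 0" "\<And>t::real. \<bar>t\<bar> < d \<Longrightarrow> g t \<in> H"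
    "\<And>t. \<bar>t\<bar> < d \<Longrightarrow> norm (g t - (mat 1 + t *\<^sub>R Y)) \<le> C * t\<^sup>2"
    using assms by (rule tangent_spaceE) blast
  have small: "\<bar>t * c\<bar> < d" if "\<bar>t\<bar> < d / (\<bar>c\<bar> + 1)" for t
  proof -
    have "\<bar>t * c\<bar> \<le> \<bar>t\<bar> * (\<bar>c\<bar> + 1)" by (simp add: abs_mult mult_left_mono)
    also have "\<dots> < d" using that by (simp add: pos_less_divide_eq)
    finally show ?thesis .
  qed
  show ?thesis
  proof (rule tangent_spaceI[where g = "\<lambda>t. g (t * c)" and C = "C * c\<^sup>2" and d = "d / (\<bar>c\<bar> + 1)"])
    show "C * c\<^sup>2 \<ge> 0" "d / (\<bar>c\<bar> + 1) > 0" using g(1,2) by simp_all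
    show "g (t * c) \<in> H" if "\<bar>t\<bar> < d / (\<bar>c\<bar> + 1)" for t using g(3) small[OF that] by blast
    show "norm (g (t * c) - (mat 1 + t *\<^sub>R c *\<^sub>R Y)) \<le> C * c\<^sup>2 * t\<^sup>2"
      if "\<bar>t\<bar> < d / (\<bar>c\<bar> + 1)" for t
      using g(4)[OF small[OF that]] by (simp add: power_mult_distrib mult_ac)
  qed
qed

lemma tangent_space_zero:
  assumes "mat 1 \<in> H" shows "0 \<in> tangent_space H"
  by (rule tangent_spaceI[where g = "\<lambda>t. mat 1" and C = 0 and d = 1]) (use assms in auto)

lemma tangent_space_add:
  assumes H: "\<And>g h. g \<in> H \<Longrightarrow> h \<in> H \<Longrightarrow> g ** h \<in> H"
    and "Y \<in> tangent_space H" "Z \<in> tangent_space H" shows "Y + Z \<in> tangent_space H"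
proof -
  obtain g C d where g: "C \<ge> 0" "d > 0" "\<And>t::real. \<bar>t\<bar> < d \<Longrightarrow> g t \<in> H"
    "\<And>t. \<bar>t\<bar> < d \<Longrightarrow> norm (g t - (mat 1 + t *\<^sub>R Y)) \<le> C * t\<^sup>2"
    using assms(2) by (rule tangent_spaceE) blast
  obtain g' C' d' where g': "C' \<ge> 0" "d' > 0" "\<And>t::real. \<bar>t\<bar> < d' \<Longrightarrow> g' t \<in> H"
    "\<And>t. \<bar>t\<bar> < d' \<Longrightarrow> norm (g' t - (mat 1 + t *\<^sub>R Z)) \<le> C' * t\<^sup>2"
    using assms(3) by (rule tangent_spaceE) blast
  obtain K where K: "K > 0" "\<And>(A :: complex^2^2) (B :: complex^2^2). norm (A ** B) \<le> norm A * norm B * K"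
    using mm.pos_bounded by metis
  \<comment> \<open>The sum of the coefficients of t^2 in the six error terms of the product
    expansion \<open>eq\<close>, where |t| < 1 absorbs higher powers of t.\<close>
  define D where "D = norm (Y ** Z) + C + C' + norm Y * C' * K + C * norm Z * K + C * C' * K"
  show ?thesis
  proof (rule tangent_spaceI[where g = "\<lambda>t. g t ** g' t" and C = D and d = "min 1 (min d d')"])
    show "D \<ge> 0" unfolding D_def using g(1) g'(1) K(1) by simp
    show "min 1 (min d d') > 0" using g(2) g'(2) by simp
    show "g t ** g' t \<in> H" if "\<bar>t\<bar> < min 1 (min d d')" for t using that g(3) g'(3) H by simp
    show "norm (g t ** g' t - (mat 1 + t *\<^sub>R (Y + Z))) \<le> D * t\<^sup>2" if t: "\<bar>t\<bar> < min 1 (min d d')" for t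
    proof -
      define R where "R = g t - (mat 1 + t *\<^sub>R Y)"
      define R' where "R' = g' t - (mat 1 + t *\<^sub>R Z)"
      have R: "norm R \<le> C * t\<^sup>2" "norm R' \<le> C' * t\<^sup>2" unfolding R_def R'_def using g(4) g'(4) t by auto
      have gt: "g t = mat 1 + t *\<^sub>R Y + R" "g' t = mat 1 + t *\<^sub>R Z + R'" by (simp_all add: R_def R'_def)
      have t1: "\<bar>t\<bar> * t\<^sup>2 \<le> t\<^sup>2" "t\<^sup>2 * t\<^sup>2 \<le> t\<^sup>2"
        using t mult_left_le_one_le[of "t\<^sup>2" "\<bar>t\<bar>"] mult_left_le_one_le[of "t\<^sup>2" "t\<^sup>2"]
        by (auto simp: abs_square_le_1)
      have eq: "g t ** g' t - (mat 1 + t *\<^sub>R (Y + Z))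
          = t\<^sup>2 *\<^sub>R (Y ** Z) + R + R' + t *\<^sub>R (Y ** R') + t *\<^sub>R (R ** Z) + R ** R'"
        unfolding gt
        by (simp add: mm.add_left mm.add_right mm.scaleR_left mm.scaleR_right scaleR_add_right
            power2_eq_square)
      have b1: "norm (t *\<^sub>R (Y ** R')) \<le> norm Y * C' * K * t\<^sup>2"
      proof -
        have "norm (t *\<^sub>R (Y ** R')) \<le> \<bar>t\<bar> * (norm Y * (C' * t\<^sup>2) * K)"
          using order_trans[OF K(2)[of Y R'] mult_right_mono[OF mult_left_mono[OF R(2), of "norm Y"], of K]] K(1)
          by (simp add: mult_left_mono)
        also have "\<dots> = (norm Y * C' * K) * (\<bar>t\<bar> * t\<^sup>2)" by simp
        also have "\<dots> \<le> (norm Y * C' * K) * t\<^sup>2" using t1(1) g'(1) K(1) by (intro mult_left_mono) auto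
        finally show ?thesis .
      qed
      have b2: "norm (t *\<^sub>R (R ** Z)) \<le> C * norm Z * K * t\<^sup>2"
      proof -
        have "norm (t *\<^sub>R (R ** Z)) \<le> \<bar>t\<bar> * ((C * t\<^sup>2) * norm Z * K)"
          using order_trans[OF K(2)[of R Z] mult_right_mono[OF mult_right_mono[OF R(1), of "norm Z"], of K]] K(1)
          by (simp add: mult_left_mono)
        also have "\<dots> = (C * norm Z * K) * (\<bar>t\<bar> * t\<^sup>2)" by simp
        also have "\<dots> \<le> (C * norm Z * K) * t\<^sup>2" using t1(1) g(1) K(1) by (intro mult_left_mono) auto
        finally show ?thesis .
      qed
      have b3: "norm (R ** R') \<le> C * C' * K * t\<^sup>2"
      proof -
        have "norm (R ** R') \<le> (C * t\<^sup>2) * (C' * t\<^sup>2) * K"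
          by (rule order_trans[OF K(2)]) (use R g(1) K(1) in \<open>intro mult_right_mono mult_mono, auto\<close>)
        also have "\<dots> = (C * C' * K) * (t\<^sup>2 * t\<^sup>2)" by simp
        also have "\<dots> \<le> (C * C' * K) * t\<^sup>2" using t1(2) g(1) g'(1) K(1) by (intro mult_left_mono) auto
        finally show ?thesis .
      qed
      have "norm (g t ** g' t - (mat 1 + t *\<^sub>R (Y + Z)))
          \<le> norm (t\<^sup>2 *\<^sub>R (Y ** Z)) + norm R + norm R' + norm (t *\<^sub>R (Y ** R'))
            + norm (t *\<^sub>R (R ** Z)) + norm (R ** R')"
        unfolding eq by (intro order_trans[OF norm_triangle_ineq] add_right_mono order_refl)
      also have "\<dots> \<le> t\<^sup>2 * norm (Y ** Z) + C * t\<^sup>2 + C' * t\<^sup>2 + norm Y * C' * K * t\<^sup>2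
            + C * norm Z * K * t\<^sup>2 + C * C' * K * t\<^sup>2"
        using R b1 b2 b3 by (intro add_mono) simp_all
      also have "\<dots> = D * t\<^sup>2" by (simp add: D_def algebra_simps)
      finally show ?thesis .
    qed
  qed
qed

lemma subspace_tangent_space:
  assumes "mat 1 \<in> H" "\<And>g h. g \<in> H \<Longrightarrow> h \<in> H \<Longrightarrow> g ** h \<in> H"
  shows "subspace (tangent_space H)"
  unfolding subspace_def
  using tangent_space_zero tangent_space_add tangent_space_scale assms by metis

primrec mpow :: "complex^2^2 \<Rightarrow> nat \<Rightarrow> complex^2^2" where
  "mpow g 0 = mat 1" | "mpow g (Suc k) = g ** mpow g k"

lemma mpow_in: "mat 1 \<in> H \<Longrightarrow> (\<And>g h. g \<in> H \<Longrightarrow> h \<in> H \<Longrightarrow> g ** h \<in> H) \<Longrightarrow> g \<in> H \<Longrightarrow> mpow g k \<in> H"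
  by (induction k) auto

text \<open>For a nilpotent tangent vector, \<open>1 + Y\<close> is its exponential: the limit of the \<open>n\<close>-th powers of
  the points at time \<open>1/n\<close> of a curve with velocity \<open>Y\<close>.\<close>

lemma exp_nilpotent_tangent:
  assumes one: "mat 1 \<in> H" and mult: "\<And>g h. g \<in> H \<Longrightarrow> h \<in> H \<Longrightarrow> g ** h \<in> H" and "closed H"
    and Y: "Y \<in> tangent_space H" "Y ** Y = 0"
  shows "mat 1 + Y \<in> H"
proof -
  obtain g C d where g: "C \<ge> 0" "d > 0" "\<And>t::real. \<bar>t\<bar> < d \<Longrightarrow> g t \<in> H"
    "\<And>t. \<bar>t\<bar> < d \<Longrightarrow> norm (g t - (mat 1 + t *\<^sub>R Y)) \<le> C * t\<^sup>2"
    using Y(1) by (rule tangent_spaceE) blast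
  obtain K where K: "K > 0" "\<And>(A :: complex^2^2) (B :: complex^2^2). norm (A ** B) \<le> norm A * norm B * K"
    using mm.pos_bounded by metis
  \<comment> \<open>D/n^2 bounds the error made by one further factor, and 1 + L/n the growth of the
    error already present.\<close>
  define D where "D = C + C * norm Y * K"
  define L where "L = (norm Y + C) * K"
  have D0: "D \<ge> 0" and L0: "L \<ge> 0" using g(1) K(1) by (simp_all add: D_def L_def)
  have bound: "norm (mpow (g (1/n)) n - (mat 1 + Y)) \<le> D * exp L / n"
    if n: "n > 0" "1 / real n < d" for n :: nat
  proof -
    let ?g = "g (1 / real n)"
    define R where "R = ?g - (mat 1 + (1 / n) *\<^sub>R Y)"
    have R: "norm R \<le> C / n\<^sup>2" using g(4)[of "1/n"] n by (simp add: R_def power_divide)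
    have gt: "?g = mat 1 + (1 / n) *\<^sub>R Y + R" by (simp add: R_def)
    have "norm (mpow ?g k - (mat 1 + (k / n) *\<^sub>R Y)) \<le> k * (D / n\<^sup>2) * (1 + L / n) ^ k" if "k \<le> n" for k
      using that
    proof (induction k)
      case 0
      then show ?case by simp
    next
      case (Suc k)
      define e where "e = mpow ?g k - (mat 1 + (k / n) *\<^sub>R Y)"
      have e: "norm e \<le> k * (D / n\<^sup>2) * (1 + L / n) ^ k" unfolding e_def using Suc by simp
      have pk: "mpow ?g k = mat 1 + (k / n) *\<^sub>R Y + e" by (simp add: e_def)
      \<comment> \<open>The term with \<open>Y ** Y\<close> vanishes, so the main part of the k-th
        power stays affine in k.\<close>
      have eq: "mpow ?g (Suc k) - (mat 1 + (Suc k / n) *\<^sub>R Y)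
          = e + (1 / n) *\<^sub>R (Y ** e) + R ** e + R + (k / n) *\<^sub>R (R ** Y)"
      proof -
        have "(Suc k / n) *\<^sub>R Y = (k / n) *\<^sub>R Y + (1 / n) *\<^sub>R Y"
          by (simp add: add_divide_distrib flip: scaleR_add_left)
        then show ?thesis unfolding mpow.simps pk unfolding gt
          by (simp add: mm.add_left mm.add_right mm.scaleR_left mm.scaleR_right scaleR_add_right Y(2))
      qed
      have "norm (mpow ?g (Suc k) - (mat 1 + (Suc k / n) *\<^sub>R Y))
          \<le> norm e + norm ((1 / n) *\<^sub>R (Y ** e)) + norm (R ** e) + norm R + norm ((k / n) *\<^sub>R (R ** Y))"
        unfolding eq by (intro order_trans[OF norm_triangle_ineq] add_right_mono order_refl)
      moreover have "norm ((1 / n) *\<^sub>R (Y ** e)) \<le> norm Y * K / n * norm e"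
        using K(2)[of Y e] n by (simp add: field_simps)
      moreover have "norm (R ** e) \<le> C * K / n * norm e"
      proof -
        have "C / n\<^sup>2 \<le> C / n" using n g(1)
          by (intro divide_left_mono) (simp_all add: power2_eq_square)
        then have "norm R * norm e * K \<le> C / n * norm e * K"
          using R K(1) by (intro mult_right_mono) auto
        then show ?thesis using K(2)[of R e] by (simp add: mult_ac)
      qed
      moreover have "norm ((k / n) *\<^sub>R (R ** Y)) \<le> C * norm Y * K / n\<^sup>2"
      proof -
        have "norm (R ** Y) \<le> C / n\<^sup>2 * norm Y * K"
          using order_trans[OF K(2)[of R Y] mult_right_mono[OF mult_right_mono[OF R, of "norm Y"], of K]] K(1)
          by simp
        moreover have "k / n \<le> 1" using Suc.prems n by simp
        ultimately have "k / n * norm (R ** Y) \<le> 1 * (C / n\<^sup>2 * norm Y * K)" by (intro mult_mono) auto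
        then show ?thesis by simp
      qed
      ultimately have "norm (mpow ?g (Suc k) - (mat 1 + (Suc k / n) *\<^sub>R Y))
          \<le> norm e + norm Y * K / n * norm e + C * K / n * norm e + C / n\<^sup>2 + C * norm Y * K / n\<^sup>2"
        using R by linarith
      also have "\<dots> = norm e * (1 + L / n) + D / n\<^sup>2"
        by (simp add: L_def D_def add_divide_distrib algebra_simps)
      also have "\<dots> \<le> k * (D / n\<^sup>2) * (1 + L / n) ^ k * (1 + L / n) + D / n\<^sup>2 * (1 + L / n) ^ Suc k"
      proof (intro add_mono mult_right_mono e)
        show "0 \<le> 1 + L / n" using L0 by simp
        have "D / n\<^sup>2 * 1 \<le> D / n\<^sup>2 * (1 + L / n) ^ Suc k"
          using L0 D0 by (intro mult_left_mono one_le_power) auto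
        then show "D / n\<^sup>2 \<le> D / n\<^sup>2 * (1 + L / n) ^ Suc k" by simp
      qed
      also have "\<dots> = Suc k * (D / n\<^sup>2) * (1 + L / n) ^ Suc k"
      proof -
        have "p * a * b * x + a * (b * x) = (1 + p) * a * (b * x)" for p a b x :: real
          by (simp add: algebra_simps)
        then show ?thesis unfolding power_Suc2 of_nat_Suc .
      qed
      finally show ?case .
    qed
    from this[of n] have "norm (mpow ?g n - (mat 1 + Y)) \<le> n * (D / n\<^sup>2) * (1 + L / n) ^ n" using n by simp
    also have "\<dots> = D / n * (1 + L / n) ^ n" using n by (simp add: power2_eq_square)
    also have "\<dots> \<le> D / n * exp L"
    proof (rule mult_left_mono)
      show "(1 + L / n) ^ n \<le> exp L" using n L0 by (intro exp_ge_one_plus_x_over_n_power_n) auto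
    qed (use D0 in simp)
    finally show ?thesis by simp
  qed
  have ev: "\<forall>\<^sub>F n::nat in sequentially. n > 0 \<and> 1 / real n < d"
  proof -
    obtain N :: nat where N: "1 / d < N" using reals_Archimedean2 by blast
    have "0 < 1 / d" using g(2) by simp
    then have "n > 0 \<and> 1 / real n < d" if "n \<ge> N" for n
    proof -
      have "1 / d < n" using N that by linarith
      then have "n > 0" using \<open>0 < 1 / d\<close> by (metis of_nat_0_less_iff order_less_trans)
      then show ?thesis using \<open>1 / d < n\<close> g(2) by (simp add: field_simps)
    qed
    then show ?thesis unfolding eventually_sequentially by blast
  qed
  have "(\<lambda>n. mpow (g (1 / real n)) n - (mat 1 + Y)) \<longlonglongrightarrow> 0"
  proof (rule Lim_null_comparison)
    show "\<forall>\<^sub>F n in sequentially. norm (mpow (g (1 / real n)) n - (mat 1 + Y)) \<le> D * exp L / real n"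
      using ev by eventually_elim (use bound in blast)
    show "(\<lambda>n. D * exp L / real n) \<longlonglongrightarrow> 0" by (rule lim_const_over_n)
  qed
  then have lim: "(\<lambda>n. mpow (g (1 / real n)) n) \<longlonglongrightarrow> mat 1 + Y" by (rule LIM_zero_cancel)
  have "\<forall>\<^sub>F n in sequentially. mpow (g (1 / real n)) n \<in> H"
    using ev by eventually_elim (use g(3) in \<open>auto intro!: mpow_in one mult\<close>)
  then show ?thesis using Lim_in_closed_set[OF \<open>closed H\<close> _ _ lim] by simp
qed

section \<open>The group of Moebius and anti-Moebius maps\<close>

lemma bij_moebius: assumes "det \<gamma> = 1" shows "bij (moebius \<gamma>)"
  by (rule o_bij[of "moebius (adj2 \<gamma>)"])
    (use assms in \<open>simp_all add: adj2_mult moebius_one flip: moebius_mult\<close>)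

lemma bij_conjugation: "bij conjugation"
  using conjugation_conjugation o_bij by blast

interpretation Bij: group "BijGroup (UNIV :: riemann_sphere set)"
  by (rule group_BijGroup)

interpretation Moeb: group Moeb
  unfolding Moeb_def by (rule Bij.group_subgroup_generated)

lemma carrier_BijGroup_UNIV: "carrier (BijGroup (UNIV :: 'a set)) = {f. bij f}"
  by (auto simp: BijGroup_def Bij_def extensional_def)

lemma carrier_Moeb_subset: "carrier Moeb \<subseteq> {f. bij f}"
  using Bij.carrier_subgroup_generated_subset unfolding Moeb_def carrier_BijGroup_UNIV .

lemma carrier_MoebI: "f \<in> insert conjugation {moebius \<gamma> | \<gamma>. det \<gamma> = 1} \<Longrightarrow> f \<in> carrier Moeb"
  unfolding Moeb_def carrier_subgroup_generated
  by (rule generate.incl) (auto simp: carrier_BijGroup_UNIV bij_moebius bij_conjugation)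

lemma Moeb_mult:
  assumes "f \<in> carrier Moeb" "g \<in> carrier Moeb" shows "f \<otimes>\<^bsub>Moeb\<^esub> g = f \<circ> g"
proof -
  have "f \<in> Bij UNIV" "g \<in> Bij UNIV"
    using assms carrier_Moeb_subset by (auto simp: Bij_def extensional_def)
  then show ?thesis by (simp add: Moeb_def BijGroup_def compose_def o_def restrict_def)
qed

lemma Moeb_one: "\<one>\<^bsub>Moeb\<^esub> = id"
  by (simp add: Moeb_def BijGroup_def id_def restrict_def)

lemma Moeb_inv_moebius: assumes "det \<gamma> = 1" shows "inv\<^bsub>Moeb\<^esub> (moebius \<gamma>) = moebius (adj2 \<gamma>)"
proof (rule Moeb.inv_equality)
  have "moebius \<gamma> \<in> carrier Moeb" "moebius (adj2 \<gamma>) \<in> carrier Moeb"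
    using assms by (auto intro!: carrier_MoebI simp: exI[of _ \<gamma>] exI[of _ "adj2 \<gamma>"])
  moreover have "moebius (adj2 \<gamma>) \<circ> moebius \<gamma> = id"
    using assms by (simp add: adj2_mult moebius_one flip: moebius_mult)
  ultimately show "moebius \<gamma> \<in> carrier Moeb" "moebius (adj2 \<gamma>) \<in> carrier Moeb"
    "moebius (adj2 \<gamma>) \<otimes>\<^bsub>Moeb\<^esub> moebius \<gamma> = \<one>\<^bsub>Moeb\<^esub>" by (simp_all add: Moeb_mult Moeb_one)
qed

lemma Moeb_inv_conjugation: "inv\<^bsub>Moeb\<^esub> conjugation = conjugation"
  using Moeb.inv_equality[of conjugation conjugation] carrier_MoebI[of conjugation]
  by (simp add: Moeb_mult Moeb_one)

text \<open>Justifies the definite description in \<open>rho\<close>: two matrices of one map differ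
  by a scalar s with s cnj s = 1, which cancels in the action, and no map is both Moebius and
  anti-Moebius.\<close>

lemma rho_eqI:
  assumes f: "f = moebius \<gamma> \<and> R = Rm \<gamma> (cnjm \<gamma>) \<or> f = moebius \<gamma> \<circ> conjugation \<and> R = Rm \<gamma> (cnjm \<gamma>) ** Cm"
    and det: "det \<gamma> = 1"
  shows "map_matrix of_real (rho f) = R"
proof -
  let ?P = "\<lambda>L. \<exists>\<gamma>. cmod (det \<gamma>) = 1 \<and>
     (f = moebius \<gamma> \<and> L = matrix (moebius_action \<gamma>) \<or>
      f = moebius \<gamma> \<circ> conjugation \<and> L = matrix (moebius_action \<gamma> \<circ> conjugation_action))"
  have scal: "Rm \<delta> (cnjm \<delta>) = Rm \<gamma> (cnjm \<gamma>)"
    if dd: "cmod (det \<delta>) = 1" "\<And>z. z \<in> {None, Some 0, Some 1} \<Longrightarrow> moebius \<delta> z = moebius \<gamma> z" for \<delta>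
  proof -
    have "det \<delta> \<noteq> 0" using dd(1) by auto
    then obtain s where s: "\<delta> = mat s ** \<gamma>"
      using moebius_eq_on_three_points[of \<delta> \<gamma>] dd(2) det by (metis zero_neq_one)
    have "det \<delta> = s\<^sup>2" unfolding s det_mul using det by (simp add: det_2[of "mat s"] power2_eq_square)
    then have "cmod s ^ 2 = 1" using dd(1) by (simp add: norm_power)
    then have "s * cnj s = 1" by (simp flip: complex_norm_square)
    moreover have "herm (Rm \<delta> (cnjm \<delta>) *v v) = mat (s * cnj s) ** herm (Rm \<gamma> (cnjm \<gamma>) *v v)" for v
      unfolding herm_Rm s by (simp add: mat2_simps algebra_simps)
    ultimately show ?thesis by (intro matrix_eqI_herm) simp
  qed
  have uniq: "map_matrix of_real L = R" if PL: "?P L" for L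
  proof -
    obtain \<delta> where d: "cmod (det \<delta>) = 1"
      "f = moebius \<delta> \<and> L = matrix (moebius_action \<delta>) \<or>
       f = moebius \<delta> \<circ> conjugation \<and> L = matrix (moebius_action \<delta> \<circ> conjugation_action)"
      using PL by blast
    have d0: "det \<delta> \<noteq> 0" "det \<gamma> \<noteq> 0" using d(1) det by auto
    have conj: "moebius \<delta> \<circ> conjugation = moebius \<gamma> \<circ> conjugation \<Longrightarrow> moebius \<delta> = moebius \<gamma>"
      by (metis comp_assoc comp_id conjugation_conjugation)
    from d(2) f show ?thesis
      using moebius_neq_moebius_conjugation[OF d0] moebius_neq_moebius_conjugation[OF d0(2,1)]
        conj scal[OF d(1)]
      by (auto simp: complexified_moebius_action complexified_moebius_conjugation_action)
  qed
  have "cmod (det \<gamma>) = 1" using det by simp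
  then have "\<exists>L. ?P L" using f by blast
  then obtain L where L: "?P L" by blast
  have "L' = L" if "?P L'" for L'
  proof -
    have "map_matrix complex_of_real L' = map_matrix of_real L" using uniq[OF that] uniq[OF L] by simp
    then show ?thesis by (simp add: vec_eq_iff)
  qed
  then have "rho f = L" unfolding rho_def using L by (intro the_equality)
  then show ?thesis using uniq[OF L] by simp
qed

section \<open>The extended Bianchi group and its invariant lattice\<close>

context bianchi begin

lemma SLK_det: "\<gamma> \<in> SLK \<Longrightarrow> det \<gamma> = 1"
  by (simp add: SLK_def)

lemma SLK_adj2: "\<gamma> \<in> SLK \<Longrightarrow> adj2 \<gamma> \<in> SLK"
  by (simp add: SLK_iff_mat2 OK_minus)

lemma SLK_cnjm: "\<gamma> \<in> SLK \<Longrightarrow> cnjm \<gamma> \<in> SLK"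
  by (simp add: SLK_iff_mat2 OK_cnj)

lemma SLK_one: "mat 1 \<in> SLK"
  by (simp add: SLK_iff_mat2 OK_0 OK_1)

text \<open>Conjugation moves to the right past a Moebius map at the price of conjugating its
  matrix, and the ring of integers is stable under that.\<close>

lemma extended_bianchi_groupE:
  assumes "f \<in> extended_bianchi_group K"
  obtains \<gamma> where "\<gamma> \<in> SLK" "f = moebius \<gamma> \<or> f = moebius \<gamma> \<circ> conjugation"
proof -
  have "f \<in> carrier Moeb \<and> (\<exists>\<gamma>\<in>SLK. f = moebius \<gamma> \<or> f = moebius \<gamma> \<circ> conjugation)"
    using assms unfolding extended_bianchi_group_def
  proof (induction rule: generate.induct)
    case one
    then show ?case using SLK_one moebius_one Moeb.one_closed unfolding Moeb_one by metis
  next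
    case (incl h)
    show ?case
    proof (cases "h = conjugation")
      case True
      then show ?thesis using SLK_one moebius_one carrier_MoebI[of conjugation] by (metis id_comp insertI1)
    next
      case False
      then obtain \<gamma> where "\<gamma> \<in> SLK" "h = moebius \<gamma>" using incl unfolding PSL2_def SLK_def by blast
      then show ?thesis using carrier_MoebI SLK_det by blast
    qed
  next
    case (inv h)
    show ?case
    proof (cases "h = conjugation")
      case True
      then show ?thesis using SLK_one moebius_one carrier_MoebI[of conjugation]
        unfolding True Moeb_inv_conjugation by (metis id_comp insertI1)
    next
      case False
      then obtain \<gamma> where g: "\<gamma> \<in> SLK" "h = moebius \<gamma>" using inv unfolding PSL2_def SLK_def by blast
      then have "inv\<^bsub>Moeb\<^esub> h = moebius (adj2 \<gamma>)" by (simp add: Moeb_inv_moebius SLK_det)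
      moreover have "adj2 \<gamma> \<in> SLK" using g SLK_adj2 by blast
      ultimately show ?thesis using carrier_MoebI SLK_det by blast
    qed
  next
    case (eng h1 h2)
    then obtain \<alpha> \<beta> where ab: "\<alpha> \<in> SLK" "h1 = moebius \<alpha> \<or> h1 = moebius \<alpha> \<circ> conjugation"
      "\<beta> \<in> SLK" "h2 = moebius \<beta> \<or> h2 = moebius \<beta> \<circ> conjugation" by blast
    have d: "det \<alpha> \<noteq> 0" "det \<beta> \<noteq> 0" "det (cnjm \<beta>) \<noteq> 0" using ab SLK_det by simp_all
    have m: "h1 \<otimes>\<^bsub>Moeb\<^esub> h2 = h1 \<circ> h2" "h1 \<otimes>\<^bsub>Moeb\<^esub> h2 \<in> carrier Moeb"
      using eng.IH Moeb_mult[of h1 h2] Moeb.m_closed[of h1 h2] by blast+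
    have c: "moebius \<alpha> \<circ> conjugation \<circ> moebius \<beta> = moebius (\<alpha> ** cnjm \<beta>) \<circ> conjugation"
      using d by (simp add: comp_assoc conjugation_moebius moebius_mult)
    have "h1 \<circ> h2 \<in> {moebius (\<alpha> ** \<beta>), moebius (\<alpha> ** \<beta>) \<circ> conjugation,
        moebius (\<alpha> ** cnjm \<beta>) \<circ> conjugation, moebius (\<alpha> ** cnjm \<beta>)}"
    proof -
      have "moebius (\<alpha> ** cnjm \<beta>) \<circ> conjugation \<circ> conjugation = moebius (\<alpha> ** cnjm \<beta>)"
        by (simp add: comp_assoc)
      then have "moebius \<alpha> \<circ> conjugation \<circ> (moebius \<beta> \<circ> conjugation) = moebius (\<alpha> ** cnjm \<beta>)"
        by (simp add: c flip: comp_assoc)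
      moreover have "moebius \<alpha> \<circ> (moebius \<beta> \<circ> conjugation) = moebius (\<alpha> ** \<beta>) \<circ> conjugation"
        using d by (simp add: moebius_mult comp_assoc)
      ultimately show ?thesis using ab(2,4) c moebius_mult[OF d(1,2)] by auto
    qed
    moreover have "\<alpha> ** \<beta> \<in> SLK" "\<alpha> ** cnjm \<beta> \<in> SLK" using ab SLK_mult SLK_cnjm by auto
    ultimately show ?case unfolding m(1)[symmetric] using m(2) by blast
  qed
  then show thesis using that by blast
qed

text \<open>The transformed matrix is again Hermitian with entries in the ring of integers; its
  diagonal entries are real integers of K, hence rational integers.\<close>

lemma Rm_hermitian_lattice:
  assumes g: "\<gamma> \<in> SLK" and v: "v \<in> hermitian_lattice K"
  shows "Rm \<gamma> (cnjm \<gamma>) *v v \<in> hermitian_lattice K"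
proof -
  define \<xi> where "\<xi> = v$3 + v$4 * \<i>"
  have v': "v$1 \<in> \<int>" "v$2 \<in> \<int>" "v$3 \<in> \<real>" "v$4 \<in> \<real>" and xi: "\<xi> \<in> OK"
    using v by (auto simp: hermitian_lattice_def \<xi>_def)
  have herm: "herm v = mat2 (v$1) \<xi> (cnj \<xi>) (v$2)"
    using v'(3,4) by (simp add: herm_def \<xi>_def mult.commute mat2_eq_iff Reals_cnj_iff)
  define W where "W = herm (Rm \<gamma> (cnjm \<gamma>) *v v)"
  have w: "Rm \<gamma> (cnjm \<gamma>) *v v = unherm W" by (simp add: W_def)
  have gO: "\<gamma>$i$j \<in> OK" for i j using g by (simp add: SLK_def)
  have "v$1 \<in> OK" "v$2 \<in> OK" using v'(1,2) OK_of_int by (auto elim!: Ints_cases)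
  then have WO: "W$i$j \<in> OK" for i j
    unfolding W_def herm_Rm herm using exhaust_2[of i] exhaust_2[of j]
    by (auto simp: matrix_mult_2_nth transpose_def intro!: OK_add OK_mult OK_cnj gO xi)
  have real: "cnj (v$1) = v$1" "cnj (v$2) = v$2"
    using v'(1,2) by (auto elim!: Ints_cases)
  have W: "W$2$1 = cnj (W$1$2)" "cnj (W$1$1) = W$1$1" "cnj (W$2$2) = W$2$2"
    unfolding W_def herm_Rm herm
    by (simp_all add: matrix_mult_2_nth transpose_def real algebra_simps)
  have Z: "x \<in> \<int>" if "x \<in> OK" "cnj x = x" for x
  proof -
    have "x = of_real (Re x)" using that(2) by (simp add: complex_eq_iff)
    moreover from this have "Re x \<in> \<int>" using OK_real_Ints that(1) by metis
    ultimately show ?thesis by (metis Ints_cases Ints_of_int of_real_of_int_eq)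
  qed
  have "(W$1$2 + W$2$1) / 2 = of_real (Re (W$1$2))" "(W$2$1 - W$1$2) * \<i> / 2 = of_real (Im (W$1$2))"
    unfolding W(1) by (simp_all add: complex_eq_iff)
  moreover from this have "(W$1$2 + W$2$1) / 2 + (W$2$1 - W$1$2) * \<i> / 2 * \<i> = W$1$2"
    by (simp add: complex_eq_iff)
  ultimately show ?thesis using Z WO W unfolding w
    by (simp add: hermitian_lattice_def unherm_def)
qed

lemma Cm_hermitian_lattice:
  assumes "v \<in> hermitian_lattice K" shows "Cm *v v \<in> hermitian_lattice K"
proof -
  have "cnj (v$3 + v$4 * \<i>) \<in> OK" using assms by (intro OK_cnj) (simp add: hermitian_lattice_def)
  moreover have "cnj (v$3) = v$3" "cnj (v$4) = v$4"
    using assms by (auto simp: hermitian_lattice_def Reals_cnj_iff)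
  ultimately show ?thesis using assms by (simp add: hermitian_lattice_def Cm_vec)
qed

end

section \<open>Limits of rescaled matrices\<close>

text \<open>The determinant of the pair. For nonzero vectors its vanishing is equality of points of
  the projective line, a condition that is homogeneous and passes to limits.\<close>

definition wedge :: "complex^2 \<Rightarrow> complex^2 \<Rightarrow> complex" where
  "wedge v w = v$1 * w$2 - v$2 * w$1"

lemma wedge_eq_0_imp:
  assumes "wedge v w = 0" "v \<noteq> 0" obtains s where "w = s *s v"
proof (cases "v$1 = 0")
  case True
  then have "v$2 \<noteq> 0" using assms(2) by (simp add: vec2_eq_iff)
  moreover from this have "w$1 = 0" using assms(1) True by (simp add: wedge_def)
  ultimately have "w = (w$2 / v$2) *s v" using True by (simp add: vec2_eq_iff)
  then show ?thesis by (rule that)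
next
  case False
  then have "w$2 = (w$1 / v$1) * v$2" using assms(1) by (simp add: wedge_def field_simps)
  then have "w = (w$1 / v$1) *s v" using False by (simp add: vec2_eq_iff)
  then show ?thesis by (rule that)
qed

lemma wedge_scale: "wedge (s *s v) w = s * wedge v w" "wedge v (s *s w) = s * wedge v w"
  by (simp_all add: wedge_def algebra_simps)

lemma wedge_zero [simp]: "wedge v 0 = 0" "wedge 0 w = 0"
  by (simp_all add: wedge_def)

lemma wedge_self [simp]: "wedge v v = 0"
  by (simp add: wedge_def)

lemma wedge_mult: "wedge (g *v v) (g *v w) = det g * wedge v w"
  by (simp add: wedge_def mv2_nth det_2 algebra_simps)

lemma wedge_hv_inject: "wedge (hv z) (hv w) = 0 \<Longrightarrow> z = w"
  by (cases z; cases w) (simp_all add: wedge_def)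

lemma wedge_column: "det E = 0 \<Longrightarrow> wedge (E *v v) (E *v w) = 0"
  by (simp add: wedge_mult)

lemma wedge_kernel:
  fixes E :: "complex^2^2"
  assumes "E \<noteq> 0" "E *v v = 0" "E *v w = 0" shows "wedge v w = 0"
proof (rule ccontr)
  assume "wedge v w \<noteq> 0"
  have "E$i$1 * wedge v w = (E *v v)$i * w$2 - (E *v w)$i * v$2"
    "E$i$2 * wedge v w = (E *v w)$i * v$1 - (E *v v)$i * w$1" for i
    by (simp_all add: wedge_def mv2_nth algebra_simps)
  then have "E$i$1 * wedge v w = 0" "E$i$2 * wedge v w = 0" for i
    by (simp_all only: assms(2,3)) simp_all
  then have "E = 0" using \<open>wedge v w \<noteq> 0\<close> by (simp add: mat2_eq_iff)
  then show False using assms(1) by simp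
qed

text \<open>If the determinants are bounded, such a limit has rank at most one: its image is the attracting
  limit point of a divergent sequence, its kernel the repelling one.\<close>

definition scaled_limits :: "(complex^2^2) set \<Rightarrow> (complex^2^2) set" where
  "scaled_limits S = {E. \<forall>\<epsilon>>0. \<exists>\<gamma>\<in>S. \<exists>c::real. 0 < c \<and> c < \<epsilon> \<and> norm (c *\<^sub>R \<gamma> - E) < \<epsilon>}"

lemma scaled_limits_seq:
  assumes "E \<in> scaled_limits S"
  obtains \<gamma> c where "\<And>n::nat. \<gamma> n \<in> S" "\<And>n. c n > 0" "c \<longlonglongrightarrow> 0" "(\<lambda>n. c n *\<^sub>R \<gamma> n) \<longlonglongrightarrow> E"
proof -
  have "\<forall>n::nat. \<exists>\<gamma> c. \<gamma> \<in> S \<and> 0 < c \<and> c < 1 / (real n + 1) \<and> norm (c *\<^sub>R \<gamma> - E) < 1 / (real n + 1)"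
  proof
    fix n :: nat
    have "1 / (real n + 1) > 0" by simp
    then show "\<exists>\<gamma> c. \<gamma> \<in> S \<and> 0 < c \<and> c < 1 / (real n + 1) \<and> norm (c *\<^sub>R \<gamma> - E) < 1 / (real n + 1)"
      using assms unfolding scaled_limits_def by blast
  qed
  then obtain \<gamma> c where gc: "\<And>n. \<gamma> n \<in> S \<and> 0 < c n \<and> c n < 1 / (real n + 1) \<and>
      norm (c n *\<^sub>R \<gamma> n - E) < 1 / (real n + 1)" by metis
  have lim: "(\<lambda>n. 1 / (real n + 1)) \<longlonglongrightarrow> 0"
    using LIMSEQ_inverse_real_of_nat by (simp add: inverse_eq_divide add.commute)
  have small: "norm (c n) \<le> 1 / (real n + 1)" "norm (c n *\<^sub>R \<gamma> n - E) \<le> 1 / (real n + 1)" for n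
    using gc[of n] by auto
  have c0: "c \<longlonglongrightarrow> 0"
    by (rule Lim_null_comparison[OF always_eventually lim]) (use small in blast)
  have "(\<lambda>n. c n *\<^sub>R \<gamma> n - E) \<longlonglongrightarrow> 0"
    by (rule Lim_null_comparison[OF always_eventually lim]) (use small in blast)
  then have cE: "(\<lambda>n. c n *\<^sub>R \<gamma> n) \<longlonglongrightarrow> E" by (rule LIM_zero_cancel)
  show thesis by (rule that[OF _ _ c0 cE]) (use gc in simp_all)
qed

lemma scaled_limitsI:
  assumes "\<And>n::nat. \<gamma> n \<in> S" "\<And>n. c n > 0" "c \<longlonglongrightarrow> 0" "(\<lambda>n. c n *\<^sub>R \<gamma> n) \<longlonglongrightarrow> E"
  shows "E \<in> scaled_limits S"
  unfolding scaled_limits_def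
proof (intro CollectI allI impI)
  fix \<epsilon> :: real assume e: "\<epsilon> > 0"
  have "\<forall>\<^sub>F n in sequentially. dist (c n) 0 < \<epsilon>" using assms(3) e by (rule tendstoD)
  moreover have "\<forall>\<^sub>F n in sequentially. dist (c n *\<^sub>R \<gamma> n) E < \<epsilon>" using assms(4) e by (rule tendstoD)
  ultimately have "\<forall>\<^sub>F n in sequentially. dist (c n) 0 < \<epsilon> \<and> dist (c n *\<^sub>R \<gamma> n) E < \<epsilon>"
    by (rule eventually_conj)
  then obtain n where "dist (c n) 0 < \<epsilon>" "dist (c n *\<^sub>R \<gamma> n) E < \<epsilon>"
    using eventually_happens'[OF sequentially_bot] by blast
  then show "\<exists>\<gamma>\<in>S. \<exists>c>0. c < \<epsilon> \<and> norm (c *\<^sub>R \<gamma> - E) < \<epsilon>"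
    using assms(1,2)[of n] by (intro bexI[of _ "\<gamma> n"] exI[of _ "c n"]) (auto simp: dist_norm)
qed

lemma closed_scaled_limits: "closed (scaled_limits S)"
  unfolding closure_subset_eq[symmetric]
proof
  fix E assume "E \<in> closure (scaled_limits S)"
  then have E: "\<forall>e>0. \<exists>F\<in>scaled_limits S. dist F E < e" by (simp add: closure_approachable)
  show "E \<in> scaled_limits S"
    unfolding scaled_limits_def
  proof (intro CollectI allI impI)
    fix \<epsilon> :: real assume "\<epsilon> > 0"
    then obtain F where F: "F \<in> scaled_limits S" "dist F E < \<epsilon> / 2" using E half_gt_zero by blast
    then obtain \<gamma> c where g: "\<gamma> \<in> S" "0 < c" "c < \<epsilon> / 2" "norm (c *\<^sub>R \<gamma> - F) < \<epsilon> / 2"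
      using \<open>\<epsilon> > 0\<close> half_gt_zero unfolding scaled_limits_def by blast
    have "norm (c *\<^sub>R \<gamma> - E) < \<epsilon>"
      using F(2) g(4) norm_triangle_ineq[of "c *\<^sub>R \<gamma> - F" "F - E"] by (simp add: dist_norm)
    then show "\<exists>\<gamma>\<in>S. \<exists>c>0. c < \<epsilon> \<and> norm (c *\<^sub>R \<gamma> - E) < \<epsilon>"
      using g by (intro bexI[OF _ g(1)] exI[of _ c]) auto
  qed
qed

lemma scaled_limits_scale:
  assumes "E \<in> scaled_limits S" "s > 0" shows "s *\<^sub>R E \<in> scaled_limits S"
proof -
  obtain \<gamma> c where g: "\<And>n::nat. \<gamma> n \<in> S" "\<And>n. c n > 0" "c \<longlonglongrightarrow> 0" "(\<lambda>n. c n *\<^sub>R \<gamma> n) \<longlonglongrightarrow> E"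
    using assms(1) by (rule scaled_limits_seq) blast
  show ?thesis
  proof (rule scaled_limitsI[where \<gamma> = \<gamma> and c = "\<lambda>n. s * c n"])
    show "(\<lambda>n. s * c n) \<longlonglongrightarrow> 0" using tendsto_mult_right_zero[OF g(3)] .
    show "(\<lambda>n. (s * c n) *\<^sub>R \<gamma> n) \<longlonglongrightarrow> s *\<^sub>R E"
      using tendsto_scaleR[OF tendsto_const g(4), of s] by simp
  qed (use g assms(2) in auto)
qed

lemma scaled_limits_translate:
  assumes "E \<in> scaled_limits S" shows "a ** E ** b \<in> scaled_limits ((\<lambda>\<gamma>. a ** \<gamma> ** b) ` S)"
proof -
  obtain \<gamma> c where g: "\<And>n::nat. \<gamma> n \<in> S" "\<And>n. c n > 0" "c \<longlonglongrightarrow> 0" "(\<lambda>n. c n *\<^sub>R \<gamma> n) \<longlonglongrightarrow> E"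
    using assms by (rule scaled_limits_seq) blast
  show ?thesis
  proof (rule scaled_limitsI[where \<gamma> = "\<lambda>n. a ** \<gamma> n ** b" and c = c])
    show "(\<lambda>n. c n *\<^sub>R (a ** \<gamma> n ** b)) \<longlonglongrightarrow> a ** E ** b"
      using mm.tendsto[OF mm.tendsto[OF tendsto_const[of a] g(4)] tendsto_const[of b]]
      by (simp add: mm.scaleR_left mm.scaleR_right)
  qed (use g in auto)
qed

lemma scaled_limits_mult:
  assumes S: "\<And>x y. x \<in> S \<Longrightarrow> y \<in> S \<Longrightarrow> x ** y \<in> S"
    and "E \<in> scaled_limits S" "F \<in> scaled_limits S" shows "E ** F \<in> scaled_limits S"
proof -
  obtain \<gamma> c where g: "\<And>n::nat. \<gamma> n \<in> S" "\<And>n. c n > 0" "c \<longlonglongrightarrow> 0" "(\<lambda>n. c n *\<^sub>R \<gamma> n) \<longlonglongrightarrow> E"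
    using assms(2) by (rule scaled_limits_seq) blast
  obtain \<delta> d where d: "\<And>n::nat. \<delta> n \<in> S" "\<And>n. d n > 0" "d \<longlonglongrightarrow> 0" "(\<lambda>n. d n *\<^sub>R \<delta> n) \<longlonglongrightarrow> F"
    using assms(3) by (rule scaled_limits_seq) blast
  show ?thesis
  proof (rule scaled_limitsI[where \<gamma> = "\<lambda>n. \<gamma> n ** \<delta> n" and c = "\<lambda>n. c n * d n"])
    show "(\<lambda>n. c n * d n) \<longlonglongrightarrow> 0" using tendsto_mult[OF g(3) d(3)] by simp
    show "(\<lambda>n. (c n * d n) *\<^sub>R (\<gamma> n ** \<delta> n)) \<longlonglongrightarrow> E ** F"
      using mm.tendsto[OF g(4) d(4)] by (simp add: mm.scaleR_left mm.scaleR_right mult.commute)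
    show "c n * d n > 0" for n using g(2) d(2) by simp
  qed (use g d S in auto)
qed

lemma adj2_scaleR: "adj2 (c *\<^sub>R \<gamma>) = c *\<^sub>R adj2 \<gamma>"
  by (simp add: mat2_eq_iff)

lemma tendsto_matrix_nth:
  fixes f :: "'a \<Rightarrow> complex^2^2"
  assumes "(f \<longlongrightarrow> E) F" shows "((\<lambda>x. f x $ i $ j) \<longlongrightarrow> E $ i $ j) F"
  by (intro tendsto_vec_nth assms)

lemma tendsto_matrixI:
  fixes f :: "'a \<Rightarrow> complex^2^2"
  assumes "\<And>i j. ((\<lambda>x. f x $ i $ j) \<longlongrightarrow> E $ i $ j) F" shows "(f \<longlongrightarrow> E) F"
  by (rule vec_tendstoI, rule vec_tendstoI, rule assms)

lemma scaled_limits_adj2: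
  assumes S: "\<And>x. x \<in> S \<Longrightarrow> adj2 x \<in> S" and "E \<in> scaled_limits S"
  shows "adj2 E \<in> scaled_limits S"
proof -
  obtain \<gamma> c where g: "\<And>n::nat. \<gamma> n \<in> S" "\<And>n. c n > 0" "c \<longlonglongrightarrow> 0" "(\<lambda>n. c n *\<^sub>R \<gamma> n) \<longlonglongrightarrow> E"
    using assms(2) by (rule scaled_limits_seq) blast
  show ?thesis
  proof (rule scaled_limitsI[where \<gamma> = "\<lambda>n. adj2 (\<gamma> n)" and c = c])
    show "(\<lambda>n. c n *\<^sub>R adj2 (\<gamma> n)) \<longlonglongrightarrow> adj2 E"
    proof (rule tendsto_matrixI)
      fix i j :: 2
      show "(\<lambda>n. (c n *\<^sub>R adj2 (\<gamma> n)) $ i $ j) \<longlonglongrightarrow> adj2 E $ i $ j"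
        unfolding adj2_scaleR[symmetric] using exhaust_2[of i] exhaust_2[of j]
        by (auto simp del: vector_scaleR_component intro!: tendsto_minus tendsto_matrix_nth[OF g(4)])
    qed
  qed (use g S in auto)
qed

lemma det_scaled_limits:
  assumes "\<And>x. x \<in> S \<Longrightarrow> det x = 1" "E \<in> scaled_limits S" shows "det E = 0"
proof -
  obtain \<gamma> c where g: "\<And>n::nat. \<gamma> n \<in> S" "\<And>n. c n > 0" "c \<longlonglongrightarrow> 0" "(\<lambda>n. c n *\<^sub>R \<gamma> n) \<longlonglongrightarrow> E"
    using assms(2) by (rule scaled_limits_seq) blast
  have "(\<lambda>n. det (c n *\<^sub>R \<gamma> n)) \<longlonglongrightarrow> det E"
    unfolding det_2 by (intro tendsto_intros tendsto_matrix_nth g(4))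
  moreover have "det (c n *\<^sub>R \<gamma> n) = of_real ((c n)\<^sup>2)" for n
  proof -
    have "det (c n *\<^sub>R \<gamma> n) = of_real ((c n)\<^sup>2) * det (\<gamma> n)"
      by (simp add: det_2) (simp add: scaleR_conv_of_real power2_eq_square algebra_simps)
    then show ?thesis using assms(1)[OF g(1)] by simp
  qed
  moreover have "(\<lambda>n. complex_of_real ((c n)\<^sup>2)) \<longlonglongrightarrow> of_real (0\<^sup>2)"
    by (intro tendsto_intros g(3))
  ultimately show ?thesis using LIMSEQ_unique by fastforce
qed

lemma normalized_limit:
  fixes \<gamma> :: "nat \<Rightarrow> complex^2^2"
  assumes "\<And>n. \<gamma> n \<noteq> 0"
  obtains E r where "norm E = 1" "strict_mono (r :: nat \<Rightarrow> nat)"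
    "(\<lambda>n. (1 / norm (\<gamma> (r n))) *\<^sub>R \<gamma> (r n)) \<longlonglongrightarrow> E"
proof -
  define f where "f n = (1 / norm (\<gamma> n)) *\<^sub>R \<gamma> n" for n
  have "\<forall>n. f n \<in> sphere 0 1" using assms by (simp add: f_def)
  then obtain E r where "E \<in> sphere 0 1" "strict_mono (r :: nat \<Rightarrow> nat)" "(f \<circ> r) \<longlonglongrightarrow> E"
    using compact_sphere[of "0 :: complex^2^2" 1] unfolding compact_def by blast
  then show thesis using that[of E r] by (simp add: o_def f_def)
qed

lemma unbounded_scaled_limit:
  assumes "\<And>n. \<gamma> n \<in> S" "\<And>n. norm (\<gamma> n) > real n"
  obtains E r where "norm E = 1" "E \<in> scaled_limits S" "strict_mono (r :: nat \<Rightarrow> nat)"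
    "(\<lambda>n. (1 / norm (\<gamma> (r n))) *\<^sub>R \<gamma> (r n)) \<longlonglongrightarrow> E"
proof -
  have nz: "\<gamma> n \<noteq> 0" for n using assms(2)[of n] by auto
  obtain E r where E: "norm E = 1" "strict_mono (r :: nat \<Rightarrow> nat)"
    "(\<lambda>n. (1 / norm (\<gamma> (r n))) *\<^sub>R \<gamma> (r n)) \<longlonglongrightarrow> E"
    using normalized_limit[of \<gamma>, OF nz] by blast
  have "E \<in> scaled_limits S"
  proof (rule scaled_limitsI[where \<gamma> = "\<lambda>n. \<gamma> (r n)" and c = "\<lambda>n. 1 / norm (\<gamma> (r n))"])
    show "1 / norm (\<gamma> (r n)) > 0" for n using nz by simp
    show "(\<lambda>n. 1 / norm (\<gamma> (r n))) \<longlonglongrightarrow> 0"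
    proof (rule Lim_null_comparison[OF _ lim_1_over_n])
      have "norm (1 / norm (\<gamma> (r n))) \<le> 1 / real n" if "n \<ge> 1" for n
      proof -
        have "real n \<le> real (r n)" using seq_suble[OF E(2)] by simp
        then have "real n \<le> norm (\<gamma> (r n))" using assms(2)[of "r n"] by linarith
        then show ?thesis using that by (simp add: frac_le)
      qed
      then show "\<forall>\<^sub>F n in sequentially. norm (1 / norm (\<gamma> (r n))) \<le> 1 / real n"
        unfolding eventually_sequentially by blast
    qed
  qed (use assms E in auto)
  then show thesis using that E by blast
qed

section \<open>Discrete groups with a fixed point\<close>

lemma mv_assoc: "(a ** b) *v x = a *v (b *v (x :: complex^2))"
  by (simp add: matrix_vector_mul_assoc)

lemma SL2_first_column:
  fixes v :: "complex^2"
  assumes "v \<noteq> 0" obtains g :: "complex^2^2" where "det g = 1" "g$1$1 = v$1" "g$2$1 = v$2"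
proof (cases "v$1 = 0")
  case True
  then have "v$2 \<noteq> 0" using assms by (simp add: vec2_eq_iff)
  then show ?thesis using True that[of "mat2 (v$1) (- inverse (v$2)) (v$2) 0"] by (simp add: det_2)
next
  case False
  then show ?thesis using that[of "mat2 (v$1) 0 (v$2) (inverse (v$1))"] by (simp add: det_2)
qed

definition conj_by :: "complex^2^2 \<Rightarrow> complex^2^2 \<Rightarrow> complex^2^2" where
  "conj_by g t = adj2 g ** t ** g"

lemma conj_by_cancel:
  assumes "det g = 1" shows "g ** conj_by g t ** adj2 g = t"
proof -
  have "g ** conj_by g t ** adj2 g = (g ** adj2 g) ** t ** (g ** adj2 g)"
    by (simp add: conj_by_def matrix_mul_assoc)
  then show ?thesis by (simp add: adj2_mult assms)
qed

lemma conj_by_mult: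
  assumes "det g = 1" shows "conj_by g s ** conj_by g t = conj_by g (s ** t)"
proof -
  have "conj_by g s ** conj_by g t = adj2 g ** s ** (g ** adj2 g) ** t ** g"
    by (simp add: conj_by_def matrix_mul_assoc)
  then show ?thesis by (simp add: adj2_mult assms conj_by_def matrix_mul_assoc)
qed

lemma conj_by_adj2: "conj_by g (adj2 t) = adj2 (conj_by g t)"
  by (simp add: conj_by_def mat2_simps algebra_simps)

lemma conj_by_vec:
  assumes "det g = 1" shows "t *v x = g *v (conj_by g t *v (adj2 g *v x))"
  by (metis assms conj_by_cancel mv_assoc)

lemma norm_le_norm_conj_by:
  assumes "det g = 1" obtains M where "M \<ge> 0" "\<And>t. norm t \<le> M * norm (conj_by g t)"
proof -
  obtain M where M: "M > 0" "\<And>(A::complex^2^2) (B::complex^2^2). norm (A ** B) \<le> norm A * norm B * M"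
    using mm.pos_bounded by metis
  have "norm t \<le> norm g * M * norm (adj2 g) * M * norm (conj_by g t)" for t
  proof -
    have "norm t \<le> norm (g ** conj_by g t) * norm (adj2 g) * M"
      using M(2)[of "g ** conj_by g t" "adj2 g"] by (simp add: conj_by_cancel assms)
    also have "\<dots> \<le> norm g * norm (conj_by g t) * M * norm (adj2 g) * M"
      using M(1) by (intro mult_right_mono M(2)) auto
    finally show ?thesis by (simp add: mult_ac)
  qed
  moreover have "norm g * M * norm (adj2 g) * M \<ge> 0" using M(1) by simp
  ultimately show thesis using that by blast
qed

text \<open>The image directions take at most two values, as for an elementary group. If all
  diagonal entries have modulus 1, the second row stays bounded and disappears after rescaling.
  Otherwise some t0 has an eigenvalue off the unit circle, and discreteness makes the whole group
  diagonal in an eigenbasis of t0.\<close>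

lemma triangular_scaled_limits:
  assumes det: "\<And>t. t \<in> T \<Longrightarrow> det t = 1" and tri: "\<And>t. t \<in> T \<Longrightarrow> t$2$1 = 0"
    and mult: "\<And>s t. s \<in> T \<Longrightarrow> t \<in> T \<Longrightarrow> s ** t \<in> T"
    and adj: "\<And>t. t \<in> T \<Longrightarrow> adj2 t \<in> T"
    and fin: "\<And>B. finite {t \<in> T. norm t \<le> B}"
  shows "\<exists>v w. v \<noteq> 0 \<and> w \<noteq> 0 \<and>
    (\<forall>E\<in>scaled_limits T. \<forall>x. wedge v (E *v x) = 0 \<or> wedge w (E *v x) = 0)"
proof (cases "\<forall>t\<in>T. cmod (t$1$1) = 1")
  case True
  let ?e = "hv None"
  have "wedge ?e (E *v x) = 0" if E: "E \<in> scaled_limits T" for E x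
  proof -
    obtain \<gamma> c where g: "\<And>n::nat. \<gamma> n \<in> T" "\<And>n. c n > 0" "c \<longlonglongrightarrow> 0" "(\<lambda>n. c n *\<^sub>R \<gamma> n) \<longlonglongrightarrow> E"
      using E by (rule scaled_limits_seq) blast
    have "cmod (adj2 (\<gamma> n) $ 1 $ 1) = 1" for n using True adj[OF g(1)[of n]] by blast
    then have "cmod (\<gamma> n $ 2 $ 2) = 1" for n by simp
    then have "norm ((c n *\<^sub>R \<gamma> n) $ 2 $ j) \<le> c n" for n j
      using g(2)[of n] tri[OF g(1)] exhaust_2[of j] by auto
    then have "(\<lambda>n. (c n *\<^sub>R \<gamma> n) $ 2 $ j) \<longlonglongrightarrow> 0" for j
      by (intro Lim_null_comparison[OF _ g(3)]) auto
    then have "E$2$j = 0" for j using tendsto_matrix_nth[OF g(4), of 2 j] LIMSEQ_unique by blast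
    then show ?thesis by (simp add: wedge_def mv2_nth)
  qed
  then show ?thesis using hv_nonzero by blast
next
  case False
  then obtain t1 where t1: "t1 \<in> T" "cmod (t1$1$1) \<noteq> 1" by blast
  have "\<exists>t0\<in>T. cmod (t0$1$1) > 1"
  proof (cases "cmod (t1$1$1) > 1")
    case True
    then show ?thesis using t1 by blast
  next
    case False
    have "t1$1$1 * t1$2$2 = 1" using det[OF t1(1)] tri[OF t1(1)] by (simp add: det_2)
    then have "cmod (t1$1$1) * cmod (t1$2$2) = 1" by (metis norm_mult norm_one)
    moreover have "cmod (t1$1$1) * cmod (t1$2$2) \<le> cmod (t1$1$1) * 1" if "cmod (t1$2$2) \<le> 1"
      by (rule mult_left_mono[OF that norm_ge_zero])
    ultimately have "cmod (t1$2$2) > 1" using False t1(2) by force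
    then show ?thesis using adj[OF t1(1)] by (intro bexI[of _ "adj2 t1"]) auto
  qed
  then obtain t0 where t0: "t0 \<in> T" "cmod (t0$1$1) > 1" by blast
  define a where "a = t0$1$1"
  have a: "cmod a > 1" "a \<noteq> 0" using t0 by (auto simp: a_def)
  have a22: "t0$2$2 = inverse a" using det[OF t0(1)] tri[OF t0(1)] a(2)
    by (simp add: det_2 a_def field_simps)
  have "inverse a \<noteq> a"
  proof
    assume "inverse a = a"
    then have "cmod a * cmod a = 1" using a(2) by (metis norm_mult norm_one right_inverse)
    then show False using a(1) by (metis less_1_mult order_less_irrefl)
  qed
  then have aa: "inverse a - a \<noteq> 0" by simp
  \<comment> \<open>The second column is the eigenvector of t0 for the eigenvalue 1/a; the first
    basis vector is the other one.\<close>
  define p where "p = mat2 1 (t0$1$2 / (inverse a - a)) 0 1"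
  have p: "det p = 1" by (simp add: p_def det_2)
  let ?C = "conj_by p"
  have C_nth: "?C t $ 1 $ 1 = t$1$1" "?C t $ 2 $ 1 = 0" "?C t $ 2 $ 2 = t$2$2" if "t \<in> T" for t
    using tri[OF that] by (simp_all add: conj_by_def p_def matrix_mult_2_nth)
  have C_t0: "?C t0 = mat2 a 0 0 (inverse a)"
    using tri[OF t0(1)] aa a22 by (simp add: mat2_simps conj_by_def p_def a_def[symmetric] field_simps)
  have C_adj: "?C (adj2 t0) = mat2 (inverse a) 0 0 a"
    using tri[OF t0(1)] aa a22 by (simp add: mat2_simps conj_by_def p_def a_def[symmetric] field_simps)
  \<comment> \<open>Conjugation by powers of t0 divides the off-diagonal entry by a^(2n) and keeps
    the diagonal. A nonzero entry would produce infinitely many elements of bounded norm.\<close>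
  have zero: "?C t $ 1 $ 2 = 0" if t: "t \<in> T" for t
  proof (rule ccontr)
    assume nz: "?C t $ 1 $ 2 \<noteq> 0"
    have "\<exists>s\<in>T. ?C s = mat2 (t$1$1) (?C t $ 1 $ 2 / a ^ (2 * n)) 0 (t$2$2)" for n
    proof (induction n)
      case 0
      show ?case using C_nth[OF t] t by (intro bexI[of _ t]) (auto simp: mat2_eq_iff)
    next
      case (Suc n)
      then obtain s where s: "s \<in> T" "?C s = mat2 (t$1$1) (?C t $ 1 $ 2 / a ^ (2 * n)) 0 (t$2$2)" by blast
      have "?C (adj2 t0 ** s ** t0) = mat2 (t$1$1) (?C t $ 1 $ 2 / a ^ (2 * Suc n)) 0 (t$2$2)"
        unfolding conj_by_mult[OF p, symmetric] C_adj s(2) C_t0 using a(2) by (simp add: mat2_simps field_simps)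
      moreover have "adj2 t0 ** s ** t0 \<in> T" using mult adj t0(1) s(1) by blast
      ultimately show ?case by blast
    qed
    then obtain s where s: "\<And>n. s n \<in> T" "\<And>n. ?C (s n) = mat2 (t$1$1) (?C t $ 1 $ 2 / a ^ (2 * n)) 0 (t$2$2)"
      by metis
    have "inj s"
    proof (rule linorder_injI)
      fix m n :: nat assume "m < n"
      show "s m \<noteq> s n"
      proof
        assume "s m = s n"
        then have "?C t $ 1 $ 2 / a ^ (2 * m) = ?C t $ 1 $ 2 / a ^ (2 * n)"
          using s(2)[of m] s(2)[of n] by (metis mat2_nth(2))
        then have "a ^ (2 * m) = a ^ (2 * n)" using nz a(2) by (simp add: field_simps)
        then have "cmod a ^ (2 * m) = cmod a ^ (2 * n)" by (metis norm_power)
        then show False using power_strict_increasing[of "2 * m" "2 * n" "cmod a"] \<open>m < n\<close> a(1) by simp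
      qed
    qed
    moreover have "\<exists>B. \<forall>n. norm (s n) \<le> B"
    proof -
      obtain M where M: "M \<ge> 0" "\<And>t. norm t \<le> M * norm (?C t)"
        using norm_le_norm_conj_by[OF p] by blast
      have le: "norm (?C (s n)) \<le> cmod (t$1$1) + cmod (?C t $ 1 $ 2) + cmod (t$2$2)" for n
      proof -
        have "norm (?C (s n)) \<le> (\<Sum>i\<in>UNIV. \<Sum>j\<in>UNIV. norm (?C (s n) $ i $ j))"
          unfolding norm_vec_def
          by (intro order_trans[OF L2_set_le_sum] sum_mono) (auto simp: L2_set_nonneg norm_vec_def intro!: L2_set_le_sum)
        also have "\<dots> = cmod (t$1$1) + cmod (?C t $ 1 $ 2 / a ^ (2 * n)) + cmod (t$2$2)"
          by (simp add: s(2) sum_2)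
        also have "cmod (?C t $ 1 $ 2 / a ^ (2 * n)) \<le> cmod (?C t $ 1 $ 2) / 1"
          unfolding norm_divide using a by (intro divide_left_mono) (auto simp: norm_power)
        finally show ?thesis by simp
      qed
      have "norm (s n) \<le> M * (cmod (t$1$1) + cmod (?C t $ 1 $ 2) + cmod (t$2$2))" for n
        using order_trans[OF M(2) mult_left_mono[OF le M(1)]] .
      then show ?thesis by blast
    qed
    then obtain B where "\<And>n. norm (s n) \<le> B" by blast
    then have "range s \<subseteq> {t \<in> T. norm t \<le> B}" using s(1) by auto
    ultimately show False using fin finite_subset range_inj_infinite by blast
  qed
  have "wedge (p *v hv None) (E *v x) = 0 \<or> wedge (p *v hv (Some 0)) (E *v x) = 0"
    if E: "E \<in> scaled_limits T" for E x
  proof -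
    have "?C E \<in> scaled_limits (?C ` T)" unfolding conj_by_def by (rule scaled_limits_translate[OF E])
    then obtain \<gamma> c where g: "\<And>n::nat. \<gamma> n \<in> ?C ` T" "\<And>n. c n > 0" "c \<longlonglongrightarrow> 0"
      "(\<lambda>n. c n *\<^sub>R \<gamma> n) \<longlonglongrightarrow> ?C E" by (rule scaled_limits_seq) blast
    have off: "\<gamma> n $ 1 $ 2 = 0" "\<gamma> n $ 2 $ 1 = 0" for n using g(1)[of n] zero C_nth by auto
    have "?C E $ 1 $ 2 = 0" "?C E $ 2 $ 1 = 0"
      using tendsto_matrix_nth[OF g(4), of 1 2] tendsto_matrix_nth[OF g(4), of 2 1]
      by (simp_all add: off LIMSEQ_const_iff)
    moreover have "det (?C E) = 0"
      using det_scaled_limits[OF det E] by (simp add: conj_by_def det_mul)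
    ultimately have "?C E $ 1 $ 1 = 0 \<or> ?C E $ 2 $ 2 = 0" by (simp add: det_2)
    then have "wedge (hv None) (?C E *v y) = 0 \<or> wedge (hv (Some 0)) (?C E *v y) = 0" for y
      using \<open>?C E $ 1 $ 2 = 0\<close> \<open>?C E $ 2 $ 1 = 0\<close> by (auto simp: wedge_def mv2_nth)
    then show ?thesis unfolding conj_by_vec[OF p, of E x] by (simp add: wedge_mult p)
  qed
  moreover have "p *v hv None \<noteq> 0" "p *v hv (Some 0) \<noteq> 0"
    using mult_vector_eq_0_imp[of p] hv_nonzero p by auto
  ultimately show ?thesis by blast
qed

text \<open>Conjugation takes v to the first basis vector, which makes T triangular; norms change by
  bounded factors, so discreteness is preserved.\<close>

lemma fixed_line_scaled_limits:
  assumes det: "\<And>t. t \<in> T \<Longrightarrow> det t = 1" and fix': "\<And>t. t \<in> T \<Longrightarrow> wedge v (t *v v) = 0" and "v \<noteq> 0"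
    and mult: "\<And>s t. s \<in> T \<Longrightarrow> t \<in> T \<Longrightarrow> s ** t \<in> T"
    and adj: "\<And>t. t \<in> T \<Longrightarrow> adj2 t \<in> T"
    and fin: "\<And>B. finite {t \<in> T. norm t \<le> B}"
  shows "\<exists>v w. v \<noteq> 0 \<and> w \<noteq> 0 \<and>
    (\<forall>E\<in>scaled_limits T. \<forall>x. wedge v (E *v x) = 0 \<or> wedge w (E *v x) = 0)"
proof -
  obtain g :: "complex^2^2" where "det g = 1" "g$1$1 = v$1" "g$2$1 = v$2"
    using SL2_first_column[OF \<open>v \<noteq> 0\<close>] by metis
  then have g: "det g = 1" "g *v hv None = v" by (simp_all add: vec2_eq_iff mv2_nth)
  let ?C = "conj_by g"
  have "\<exists>v w. v \<noteq> 0 \<and> w \<noteq> 0 \<and>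
    (\<forall>E\<in>scaled_limits (?C ` T). \<forall>x. wedge v (E *v x) = 0 \<or> wedge w (E *v x) = 0)"
  proof (rule triangular_scaled_limits)
    show "det t = 1" if "t \<in> ?C ` T" for t using that det g(1) by (auto simp: conj_by_def det_mul)
    show "t$2$1 = 0" if t: "t \<in> ?C ` T" for t
    proof -
      obtain s where s: "s \<in> T" "t = ?C s" using t by blast
      have "g *v (t *v hv None) = s *v v"
        using conj_by_vec[OF g(1), of s v] by (simp add: s(2) adj2_mult g(1) flip: g(2) mv_assoc)
      then have "wedge (g *v hv None) (g *v (t *v hv None)) = 0" using fix'[OF s(1)] g(2) by simp
      then have "wedge (hv None) (t *v hv None) = 0" by (simp add: wedge_mult g(1))
      then show ?thesis by (simp add: wedge_def mv2_nth)
    qed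
    show "s ** t \<in> ?C ` T" if "s \<in> ?C ` T" "t \<in> ?C ` T" for s t using that mult conj_by_mult[OF g(1)] by auto
    show "adj2 t \<in> ?C ` T" if "t \<in> ?C ` T" for t using that adj by (auto simp flip: conj_by_adj2)
    show "finite {t \<in> ?C ` T. norm t \<le> B}" for B
    proof -
      obtain M where M: "M \<ge> 0" "\<And>t. norm t \<le> M * norm (?C t)"
        using norm_le_norm_conj_by[OF g(1)] by blast
      have "norm t \<le> M * B" if "norm (?C t) \<le> B" for t
        using order_trans[OF M(2) mult_left_mono[OF that M(1)]] .
      then have "{t \<in> ?C ` T. norm t \<le> B} \<subseteq> ?C ` {t \<in> T. norm t \<le> M * B}" by blast
      then show ?thesis using fin finite_surj by blast
    qed
  qed
  then obtain v w where vw: "v \<noteq> 0" "w \<noteq> 0"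
    "\<And>E x. E \<in> scaled_limits (?C ` T) \<Longrightarrow> wedge v (E *v x) = 0 \<or> wedge w (E *v x) = 0" by blast
  have "wedge (g *v v) (E *v x) = 0 \<or> wedge (g *v w) (E *v x) = 0" if E: "E \<in> scaled_limits T" for E x
  proof -
    have "?C E \<in> scaled_limits (?C ` T)" unfolding conj_by_def by (rule scaled_limits_translate[OF E])
    then show ?thesis unfolding conj_by_vec[OF g(1), of E x] using vw(3) by (simp add: wedge_mult g)
  qed
  moreover have "g *v v \<noteq> 0" "g *v w \<noteq> 0"
    using mult_vector_eq_0_imp[of g] vw(1,2) g(1) by auto
  ultimately show ?thesis by blast
qed

section \<open>The limit set and rescaled limits\<close>

text \<open>Translates the topology of the sphere into an estimate that is homogeneous in the second
  vector, so that it can be applied to unnormalised vectors \<open>\<gamma> *v x\<close>.\<close>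

lemma sphere_neighbourhood:
  assumes "\<epsilon> > 0"
  obtains U where "openin sphere_topology U" "\<xi> \<in> U"
    "\<And>y. y \<in> U \<Longrightarrow> cmod (wedge (hv \<xi>) (hv y)) \<le> \<epsilon> * norm (hv y)"
proof (cases \<xi>)
  case None
  let ?U = "insert None (Some ` (- cball 0 (1 / \<epsilon>)))"
  have "openin sphere_topology ?U"
    unfolding sphere_topology_def openin_Alexandroff_compactification
    by (rule disjI2, intro exI[of _ "cball 0 (1 / \<epsilon>)"]) (auto simp: compact_cball)
  moreover have "cmod (wedge (hv \<xi>) (hv y)) \<le> \<epsilon> * norm (hv y)" if "y \<in> ?U" for y
  proof (cases y)
    case None
    then show ?thesis using \<open>\<xi> = None\<close> assms by (simp add: wedge_def)
  next
    case (Some w)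
    then have "1 / \<epsilon> < cmod w" using that by auto
    then have "1 \<le> \<epsilon> * cmod w" using assms by (simp add: field_simps)
    also have "\<dots> \<le> \<epsilon> * norm (hv y)"
      using assms Some Finite_Cartesian_Product.norm_nth_le[of "hv y" 1] by (intro mult_left_mono) auto
    finally show ?thesis using Some \<open>\<xi> = None\<close> by (simp add: wedge_def)
  qed
  ultimately show ?thesis using that[of ?U] None by blast
next
  case (Some x)
  let ?U = "Some ` ball x \<epsilon>"
  have "openin sphere_topology ?U"
    unfolding sphere_topology_def by (simp add: openin_Alexandroff_compactification_image_Some)
  moreover have "cmod (wedge (hv \<xi>) (hv y)) \<le> \<epsilon> * norm (hv y)" if yU: "y \<in> ?U" for y
  proof -
    obtain w where w: "y = Some w" "dist x w < \<epsilon>" using yU by auto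
    have "cmod (wedge (hv \<xi>) (hv y)) \<le> \<epsilon> * 1" using w by (simp add: Some wedge_def dist_norm)
    also have "\<dots> \<le> \<epsilon> * norm (hv y)"
      using assms Finite_Cartesian_Product.norm_nth_le[of "hv y" 2] w(1) by (intro mult_left_mono) auto
    finally show ?thesis .
  qed
  ultimately show ?thesis using that[of ?U] Some assms by auto
qed

lemma t1_space_sphere: "t1_space sphere_topology"
  unfolding sphere_topology_def
  using Hausdorff_imp_t1_space[OF Hausdorff_space_euclidean] by simp

lemma topspace_sphere [simp]: "topspace sphere_topology = UNIV"
  unfolding sphere_topology_def by (auto simp: notin_range_Some)

lemma finite_matrices:
  assumes "finite F" shows "finite {\<gamma> :: complex^2^2. \<forall>i j. \<gamma>$i$j \<in> F}"
proof -
  have "{\<gamma> :: complex^2^2. \<forall>i j. \<gamma>$i$j \<in> F} \<subseteq> (\<lambda>(a, b, c, d). mat2 a b c d) ` (F \<times> F \<times> F \<times> F)"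
  proof
    fix \<gamma> :: "complex^2^2" assume "\<gamma> \<in> {\<gamma>. \<forall>i j. \<gamma>$i$j \<in> F}"
    then show "\<gamma> \<in> (\<lambda>(a, b, c, d). mat2 a b c d) ` (F \<times> F \<times> F \<times> F)"
      by (intro image_eqI[of _ _ "(\<gamma>$1$1, \<gamma>$1$2, \<gamma>$2$1, \<gamma>$2$2)"]) (auto simp: mat2_eq_iff)
  qed
  then show ?thesis using assms by (meson finite_SigmaI finite_imageI finite_subset)
qed

lemma scaled_limits_mono: "S \<subseteq> S' \<Longrightarrow> scaled_limits S \<subseteq> scaled_limits S'"
  unfolding scaled_limits_def by blast

text \<open>The bound is homogeneous in \<open>G n\<close>; after division by the norm its right
  side is at most \<open>eps n\<close> times a constant.\<close>

lemma wedge_normalized_limit: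
  fixes G :: "nat \<Rightarrow> complex^2^2"
  assumes nz: "\<And>n. G n \<noteq> 0" and lim: "(\<lambda>n. (1 / norm (G n)) *\<^sub>R G n) \<longlonglongrightarrow> E"
    and eps: "\<And>n. eps n \<ge> 0" "eps \<longlonglongrightarrow> 0"
    and bound: "\<And>n. cmod (wedge u (G n *v x)) \<le> eps n * norm (G n *v x)"
  shows "wedge u (E *v x) = 0"
proof -
  have "bilinear ((*v) :: complex^2^2 \<Rightarrow> complex^2 \<Rightarrow> complex^2)"
    unfolding bilinear_def by (intro conjI allI linearI) (simp_all add: vec2_eq_iff mv2_nth algebra_simps)
  then have "bounded_bilinear ((*v) :: complex^2^2 \<Rightarrow> complex^2 \<Rightarrow> complex^2)"
    by (simp add: bilinear_conv_bounded_bilinear)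
  then obtain N where N: "N > 0" "\<And>(g::complex^2^2) (v::complex^2). norm (g *v v) \<le> norm g * norm v * N"
    using bounded_bilinear.pos_bounded by metis
  let ?u = "\<lambda>n. ((1 / norm (G n)) *\<^sub>R G n) *v x"
  have scale: "?u n = of_real (1 / norm (G n)) *s (G n *v x)" for n
    by (simp add: vec2_eq_iff mv2_nth) (simp add: scaleR_conv_of_real add_divide_distrib algebra_simps)
  have le: "norm (wedge u (?u n)) \<le> eps n * (norm x * N)" for n
  proof -
    have "norm (wedge u (?u n)) = (1 / norm (G n)) * cmod (wedge u (G n *v x))"
      unfolding scale wedge_scale by (simp add: norm_mult norm_divide)
    also have "\<dots> \<le> (1 / norm (G n)) * (eps n * (norm (G n) * norm x * N))"
      using N(2)[of "G n" x] eps(1)[of n] by (intro mult_left_mono order_trans[OF bound]) auto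
    also have "\<dots> = eps n * (norm x * N)" using nz by simp
    finally show ?thesis .
  qed
  have "(\<lambda>n. eps n * (norm x * N)) \<longlonglongrightarrow> 0" by (rule tendsto_mult_left_zero[OF eps(2)])
  then have lim0: "(\<lambda>n. wedge u (?u n)) \<longlonglongrightarrow> 0"
    by (rule Lim_null_comparison[OF always_eventually, rotated]) (use le in blast)
  have "(\<lambda>n. wedge u (?u n)) \<longlonglongrightarrow> wedge u (E *v x)"
    unfolding wedge_def mv2_nth by (intro tendsto_intros tendsto_matrix_nth lim)
  then show ?thesis using lim0 LIMSEQ_unique by blast
qed

section \<open>Limit points and limit directions of the group A\<close>

locale weak_group = bianchi +
  fixes A :: "(riemann_sphere \<Rightarrow> riemann_sphere) set"
  assumes weak: "weak_apollonian_group K A"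
begin

lemma A_subgroup: "subgroup A Moeb"
  using weak by (simp add: weak_apollonian_group_def kleinian_group_def)

lemma A_comp: "f \<in> A \<Longrightarrow> g \<in> A \<Longrightarrow> f \<circ> g \<in> A"
  using subgroup.m_closed[OF A_subgroup] Moeb_mult subgroup.mem_carrier[OF A_subgroup] by metis

lemma A_cases:
  assumes "f \<in> A"
  obtains \<gamma> where "\<gamma> \<in> SLK" "f = moebius \<gamma> \<or> f = moebius \<gamma> \<circ> conjugation"
  using assms weak extended_bianchi_groupE unfolding weak_apollonian_group_def by blast

definition Gam :: "(complex^2^2) set" where "Gam = {\<gamma> \<in> SLK. moebius \<gamma> \<in> A}"

lemma Gam_det: "\<gamma> \<in> Gam \<Longrightarrow> det \<gamma> = 1"
  by (simp add: Gam_def SLK_det)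

lemma Gam_one: "mat 1 \<in> Gam"
  using subgroup.one_closed[OF A_subgroup] by (simp add: Gam_def SLK_one moebius_one Moeb_one)

lemma Gam_mult: "\<alpha> \<in> Gam \<Longrightarrow> \<beta> \<in> Gam \<Longrightarrow> \<alpha> ** \<beta> \<in> Gam"
  by (simp add: Gam_def SLK_mult moebius_mult SLK_det A_comp)

lemma Gam_adj2: "\<gamma> \<in> Gam \<Longrightarrow> adj2 \<gamma> \<in> Gam"
  using subgroup.m_inv_closed[OF A_subgroup] by (simp add: Gam_def SLK_adj2 SLK_det flip: Moeb_inv_moebius)

text \<open>Discreteness in arithmetic form: only finitely many integers of K have bounded
  modulus.\<close>

lemma Gam_finite_bounded: "finite {\<gamma> \<in> Gam. norm \<gamma> \<le> B}"
proof -
  have "{\<gamma> \<in> Gam. norm \<gamma> \<le> B} \<subseteq> {\<gamma>. \<forall>i j. \<gamma>$i$j \<in> {x \<in> OK. cmod x \<le> B}}"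
  proof clarify
    fix \<gamma> i j assume g: "\<gamma> \<in> Gam" "norm \<gamma> \<le> B"
    have "norm (\<gamma>$i$j) \<le> norm \<gamma>"
      by (rule order_trans[OF Finite_Cartesian_Product.norm_nth_le Finite_Cartesian_Product.norm_nth_le])
    then show "\<gamma>$i$j \<in> OK \<and> cmod (\<gamma>$i$j) \<le> B" using g by (simp add: Gam_def SLK_def)
  qed
  then show ?thesis using finite_matrices[OF OK_finite_bounded] finite_subset by blast
qed

text \<open>Every neighbourhood of \<xi> contains infinitely many points of one orbit of
  \<open>Gam\<close>, and the finitely many matrices of norm at most B account for only finitely
  many of them.\<close>

lemma orbit_unbounded:
  assumes "\<xi> \<in> limit_set A"
  obtains z where "\<And>\<epsilon> B. \<epsilon> > 0 \<Longrightarrow> \<exists>\<gamma>\<in>Gam. norm \<gamma> > B \<and>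
      cmod (wedge (hv \<xi>) (hv (moebius \<gamma> z))) \<le> \<epsilon> * norm (hv (moebius \<gamma> z))"
proof -
  let ?orb = "\<lambda>z. (\<lambda>\<gamma>. moebius \<gamma> z) ` Gam"
  obtain z where z: "\<xi> \<in> sphere_topology derived_set_of ((\<lambda>f. f z) ` A)"
    using assms unfolding limit_set_def by blast
  then have inf: "infinite ((\<lambda>f. f z) ` A \<inter> U)" if "openin sphere_topology U" "\<xi> \<in> U" for U
    using that t1_space_derived_set_of_infinite_openin[THEN iffD1, OF t1_space_sphere] by auto
  \<comment> \<open>\<open>Gam\<close> captures a subgroup of index at most 2; the images of z under
    the other coset form the orbit of w, the image of z under one anti-Moebius element.\<close>
  have "\<exists>w. (\<lambda>f. f z) ` A \<subseteq> ?orb z \<union> ?orb w"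
  proof (cases "\<exists>\<delta>\<in>SLK. moebius \<delta> \<circ> conjugation \<in> A")
    case True
    then obtain \<delta> where d: "\<delta> \<in> SLK" "moebius \<delta> \<circ> conjugation \<in> A" by blast
    let ?a = "moebius \<delta> \<circ> conjugation"
    have "f z \<in> ?orb z \<union> ?orb (?a z)" if f: "f \<in> A" for f
    proof -
      obtain \<gamma> where g: "\<gamma> \<in> SLK" "f = moebius \<gamma> \<or> f = moebius \<gamma> \<circ> conjugation"
        using A_cases[OF f] by blast
      show ?thesis
      proof (cases "f = moebius \<gamma>")
        case True
        then show ?thesis using f g(1) by (auto simp: Gam_def)
      next
        case False
        then have fg: "f = moebius \<gamma> \<circ> conjugation" using g(2) by blast
        have c: "?a \<in> carrier Moeb" using d(2) subgroup.mem_carrier[OF A_subgroup] by blast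
        have inv: "inv\<^bsub>Moeb\<^esub> ?a \<in> A" using subgroup.m_inv_closed[OF A_subgroup d(2)] .
        then have "inv\<^bsub>Moeb\<^esub> ?a \<circ> ?a = id"
          using Moeb.l_inv[OF c] Moeb_mult[OF _ c] subgroup.mem_carrier[OF A_subgroup] by (simp add: Moeb_one)
        then have fa: "f = f \<circ> inv\<^bsub>Moeb\<^esub> ?a \<circ> ?a" by (simp add: comp_assoc)
        have fA: "f \<circ> inv\<^bsub>Moeb\<^esub> ?a \<in> A" using A_comp f inv by blast
        obtain \<beta> where b: "\<beta> \<in> SLK" "f \<circ> inv\<^bsub>Moeb\<^esub> ?a = moebius \<beta> \<or> f \<circ> inv\<^bsub>Moeb\<^esub> ?a = moebius \<beta> \<circ> conjugation"
          using A_cases[OF fA] by blast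
        have "f \<circ> inv\<^bsub>Moeb\<^esub> ?a \<noteq> moebius \<beta> \<circ> conjugation"
        proof
          assume "f \<circ> inv\<^bsub>Moeb\<^esub> ?a = moebius \<beta> \<circ> conjugation"
          then have 1: "f = moebius \<beta> \<circ> conjugation \<circ> ?a" using fa by metis
          have 2: "moebius \<beta> \<circ> conjugation \<circ> moebius \<delta> = moebius (\<beta> ** cnjm \<delta>) \<circ> conjugation"
            using b(1) d(1) SLK_det by (simp add: comp_assoc conjugation_moebius moebius_mult)
          have "f = moebius (\<beta> ** cnjm \<delta>)"
            unfolding 1 comp_assoc[symmetric] 2 by (simp add: comp_assoc)
          then have "moebius (\<beta> ** cnjm \<delta>) = moebius \<gamma> \<circ> conjugation" using fg by metis
          then show False
            using moebius_neq_moebius_conjugation[of "\<beta> ** cnjm \<delta>" \<gamma>] b(1) d(1) g(1) SLK_det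
            by (simp add: det_mul)
        qed
        then have fb: "f \<circ> inv\<^bsub>Moeb\<^esub> ?a = moebius \<beta>" using b(2) by blast
        then have m: "\<beta> \<in> Gam" using b(1) fA by (simp add: Gam_def)
        have "f z = moebius \<beta> (?a z)" using fa unfolding fb by (metis comp_apply)
        then show ?thesis using m by blast
      qed
    qed
    then show ?thesis by blast
  next
    case False
    have "f z \<in> ?orb z" if f: "f \<in> A" for f
    proof -
      obtain \<gamma> where g: "\<gamma> \<in> SLK" "f = moebius \<gamma> \<or> f = moebius \<gamma> \<circ> conjugation"
        using A_cases[OF f] by blast
      then have "f = moebius \<gamma>" using False f by blast
      then show ?thesis using f g(1) by (auto simp: Gam_def)
    qed
    then show ?thesis by blast
  qed
  then obtain w where w: "(\<lambda>f. f z) ` A \<subseteq> ?orb z \<union> ?orb w" by blast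
  \<comment> \<open>If the first orbit is finite in some neighbourhood V, the second must be
    infinite in every U, as seen in the intersection of U and V.\<close>
  have "\<exists>y. \<forall>U. openin sphere_topology U \<longrightarrow> \<xi> \<in> U \<longrightarrow> infinite (?orb y \<inter> U)"
  proof (cases "\<forall>U. openin sphere_topology U \<longrightarrow> \<xi> \<in> U \<longrightarrow> infinite (?orb z \<inter> U)")
    case True
    then show ?thesis by blast
  next
    case False
    then obtain V where V: "openin sphere_topology V" "\<xi> \<in> V" "finite (?orb z \<inter> V)" by blast
    have "infinite (?orb w \<inter> U)" if U: "openin sphere_topology U" "\<xi> \<in> U" for U
    proof
      assume f: "finite (?orb w \<inter> U)"
      have "(\<lambda>f. f z) ` A \<inter> (U \<inter> V) \<subseteq> (?orb z \<inter> V) \<union> (?orb w \<inter> U)" using w by blast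
      then have "finite ((\<lambda>f. f z) ` A \<inter> (U \<inter> V))" using f V(3) by (meson finite_UnI finite_subset)
      then show False using inf[of "U \<inter> V"] U V(1,2) by (simp add: openin_Int)
    qed
    then show ?thesis by blast
  qed
  then obtain y where y: "\<And>U. openin sphere_topology U \<Longrightarrow> \<xi> \<in> U \<Longrightarrow> infinite (?orb y \<inter> U)" by blast
  show thesis
  proof (rule that[of y])
    fix \<epsilon> B :: real assume "\<epsilon> > 0"
    then obtain U where U: "openin sphere_topology U" "\<xi> \<in> U"
      "\<And>y. y \<in> U \<Longrightarrow> cmod (wedge (hv \<xi>) (hv y)) \<le> \<epsilon> * norm (hv y)"
      using sphere_neighbourhood[of \<epsilon> \<xi>] by metis
    show "\<exists>\<gamma>\<in>Gam. norm \<gamma> > B \<and> cmod (wedge (hv \<xi>) (hv (moebius \<gamma> y))) \<le> \<epsilon> * norm (hv (moebius \<gamma> y))"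
    proof (rule ccontr)
      assume "\<not> ?thesis"
      then have "?orb y \<inter> U \<subseteq> (\<lambda>\<gamma>. moebius \<gamma> y) ` {\<gamma> \<in> Gam. norm \<gamma> \<le> B}" using U(3) by force
      then show False using y[OF U(1,2)] Gam_finite_bounded finite_surj by blast
    qed
  qed
qed

text \<open>A normalised limit E of the \<gamma>_n maps \<open>hv z\<close> into the line of \<xi>.
  Since E has rank one, this settles the matter unless z is the repelling point, that is
  \<open>E *v hv z = 0\<close>.\<close>

lemma limit_point_direction:
  assumes "\<xi> \<in> limit_set A"
  obtains E where "E \<in> scaled_limits Gam" "E \<noteq> 0" "\<And>x. wedge (hv \<xi>) (E *v x) = 0"
proof -
  obtain z where z: "\<And>\<epsilon> B. \<epsilon> > 0 \<Longrightarrow> \<exists>\<gamma>\<in>Gam. norm \<gamma> > B \<and>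
      cmod (wedge (hv \<xi>) (hv (moebius \<gamma> z))) \<le> \<epsilon> * norm (hv (moebius \<gamma> z))"
    using orbit_unbounded[OF assms] by blast
  define eps where "eps n = 1 / (real n + 1)" for n
  have eps: "eps n > 0" for n by (simp add: eps_def)
  have eps_lim: "eps \<longlonglongrightarrow> 0"
    unfolding eps_def using LIMSEQ_inverse_real_of_nat by (simp add: inverse_eq_divide add.commute)
  have "\<exists>\<gamma>\<in>Gam. norm \<gamma> > real n \<and>
      cmod (wedge (hv \<xi>) (hv (moebius \<gamma> z))) \<le> eps n * norm (hv (moebius \<gamma> z))" for n
    by (rule z[OF eps])
  then obtain \<gamma> where g: "\<And>n. \<gamma> n \<in> Gam" "\<And>n. norm (\<gamma> n) > real n"
    "\<And>n. cmod (wedge (hv \<xi>) (hv (moebius (\<gamma> n) z))) \<le> eps n * norm (hv (moebius (\<gamma> n) z))"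
    by metis
  have g_hv: "cmod (wedge (hv \<xi>) (\<gamma> n *v hv z)) \<le> eps n * norm (\<gamma> n *v hv z)" for n
  proof -
    obtain s where "\<gamma> n *v hv z = s *s hv (moebius (\<gamma> n) z)"
      using moebius_hv[of "\<gamma> n" z] Gam_det[OF g(1)] by (metis zero_neq_one)
    moreover have "norm (s *s hv y) = cmod s * norm (hv y)" for y
      by (simp add: norm_vec_def L2_set_right_distrib norm_mult)
    ultimately show ?thesis
      using mult_left_mono[OF g(3)[of n] norm_ge_zero[of s]] by (simp add: wedge_scale norm_mult mult_ac)
  qed
  obtain E r where E: "norm E = 1" "E \<in> scaled_limits Gam" "strict_mono (r :: nat \<Rightarrow> nat)"
    "(\<lambda>n. (1 / norm (\<gamma> (r n))) *\<^sub>R \<gamma> (r n)) \<longlonglongrightarrow> E"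
    using unbounded_scaled_limit[of \<gamma> Gam] g(1,2) by blast
  have detE: "det E = 0" using det_scaled_limits[OF Gam_det E(2)] by blast
  have eps_r: "(\<lambda>n. eps (r n)) \<longlonglongrightarrow> 0" using LIMSEQ_subseq_LIMSEQ[OF eps_lim E(3)] by (simp add: o_def)
  show thesis
  proof (cases "E *v hv z = 0")
    case False
    have nz: "\<gamma> n \<noteq> 0" for n using g(2)[of n] by auto
    have w0: "wedge (hv \<xi>) (E *v hv z) = 0"
      by (rule wedge_normalized_limit[OF nz E(4) less_imp_le[OF eps] eps_r g_hv])
    have "wedge (hv \<xi>) (E *v x) = 0" for x
    proof -
      obtain s where "E *v hv z = s *s hv \<xi>" using wedge_eq_0_imp[OF w0 hv_nonzero] by blast
      moreover have "wedge (E *v hv z) (E *v x) = 0" using wedge_column[OF detE] .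
      ultimately show ?thesis using False by (auto simp: wedge_scale)
    qed
    moreover have "E \<noteq> 0" using E(1) by auto
    ultimately show thesis using that E(2) by blast
  next
    case True
    \<comment> \<open>Now \<open>adj2 E\<close> is a scaled limit whose image is the line of z. The
      products \<open>\<gamma> n ** adj2 E\<close> are scaled limits with images on the lines of the
      \<gamma>_n z, and by closedness their normalised limit has image \<xi>.\<close>
    define F where "F = adj2 E"
    have F: "F \<in> scaled_limits Gam" unfolding F_def by (rule scaled_limits_adj2[OF Gam_adj2 E(2)])
    have F0: "F \<noteq> 0"
    proof
      assume "F = 0"
      then have "E = 0" by (simp add: F_def mat2_eq_iff)
      then show False using E(1) by simp
    qed
    have Fz: "wedge (hv z) (F *v x) = 0" for x
    proof -
      have "(E *v hv z)$1 = 0" "(E *v hv z)$2 = 0" using True by simp_all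
      then have e: "E$1$1 * hv z$1 + E$1$2 * hv z$2 = 0" "E$2$1 * hv z$1 + E$2$2 * hv z$2 = 0"
        by (simp_all add: mv2_nth)
      have "wedge (hv z) (F *v x) = x$2 * (E$1$1 * hv z$1 + E$1$2 * hv z$2)
          - x$1 * (E$2$1 * hv z$1 + E$2$2 * hv z$2)"
        by (simp add: wedge_def F_def mv2_nth algebra_simps)
      then show ?thesis by (simp add: e)
    qed
    define G where "G n = \<gamma> n ** F" for n
    have Gsl: "G n \<in> scaled_limits Gam" for n
    proof -
      have "\<gamma> n ** F ** mat 1 \<in> scaled_limits ((\<lambda>\<delta>. \<gamma> n ** \<delta> ** mat 1) ` Gam)"
        by (rule scaled_limits_translate[OF F])
      moreover have "(\<lambda>\<delta>. \<gamma> n ** \<delta> ** mat 1) ` Gam \<subseteq> Gam" using g(1) Gam_mult by auto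
      ultimately have "\<gamma> n ** F ** mat 1 \<in> scaled_limits Gam" using scaled_limits_mono by blast
      then show ?thesis by (simp add: G_def)
    qed
    have Gnz: "G n \<noteq> 0" for n
    proof
      assume "G n = 0"
      then have "adj2 (\<gamma> n) ** (\<gamma> n ** F) = 0" by (simp add: G_def mat2_simps)
      then have "F = 0" using adj2_mult(2)[OF Gam_det[OF g(1)]] by (simp add: matrix_mul_assoc)
      then show False using F0 by simp
    qed
    obtain E' r' where E': "norm E' = 1" "strict_mono (r' :: nat \<Rightarrow> nat)"
      "(\<lambda>n. (1 / norm (G (r' n))) *\<^sub>R G (r' n)) \<longlonglongrightarrow> E'"
      using normalized_limit[of G, OF Gnz] by blast
    have "(1 / norm (G (r' n))) *\<^sub>R G (r' n) \<in> scaled_limits Gam" for n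
      by (rule scaled_limits_scale[OF Gsl]) (use Gnz in simp)
    then have "E' \<in> scaled_limits Gam"
      by (intro Lim_in_closed_set[OF closed_scaled_limits always_eventually _ E'(3)]) auto
    moreover have "E' \<noteq> 0" using E'(1) by auto
    moreover have "wedge (hv \<xi>) (E' *v x) = 0" for x
    proof -
      have bound: "cmod (wedge (hv \<xi>) (G n *v x)) \<le> eps n * norm (G n *v x)" for n
      proof -
        obtain s where s: "F *v x = s *s hv z" using wedge_eq_0_imp[OF Fz[of x] hv_nonzero] by blast
        have "G n *v x = s *s (\<gamma> n *v hv z)"
          by (simp add: G_def mv_assoc s vec.scale)
        moreover have "norm (s *s v) = cmod s * norm v" for v :: "complex^2"
          by (simp add: norm_vec_def L2_set_right_distrib norm_mult)
        ultimately show ?thesis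
          using mult_left_mono[OF g_hv[of n] norm_ge_zero[of s]] by (simp add: wedge_scale norm_mult mult_ac)
      qed
      have "(\<lambda>n. eps (r' n)) \<longlonglongrightarrow> 0"
        using LIMSEQ_subseq_LIMSEQ[OF eps_lim E'(2)] by (simp add: o_def)
      then show ?thesis
        by (rule wedge_normalized_limit[OF Gnz E'(3) less_imp_le[OF eps] _ bound])
    qed
    ultimately show thesis using that by blast
  qed
qed

lemma limit_set_eq: "limit_set A = sphere_topology closure_of (\<Union>(circle_points ` fundamental_packing K))"
  using weak by (simp add: weak_apollonian_group_def)

lemma points_in_limit_set: "{None, Some 0, Some 1, Some (- \<omega>)} \<subseteq> limit_set A"
  unfolding limit_set_eq using points_of_fundamental_packing closure_of_subset[of _ sphere_topology]
  by (metis order_trans subset_UNIV topspace_sphere)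

lemma limit_set_upper_half_plane: "limit_set A \<inter> upper_half_plane = {}"
proof -
  have "openin sphere_topology upper_half_plane"
    unfolding sphere_topology_def upper_half_plane_def
    by (simp add: openin_Alexandroff_compactification_image_Some open_halfspace_Im_gt)
  then show ?thesis unfolding limit_set_eq
    using fundamental_packing_upper_half_plane openin_Int_closure_of_eq_empty by (metis Int_commute)
qed

text \<open>Otherwise every k maps a vector v in the image of F into the kernel of E, which is a
  line, so \<open>Gam\<close> fixes the line of v. Then limit directions take at most two values,
  against the three limit points infinity, 0 and 1.\<close>

lemma Gam_irreducible:
  fixes E F :: "complex^2^2"
  assumes E: "E \<in> scaled_limits Gam" "E \<noteq> 0" and F: "F \<noteq> 0"
  obtains k where "k \<in> Gam" "E ** k ** F \<noteq> 0"
proof (rule ccontr)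
  assume no: "\<not> thesis"
  note found = that
  have zero: "E ** k ** F = 0" if "k \<in> Gam" for k using no found[OF that] by blast
  obtain y where y: "F *v y \<noteq> 0" using F matrix_eq[of F 0] by auto
  define v where "v = F *v y"
  have Ek: "E *v (k *v v) = 0" if "k \<in> Gam" for k
  proof -
    have "E *v (k *v v) = (E ** k ** F) *v y" by (simp add: v_def mv_assoc)
    then show ?thesis using zero[OF that] by simp
  qed
  have fixed: "wedge v (k *v v) = 0" if "k \<in> Gam" for k
    using wedge_kernel[OF E(2) _ Ek[OF that]] Ek[OF Gam_one] by simp
  have "\<exists>v w. v \<noteq> 0 \<and> w \<noteq> 0 \<and>
    (\<forall>E\<in>scaled_limits Gam. \<forall>x. wedge v (E *v x) = 0 \<or> wedge w (E *v x) = 0)"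
    by (rule fixed_line_scaled_limits[of Gam v])
      (use Gam_det fixed y Gam_mult Gam_adj2 Gam_finite_bounded in \<open>auto simp: v_def\<close>)
  then obtain a b where ab: "a \<noteq> 0" "b \<noteq> 0"
    "\<And>E x. E \<in> scaled_limits Gam \<Longrightarrow> wedge a (E *v x) = 0 \<or> wedge b (E *v x) = 0" by blast
  have dir: "wedge a (hv \<xi>) = 0 \<or> wedge b (hv \<xi>) = 0" if xi: "\<xi> \<in> limit_set A" for \<xi>
  proof -
    obtain E where E: "E \<in> scaled_limits Gam" "E \<noteq> 0" "\<And>x. wedge (hv \<xi>) (E *v x) = 0"
      using limit_point_direction[OF xi] by metis
    obtain x where x: "E *v x \<noteq> 0" using E(2) matrix_eq[of E 0] by auto
    obtain s where s: "E *v x = s *s hv \<xi>" using wedge_eq_0_imp[OF E(3) hv_nonzero] by blast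
    then have "s \<noteq> 0" using x by auto
    then show ?thesis using ab(3)[OF E(1), of x] by (simp add: s wedge_scale)
  qed
  have same: "\<xi> = \<eta>" if c: "c \<noteq> 0" "wedge c (hv \<xi>) = 0" "wedge c (hv \<eta>) = 0" for c \<xi> \<eta>
  proof -
    obtain s t where st: "hv \<xi> = s *s c" "hv \<eta> = t *s c"
      using wedge_eq_0_imp[OF c(2,1)] wedge_eq_0_imp[OF c(3,1)] by metis
    then have "wedge (hv \<xi>) (hv \<eta>) = 0" by (simp add: wedge_scale)
    then show ?thesis by (rule wedge_hv_inject)
  qed
  have "None \<in> limit_set A" "Some 0 \<in> limit_set A" "Some 1 \<in> limit_set A" using points_in_limit_set by auto
  then show False using dir same[OF ab(1)] same[OF ab(2)]
    by (metis option.distinct(1) option.inject zero_neq_one)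
qed

end

section \<open>Loxodromic elements\<close>

lemma mat_comm: "P ** mat c = mat c ** (P :: complex^2^2)"
  by (simp add: mat2_simps mult.commute)

lemma det_diag_by:
  assumes P: "P ** P = P" "P$1$1 + P$2$2 = 1" "det P = 0" and "\<mu> \<noteq> 0"
  shows "det (diag_by P (mat 1 - P) \<mu>) = 1"
proof -
  have p22: "P$2$2 = 1 - P$1$1" using P(2) by (simp add: algebra_simps)
  have "P$1$2 * P$2$1 = P$1$1 * P$2$2" using P(3) by (simp add: det_2)
  then have p12: "P$1$2 * P$2$1 = P$1$1 * (1 - P$1$1)" by (simp add: p22)
  have "det (diag_by P (mat 1 - P) \<mu>) = \<mu> * inverse \<mu> * (P$1$1 + (1 - P$1$1)) ^ 2
      + (\<mu> - inverse \<mu>) ^ 2 * (P$1$1 * (1 - P$1$1) - P$1$2 * P$2$1)"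
    by (simp add: det_2 diag_by_def matrix_mult_2_nth p22 power2_eq_square algebra_simps)
  then show ?thesis using assms(4) by (simp add: p12)
qed

lemma diag_by_mult:
  assumes P: "P ** P = P"
  shows "diag_by P (mat 1 - P) \<mu> ** diag_by P (mat 1 - P) \<nu> = diag_by P (mat 1 - P) (\<mu> * \<nu>)"
proof -
  have "(P ** P)$i$j = P$i$j" for i j by (simp add: P)
  then have sq: "P$i$1 * P$1$j + P$i$2 * P$2$j = P$i$j" for i j by (simp add: matrix_mult_2_nth)
  have PP: "P ** (mat 1 - P) = 0" "(mat 1 - P) ** P = 0" "(mat 1 - P) ** (mat 1 - P) = mat 1 - P"
    by (simp_all add: mm.diff_left mm.diff_right P)
  have e: "(mat a ** Q) ** (mat b ** R) = mat (a * b) ** (Q ** R)" for a b and Q R :: "complex^2^2"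
    by (simp add: mat2_simps algebra_simps)
  show ?thesis unfolding diag_by_def by (simp add: mm.add_left mm.add_right e PP P)
qed

text \<open>P is the spectral projection onto the eigenline for l; \<open>P ** P = P\<close> is the
  Cayley-Hamilton relation for \<gamma>.\<close>

lemma loxodromic_projection:
  assumes det: "det \<gamma> = 1" and l: "cmod l > 1" "l + inverse l = \<gamma>$1$1 + \<gamma>$2$2"
  defines "P \<equiv> mat (inverse (l - inverse l)) ** (\<gamma> - mat (inverse l))"
  shows "P ** P = P" "P$1$1 + P$2$2 = 1" "det P = 0" "diag_by P (mat 1 - P) l = \<gamma>"
proof -
  have l0: "l \<noteq> 0" using l(1) by auto
  define m where "m = inverse l"
  have lm: "l * m = 1" using l0 by (simp add: m_def)
  have ml: "l - m \<noteq> 0"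
  proof
    assume "l - m = 0"
    then have "l * l = 1" using lm by simp
    then have "cmod l * cmod l = 1" by (metis norm_mult norm_one)
    then show False using l(1) by (metis less_1_mult order_less_irrefl)
  qed
  define k where "k = inverse (l - m)"
  have k: "k * (l - m) = 1" using ml by (simp add: k_def)
  have P: "P = mat k ** (\<gamma> - mat m)" by (simp add: P_def k_def m_def)
  have d: "\<gamma>$2$2 = l + m - \<gamma>$1$1"
    using l(2) unfolding m_def by (metis add_diff_cancel_left')
  have bc: "\<gamma>$1$2 * \<gamma>$2$1 = \<gamma>$1$1 * (l + m - \<gamma>$1$1) - 1" using det by (simp add: det_2 d algebra_simps)
  have bc': "\<gamma>$2$1 * \<gamma>$1$2 = \<gamma>$1$1 * (l + m - \<gamma>$1$1) - 1" using bc by (simp add: mult.commute)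
  have N: "(\<gamma> - mat m) ** (\<gamma> - mat m) = mat (l - m) ** (\<gamma> - mat m)"
  proof -
    have "(\<gamma>$1$1 - m) * (\<gamma>$1$1 - m) + \<gamma>$1$2 * \<gamma>$2$1 = (l - m) * (\<gamma>$1$1 - m)"
      unfolding bc using lm by (simp add: algebra_simps)
    moreover have "\<gamma>$2$1 * \<gamma>$1$2 + (\<gamma>$2$2 - m) * (\<gamma>$2$2 - m) = (l - m) * (\<gamma>$2$2 - m)"
      unfolding bc' d using lm by (simp add: algebra_simps)
    moreover have "(\<gamma>$1$1 - m) * \<gamma>$1$2 + \<gamma>$1$2 * (\<gamma>$2$2 - m) = (l - m) * \<gamma>$1$2"
      "\<gamma>$2$1 * (\<gamma>$1$1 - m) + (\<gamma>$2$2 - m) * \<gamma>$2$1 = (l - m) * \<gamma>$2$1"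
      by (simp_all add: d algebra_simps)
    ultimately show ?thesis by (simp add: mat2_eq_iff matrix_mult_2_nth)
  qed
  have "P ** P = mat k ** (mat k ** ((\<gamma> - mat m) ** (\<gamma> - mat m)))"
    unfolding P by (metis mat_comm matrix_mul_assoc)
  also have "\<dots> = mat (k * (k * (l - m))) ** (\<gamma> - mat m)"
    unfolding N by (simp add: mat2_simps algebra_simps)
  also have "\<dots> = P" by (simp add: P k)
  finally show "P ** P = P" .
  have "P$1$1 + P$2$2 = k * (l - m)" by (simp add: P matrix_mult_2_nth d algebra_simps)
  then show "P$1$1 + P$2$2 = 1" by (simp add: k)
  have "det (\<gamma> - mat m) = 0" using lm by (simp add: det_2 d bc algebra_simps)
  then show "det P = 0" by (simp add: P det_mul)
  have "diag_by P (mat 1 - P) l = mat (l - m) ** P + mat m"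
    by (simp add: diag_by_def m_def[symmetric] mat2_simps algebra_simps)
  also have "\<dots> = mat (k * (l - m)) ** (\<gamma> - mat m) + mat m" by (simp add: P mat2_simps algebra_simps)
  also have "\<dots> = \<gamma>" unfolding k by simp
  finally show "diag_by P (mat 1 - P) l = \<gamma>" .
qed

lemma exists_eigenvalue:
  obtains l :: complex where "l + inverse l = t" "cmod l \<ge> 1"
proof -
  define r where "r = (t + csqrt (t\<^sup>2 - 4)) / 2"
  define s where "s = (t - csqrt (t\<^sup>2 - 4)) / 2"
  have sum: "r + s = t" by (simp add: r_def s_def field_simps)
  have "r * s = (t\<^sup>2 - (csqrt (t\<^sup>2 - 4))\<^sup>2) / 4" by (simp add: r_def s_def power2_eq_square field_simps)
  then have prod: "r * s = 1" by simp
  then have inv: "inverse r = s" "inverse s = r" by (metis inverse_unique mult.commute)+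
  have "cmod r * cmod s = 1" using prod by (metis norm_mult norm_one)
  then have "cmod r \<ge> 1 \<or> cmod s \<ge> 1" by (metis linorder_not_le mult_le_one mult_strict_mono
      norm_ge_zero less_irrefl mult.right_neutral zero_less_one)
  then show thesis using that[of r] that[of s] sum inv by (auto simp: add.commute)
qed

section \<open>The image of A and tangent vectors of its Zariski closure\<close>

context weak_group begin

abbreviation "X \<equiv> rho_image A"
abbreviation "G \<equiv> zariski_closure X"

lemma rho_image_eq:
  "X = {Rm \<gamma> (cnjm \<gamma>) | \<gamma>. \<gamma> \<in> Gam} \<union> {Rm \<gamma> (cnjm \<gamma>) ** Cm | \<gamma>. \<gamma> \<in> SLK \<and> moebius \<gamma> \<circ> conjugation \<in> A}"
proof (rule Set.set_eqI, rule iffI)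
  fix x assume "x \<in> X"
  then obtain f where f: "f \<in> A" "x = map_matrix of_real (rho f)" unfolding rho_image_def by blast
  obtain \<gamma> where g: "\<gamma> \<in> SLK" "f = moebius \<gamma> \<or> f = moebius \<gamma> \<circ> conjugation" using A_cases[OF f(1)] by blast
  from g(2) show "x \<in> {Rm \<gamma> (cnjm \<gamma>) | \<gamma>. \<gamma> \<in> Gam} \<union> {Rm \<gamma> (cnjm \<gamma>) ** Cm | \<gamma>. \<gamma> \<in> SLK \<and> moebius \<gamma> \<circ> conjugation \<in> A}"
  proof
    assume fg: "f = moebius \<gamma>"
    then have "x = Rm \<gamma> (cnjm \<gamma>)" using f(2) rho_eqI SLK_det[OF g(1)] by blast
    moreover have "\<gamma> \<in> Gam" using fg f g by (simp add: Gam_def)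
    ultimately show ?thesis by blast
  next
    assume fg: "f = moebius \<gamma> \<circ> conjugation"
    then have "x = Rm \<gamma> (cnjm \<gamma>) ** Cm" using f(2) rho_eqI SLK_det[OF g(1)] by blast
    then show ?thesis using fg f g by blast
  qed
next
  fix x assume "x \<in> {Rm \<gamma> (cnjm \<gamma>) | \<gamma>. \<gamma> \<in> Gam} \<union> {Rm \<gamma> (cnjm \<gamma>) ** Cm | \<gamma>. \<gamma> \<in> SLK \<and> moebius \<gamma> \<circ> conjugation \<in> A}"
  then obtain \<gamma> where "\<gamma> \<in> SLK" "moebius \<gamma> \<in> A \<and> x = Rm \<gamma> (cnjm \<gamma>) \<or>
      moebius \<gamma> \<circ> conjugation \<in> A \<and> x = Rm \<gamma> (cnjm \<gamma>) ** Cm" unfolding Gam_def by blast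
  then obtain f where "f \<in> A" "map_matrix of_real (rho f) = x" using rho_eqI SLK_det by metis
  then show "x \<in> X" unfolding rho_image_def by blast
qed

lemma X_subset_O_M: "X \<subseteq> O_M"
  unfolding rho_image_eq
  by (auto intro!: O_M_mult Rm_in_O_M Cm_in_O_M simp: Gam_det SLK_det)

lemma Rm_Cm_Rm: "Rm \<alpha> (cnjm \<alpha>) ** Cm ** Rm \<beta> (cnjm \<beta>) = Rm (\<alpha> ** cnjm \<beta>) (cnjm (\<alpha> ** cnjm \<beta>)) ** Cm"
proof -
  have "Rm \<alpha> (cnjm \<alpha>) ** Cm ** Rm \<beta> (cnjm \<beta>) = Rm \<alpha> (cnjm \<alpha>) ** (Cm ** Rm \<beta> (cnjm \<beta>))"
    by (simp only: matrix_mul_assoc)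
  then show ?thesis unfolding Cm_Rm by (simp add: matrix_mul_assoc Rm_mult cnjm_mult)
qed

lemma Rm_cnjm_mult: "Rm \<alpha> (cnjm \<alpha>) ** Rm \<beta> (cnjm \<beta>) = Rm (\<alpha> ** \<beta>) (cnjm (\<alpha> ** \<beta>))"
  by (simp add: Rm_mult cnjm_mult)

abbreviation rhoC :: "(riemann_sphere \<Rightarrow> riemann_sphere) \<Rightarrow> complex^4^4" where
  "rhoC f \<equiv> map_matrix of_real (rho f)"

lemma rhoC_comp:
  assumes "f \<in> A" "g \<in> A" shows "rhoC (f \<circ> g) = rhoC f ** rhoC g"
proof -
  obtain \<alpha> where a: "\<alpha> \<in> SLK" "f = moebius \<alpha> \<or> f = moebius \<alpha> \<circ> conjugation"
    using A_cases[OF assms(1)] by blast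
  obtain \<beta> where b: "\<beta> \<in> SLK" "g = moebius \<beta> \<or> g = moebius \<beta> \<circ> conjugation"
    using A_cases[OF assms(2)] by blast
  have d: "det \<alpha> = 1" "det \<beta> = 1" "det (cnjm \<beta>) = 1" "det (\<alpha> ** \<beta>) = 1" "det (\<alpha> ** cnjm \<beta>) = 1"
    using a b SLK_det by (simp_all add: det_mul)
  have c: "moebius \<alpha> \<circ> conjugation \<circ> moebius \<beta> = moebius (\<alpha> ** cnjm \<beta>) \<circ> conjugation"
    using d by (simp add: comp_assoc conjugation_moebius moebius_mult)
  have c2: "moebius \<alpha> \<circ> conjugation \<circ> (moebius \<beta> \<circ> conjugation) = moebius (\<alpha> ** cnjm \<beta>)"
    unfolding comp_assoc[symmetric] c by (simp add: comp_assoc)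
  have c3: "moebius \<alpha> \<circ> (moebius \<beta> \<circ> conjugation) = moebius (\<alpha> ** \<beta>) \<circ> conjugation"
    using d by (simp add: comp_assoc moebius_mult)
  note R = rho_eqI[OF disjI1[OF conjI[OF refl refl]]] rho_eqI[OF disjI2[OF conjI[OF refl refl]]]
  have CC: "P ** Cm ** Cm = P" for P by (simp add: Cm_Cm flip: matrix_mul_assoc)
  show ?thesis
    using a(2) b(2)
  proof (elim disjE)
    assume *: "f = moebius \<alpha>" "g = moebius \<beta>"
    show ?thesis unfolding * using d by (simp add: R Rm_cnjm_mult flip: moebius_mult)
  next
    assume *: "f = moebius \<alpha>" "g = moebius \<beta> \<circ> conjugation"
    show ?thesis unfolding * c3 R(1)[OF d(1)] R(2)[OF d(2)] R(2)[OF d(4)] matrix_mul_assoc Rm_cnjm_mult ..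
  next
    assume *: "f = moebius \<alpha> \<circ> conjugation" "g = moebius \<beta>"
    show ?thesis unfolding * c R(2)[OF d(1)] R(1)[OF d(2)] R(2)[OF d(5)] Rm_Cm_Rm ..
  next
    assume *: "f = moebius \<alpha> \<circ> conjugation" "g = moebius \<beta> \<circ> conjugation"
    show ?thesis unfolding * c2 R(2)[OF d(1)] R(2)[OF d(2)] R(1)[OF d(5)] matrix_mul_assoc Rm_Cm_Rm CC ..
  qed
qed

lemma X_mult: "x \<in> X \<Longrightarrow> y \<in> X \<Longrightarrow> x ** y \<in> X"
  unfolding rho_image_def using rhoC_comp A_comp by (force simp: image_iff)

lemma rhoC_id: "rhoC id = mat 1"
proof -
  have "cnjm (mat 1) = mat 1" by (simp add: mat2_eq_iff)
  then have "Rm (mat 1) (cnjm (mat 1)) = mat 1" by (simp add: Rm_one)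
  then show ?thesis
    using rho_eqI[of "moebius (mat 1)" "mat 1" "mat 1"] by (simp add: moebius_one)
qed

lemma X_inverse:
  assumes "x \<in> X" obtains y where "y \<in> X" "x ** y = mat 1" "y ** x = mat 1"
proof -
  obtain f where f: "f \<in> A" "x = rhoC f" using assms unfolding rho_image_def by blast
  let ?g = "inv\<^bsub>Moeb\<^esub> f"
  have g: "?g \<in> A" using subgroup.m_inv_closed[OF A_subgroup f(1)] .
  have c: "f \<in> carrier Moeb" "?g \<in> carrier Moeb" using f(1) g subgroup.mem_carrier[OF A_subgroup] by blast+
  have "f \<circ> ?g = id" "?g \<circ> f = id"
    using Moeb.r_inv[OF c(1)] Moeb.l_inv[OF c(1)] c by (simp_all add: Moeb_mult Moeb_one)
  then have "x ** rhoC ?g = mat 1" "rhoC ?g ** x = mat 1"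
    unfolding f(2) using rhoC_comp f(1) g rhoC_id by metis+
  moreover have "rhoC ?g \<in> X" using g unfolding rho_image_def by blast
  ultimately show thesis using that by blast
qed

lemma X_subset_G: "X \<subseteq> G"
  by (rule subset_zariski_closure[OF X_subset_O_M])

lemma G_mult: "x \<in> G \<Longrightarrow> y \<in> G \<Longrightarrow> x ** y \<in> G"
  by (rule zariski_closure_mult[OF X_mult])

text \<open>The points of the closure that come from SL(2, C), kept as 2x2 matrices so that their
  tangent vectors can be described by fixed points on the sphere.\<close>

definition H :: "(complex^2^2) set" where "H = {\<gamma>. det \<gamma> = 1 \<and> Rm \<gamma> (cnjm \<gamma>) \<in> G}"

lemma Gam_subset_H: "Gam \<subseteq> H"
  using X_subset_G Gam_det unfolding H_def rho_image_eq by blast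

lemma H_mult: "\<alpha> \<in> H \<Longrightarrow> \<beta> \<in> H \<Longrightarrow> \<alpha> ** \<beta> \<in> H"
  using G_mult by (simp add: H_def det_mul flip: Rm_cnjm_mult)

lemma H_one: "mat 1 \<in> H"
  using Gam_one Gam_subset_H by blast

text \<open>The conditions are polynomial in the entries of \<gamma> and their conjugates, hence
  continuous.\<close>

lemma closed_H: "closed H"
  unfolding closed_sequential_limits
proof (intro allI impI, elim conjE)
  fix f l assume f: "\<forall>n. f n \<in> H" and l: "f \<longlonglongrightarrow> l"
  have "(\<lambda>n. det (f n)) \<longlonglongrightarrow> det l"
    unfolding det_2 by (intro tendsto_intros tendsto_matrix_nth l)
  moreover have "(\<lambda>n. det (f n)) = (\<lambda>n. 1)" using f by (auto simp: H_def)
  ultimately have det: "det l = 1" using LIMSEQ_unique tendsto_const by metis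
  have R: "(\<lambda>n. Rm (f n) (cnjm (f n))) \<longlonglongrightarrow> Rm l (cnjm l)"
  proof (rule vec_tendstoI, rule vec_tendstoI)
    fix i j :: 4
    show "(\<lambda>n. Rm (f n) (cnjm (f n)) $ i $ j) \<longlonglongrightarrow> Rm l (cnjm l) $ i $ j"
      unfolding Rm_nth using exhaust_4[of i]
      by (elim disjE; simp add: unherm_def matrix_mult_2_nth transpose_def;
          auto intro!: tendsto_intros tendsto_matrix_nth l)
  qed
  have "p (Rm l (cnjm l)) = 0" if p: "matrix_polynomial p" "\<forall>x\<in>X. p x = 0" for p
  proof -
    have "(\<lambda>n. p (Rm (f n) (cnjm (f n)))) \<longlonglongrightarrow> p (Rm l (cnjm l))"
      by (rule continuous_on_tendsto_compose[OF continuous_on_matrix_polynomial[OF p(1)] R]) auto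
    moreover have "(\<lambda>n. p (Rm (f n) (cnjm (f n)))) = (\<lambda>n. 0)"
      using f p by (auto simp: H_def zariski_closure_def)
    ultimately show ?thesis using LIMSEQ_unique tendsto_const by metis
  qed
  then show "l \<in> H" using det Rm_in_O_M[of l "cnjm l"] by (simp add: H_def zariski_closure_def)
qed

lemma subspace_tangent_H: "subspace (tangent_space H)"
  by (rule subspace_tangent_space[OF H_one H_mult])

lemma closed_tangent_H: "closed (tangent_space H)"
  by (rule closed_subspace[OF subspace_tangent_H])

text \<open>The boosts along the axis of \<gamma> lie in \<open>H\<close>, and their velocity at 1
  has eigenvalues 1 and -1 on the eigenlines of \<gamma>.\<close>

lemma loxodromic_tangent:
  assumes g: "\<gamma> \<in> Gam" and l: "cmod l > 1" "l + inverse l = \<gamma>$1$1 + \<gamma>$2$2"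
  defines "P \<equiv> mat (inverse (l - inverse l)) ** (\<gamma> - mat (inverse l))"
  shows "P - (mat 1 - P) \<in> tangent_space H"
proof -
  note P = loxodromic_projection[OF Gam_det[OF g] l, folded P_def]
  let ?B = "diag_by P (mat 1 - P)"
  have l0: "l \<noteq> 0" using l(1) by auto
  have pow: "?B (l ^ n) \<in> Gam" for n
  proof (induction n)
    case 0
    have "?B 1 = mat 1" by (simp add: diag_by_def)
    then show ?case using Gam_one by simp
  next
    case (Suc n)
    then show ?case using Gam_mult[OF g] by (simp add: P(4) flip: diag_by_mult[OF P(1)])
  qed
  have B: "?B (of_real s) \<in> H" if s: "s > 0" for s
  proof -
    have det: "det (?B (of_real s)) = 1" using det_diag_by[OF P(1-3)] s by simp
    have "Rm (?B (l ^ n)) (cnjm (?B (l ^ n))) \<in> G" for n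
      using pow[of n] Gam_subset_H by (auto simp: H_def)
    then have "Rm (?B (of_real s)) (cnjm (?B (of_real s))) \<in> G"
      by (intro zariski_closure_diag_by[OF l(1) s]) (use det Rm_in_O_M in auto)
    then show ?thesis using det by (simp add: H_def)
  qed
  show ?thesis
  \<comment> \<open>The error is t^2/(1 + t) times \<open>mat 1 - P\<close>, and 1/(1 + t) is at
    most 2 for |t| < 1/2.\<close>
  proof (rule tangent_spaceI[where g = "\<lambda>t. ?B (of_real (1 + t))" and C = "2 * norm (mat 1 - P)" and d = "1/2"])
    show "?B (of_real (1 + t)) \<in> H" if "\<bar>t\<bar> < 1 / 2" for t using B[of "1 + t"] that by linarith
    show "norm (?B (of_real (1 + t)) - (mat 1 + t *\<^sub>R (P - (mat 1 - P)))) \<le> 2 * norm (mat 1 - P) * t\<^sup>2"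
      if t: "\<bar>t\<bar> < 1 / 2" for t :: real
    proof -
      have mr: "mat (of_real r) ** Q = r *\<^sub>R Q" for r and Q :: "complex^2^2"
        by (simp add: mat2_simps) (simp add: scaleR_conv_of_real)
      have B: "?B (of_real (1 + t)) = (1 + t) *\<^sub>R P + inverse (1 + t) *\<^sub>R (mat 1 - P)"
        unfolding diag_by_def mr of_real_inverse[symmetric] ..
      have "?B (of_real (1 + t)) - (mat 1 + t *\<^sub>R (P - (mat 1 - P)))
          = (inverse (1 + t) - 1 + t) *\<^sub>R (mat 1 - P)"
        unfolding B by (simp add: algebra_simps)
      also have "inverse (1 + t) - 1 + t = t\<^sup>2 * inverse (1 + t)"
        using t by (simp add: field_simps power2_eq_square)
      finally have "norm (?B (of_real (1 + t)) - (mat 1 + t *\<^sub>R (P - (mat 1 - P))))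
          = t\<^sup>2 * (\<bar>inverse (1 + t)\<bar> * norm (mat 1 - P))" by (simp add: abs_mult)
      also have "\<dots> \<le> t\<^sup>2 * (2 * norm (mat 1 - P))"
      proof (intro mult_left_mono mult_right_mono)
        have "1 + t \<ge> 1 / 2" using t by linarith
        then have "inverse (1 + t) \<le> inverse (1 / 2)" by (intro le_imp_inverse_le) auto
        then show "\<bar>inverse (1 + t)\<bar> \<le> 2" using \<open>1 + t \<ge> 1 / 2\<close> by simp
      qed auto
      finally show ?thesis by (simp add: mult_ac)
    qed
  qed auto
qed

text \<open>A nonzero trace of E makes the traces of the approximating \<gamma>_n grow, so these are
  eventually loxodromic; their projections converge to E divided by its trace, and the tangent space
  is closed.\<close>

lemma scaled_limit_tangent:
  assumes E: "E \<in> scaled_limits Gam" and tr: "E$1$1 + E$2$2 \<noteq> 0"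
  shows "mat (2 / (E$1$1 + E$2$2)) ** E - mat 1 \<in> tangent_space H"
proof -
  let ?\<tau> = "E$1$1 + E$2$2"
  obtain \<gamma> c where g: "\<And>n::nat. \<gamma> n \<in> Gam" "\<And>n. c n > 0" "c \<longlonglongrightarrow> 0" "(\<lambda>n. c n *\<^sub>R \<gamma> n) \<longlonglongrightarrow> E"
    using E by (rule scaled_limits_seq) blast
  define t where "t n = \<gamma> n $ 1 $ 1 + \<gamma> n $ 2 $ 2" for n
  have "\<exists>l. l + inverse l = t n \<and> cmod l \<ge> 1" for n using exists_eigenvalue[of "t n"] by metis
  then obtain l where l: "\<And>n. l n + inverse (l n) = t n" "\<And>n. cmod (l n) \<ge> 1" by metis
  have l0: "l n \<noteq> 0" for n using l(2)[of n] by auto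
  have inv_l: "cmod (inverse (l n)) \<le> 1" for n using l(2)[of n] by (simp add: norm_inverse inverse_le_1_iff)
  have "(\<lambda>n. (c n *\<^sub>R \<gamma> n) $ 1 $ 1 + (c n *\<^sub>R \<gamma> n) $ 2 $ 2) \<longlonglongrightarrow> ?\<tau>"
    by (intro tendsto_intros tendsto_matrix_nth g(4))
  moreover have "(c n *\<^sub>R \<gamma> n) $ 1 $ 1 + (c n *\<^sub>R \<gamma> n) $ 2 $ 2 = of_real (c n) * t n" for n
    by (simp add: t_def) (simp add: scaleR_conv_of_real algebra_simps)
  ultimately have ct: "(\<lambda>n. of_real (c n) * t n) \<longlonglongrightarrow> ?\<tau>" by simp
  have "cmod (of_real (c n) * inverse (l n)) \<le> c n" for n
    using g(2)[of n] mult_left_mono[OF inv_l[of n], of "c n"] by (simp add: norm_mult)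
  then have cl: "(\<lambda>n. of_real (c n) * inverse (l n)) \<longlonglongrightarrow> 0"
    by (intro Lim_null_comparison[OF always_eventually g(3)]) auto
  \<comment> \<open>l - 1/l is t - 2/l, and the scaled second term tends to 0 because |1/l| <=
    1.\<close>
  have "(\<lambda>n. of_real (c n) * t n - 2 * (of_real (c n) * inverse (l n))) \<longlonglongrightarrow> ?\<tau> - 2 * 0"
    by (intro tendsto_intros ct cl)
  moreover have "of_real (c n) * t n - 2 * (of_real (c n) * inverse (l n)) = of_real (c n) * (l n - inverse (l n))" for n
    by (simp add: algebra_simps flip: l(1))
  ultimately have cd: "(\<lambda>n. of_real (c n) * (l n - inverse (l n))) \<longlonglongrightarrow> ?\<tau>" by simp
  define P where "P n = mat (inverse (l n - inverse (l n))) ** (\<gamma> n - mat (inverse (l n)))" for n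
  have "(\<lambda>n. P n $ i $ j) \<longlonglongrightarrow> inverse ?\<tau> * E $ i $ j" for i j
  proof -
    have "(\<lambda>n. inverse (of_real (c n) * (l n - inverse (l n))) *
        ((c n *\<^sub>R \<gamma> n) $ i $ j - of_real (c n) * inverse (l n) * (mat 1 :: complex^2^2) $ i $ j))
        \<longlonglongrightarrow> inverse ?\<tau> * (E $ i $ j - 0 * (mat 1 :: complex^2^2) $ i $ j)"
      by (intro tendsto_intros cd cl tr tendsto_matrix_nth g(4))
    moreover have "inverse (of_real (c n) * (l n - inverse (l n))) *
        ((c n *\<^sub>R \<gamma> n) $ i $ j - of_real (c n) * inverse (l n) * (mat 1 :: complex^2^2) $ i $ j) = P n $ i $ j" for n
    proof -
      have "(c n *\<^sub>R \<gamma> n) $ i $ j - of_real (c n) * inverse (l n) * (mat 1 :: complex^2^2) $ i $ j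
          = of_real (c n) * (\<gamma> n - mat (inverse (l n))) $ i $ j"
        by (simp add: mat_def) (simp add: scaleR_conv_of_real algebra_simps)
      moreover have "P n $ i $ j = inverse (l n - inverse (l n)) * (\<gamma> n - mat (inverse (l n))) $ i $ j"
        unfolding P_def by (rule mat_mult_nth)
      ultimately show ?thesis using g(2)[of n] by (simp add: inverse_mult_distrib)
    qed
    ultimately show ?thesis by simp
  qed
  then have "(\<lambda>n. P n) \<longlonglongrightarrow> mat (inverse ?\<tau>) ** E"
    by (intro tendsto_matrixI) (simp add: mat_mult_nth)
  then have "(\<lambda>n. P n - (mat 1 - P n)) \<longlonglongrightarrow> mat (inverse ?\<tau>) ** E - (mat 1 - mat (inverse ?\<tau>) ** E)"
    by (intro tendsto_intros)
  moreover have "mat (inverse ?\<tau>) ** E - (mat 1 - mat (inverse ?\<tau>) ** E) = mat (2 / ?\<tau>) ** E - mat 1"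
    by (simp add: vec_eq_iff mat_mult_nth) (simp add: divide_inverse)
  ultimately have lim: "(\<lambda>n. P n - (mat 1 - P n)) \<longlonglongrightarrow> mat (2 / ?\<tau>) ** E - mat 1" by simp
  have "\<forall>\<^sub>F n in sequentially. P n - (mat 1 - P n) \<in> tangent_space H"
  proof -
    \<comment> \<open>Eventually |t_n| > 2, which together with |t_n| <= |l_n| + 1 forces |l_n| >
      1.\<close>
    have "(\<lambda>n. 2 * c n - cmod (of_real (c n) * t n)) \<longlonglongrightarrow> 2 * 0 - cmod ?\<tau>"
      by (intro tendsto_intros g(3) ct)
    then have "\<forall>\<^sub>F n in sequentially. 2 * c n - cmod (of_real (c n) * t n) < 0"
      using tr by (intro order_tendstoD(2)) auto
    then show ?thesis
    proof eventually_elim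
      case (elim n)
      then have "c n * 2 < c n * cmod (t n)" using g(2)[of n] by (simp add: norm_mult)
      then have "2 < cmod (t n)" using g(2)[of n] by simp
      also have "cmod (t n) \<le> cmod (l n) + cmod (inverse (l n))" unfolding l(1)[symmetric] by (rule norm_triangle_ineq)
      also have "\<dots> \<le> cmod (l n) + 1" using inv_l[of n] by simp
      finally have "cmod (l n) > 1" by simp
      then show ?case unfolding P_def using g(1)[of n] l(1)[of n] by (intro loxodromic_tangent) (auto simp: t_def)
    qed
  qed
  then show ?thesis using Lim_in_closed_set[OF closed_tangent_H _ sequentially_bot lim] by blast
qed

text \<open>\<open>E1 ** k ** adj2 E2\<close> has its image on the line of p and kills q, since
  \<open>adj2 E2\<close> kills the image of E2. Being nonzero it has a nonzero eigenvalue at p,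
  which is its trace, and twice the normalised matrix minus 1 is the required velocity.\<close>

lemma tangent_fixing:
  assumes p: "p \<in> limit_set A" and q: "q \<in> limit_set A" and "p \<noteq> q"
  obtains Y where "Y \<in> tangent_space H" "Y *v hv p = hv p" "Y *v hv q = - hv q"
proof -
  obtain E1 where E1: "E1 \<in> scaled_limits Gam" "E1 \<noteq> 0" "\<And>x. wedge (hv p) (E1 *v x) = 0"
    using limit_point_direction[OF p] by metis
  obtain E2 where E2: "E2 \<in> scaled_limits Gam" "E2 \<noteq> 0" "\<And>x. wedge (hv q) (E2 *v x) = 0"
    using limit_point_direction[OF q] by metis
  have a0: "adj2 E2 \<noteq> 0" using E2(2) by (auto simp: mat2_eq_iff)
  obtain k where k: "k \<in> Gam" "E1 ** k ** adj2 E2 \<noteq> 0" using Gam_irreducible[OF E1(1,2) a0] by blast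
  define E where "E = E1 ** k ** adj2 E2"
  have E: "E \<in> scaled_limits Gam"
  proof -
    have "(\<lambda>\<gamma>. mat 1 ** \<gamma> ** k) ` Gam \<subseteq> Gam" using k(1) Gam_mult by auto
    from subsetD[OF scaled_limits_mono[OF this] scaled_limits_translate[OF E1(1), of "mat 1" k]]
    have E1k: "E1 ** k \<in> scaled_limits Gam" by simp
    have "adj2 E2 \<in> scaled_limits Gam" by (rule scaled_limits_adj2[OF Gam_adj2 E2(1)])
    with E1k show ?thesis unfolding E_def using scaled_limits_mult[of Gam, OF Gam_mult] by blast
  qed
  have pq: "wedge (hv p) (hv q) \<noteq> 0" using wedge_hv_inject assms(3) by blast
  obtain y where y: "E2 *v y \<noteq> 0" using E2(2) matrix_eq[of E2 0] by auto
  obtain s where s: "E2 *v y = s *s hv q" using wedge_eq_0_imp[OF E2(3)[of y] hv_nonzero] by blast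
  have s0: "s \<noteq> 0" using s y by auto
  have "adj2 E2 ** E2 = 0"
  proof -
    have "det E2 = 0" using det_scaled_limits[OF Gam_det E2(1)] by blast
    then show ?thesis by (simp add: mat2_simps det_2 algebra_simps)
  qed
  then have "adj2 E2 *v (s *s hv q) = 0" by (simp add: s[symmetric] flip: mv_assoc)
  then have "s *s (adj2 E2 *v hv q) = 0" by (simp add: vec.scale)
  then have "adj2 E2 *v hv q = 0" using s0 by (auto simp: vec2_eq_iff)
  then have Eq: "E *v hv q = 0" by (simp add: E_def mv_assoc)
  have "wedge (hv p) (E *v hv p) = 0" using E1(3) by (simp add: E_def mv_assoc)
  then obtain \<tau> where tau: "E *v hv p = \<tau> *s hv p" using wedge_eq_0_imp hv_nonzero by metis
  have "\<tau> \<noteq> 0"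
  proof
    assume "\<tau> = 0"
    then have "E *v hv p = 0" using tau by simp
    then show False using wedge_kernel[of E "hv p" "hv q"] Eq k(2) pq unfolding E_def by blast
  qed
  \<comment> \<open>The trace acts on \<open>wedge\<close> as a derivation; as E kills q, only the
    eigenvalue at p remains.\<close>
  have "(E$1$1 + E$2$2) * wedge (hv p) (hv q) = wedge (E *v hv p) (hv q) + wedge (hv p) (E *v hv q)"
    by (simp add: wedge_def mv2_nth algebra_simps)
  then have tr: "E$1$1 + E$2$2 = \<tau>" using pq by (simp add: tau Eq wedge_scale)
  let ?Y = "mat (2 / \<tau>) ** E - mat 1"
  have Yx: "?Y *v x = (2 / \<tau>) *s (E *v x) - x" for x
    by (simp add: vec2_eq_iff mv2_nth matrix_mult_2_nth algebra_simps)
  show thesis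
  proof (rule that)
    show "?Y \<in> tangent_space H" using scaled_limit_tangent[OF E] \<open>\<tau> \<noteq> 0\<close> by (simp add: tr)
    show "?Y *v hv p = hv p" unfolding Yx tau using \<open>\<tau> \<noteq> 0\<close> by (simp add: vec2_eq_iff)
    show "?Y *v hv q = - hv q" unfolding Yx Eq by simp
  qed
qed

lemma real_combination:
  assumes "Im v \<noteq> 0" obtains a b :: real where "c = of_real a + of_real b * v"
  using assms that[of "Re c - Im c / Im v * Re v" "Im c / Im v"] by (simp add: complex_eq_iff)

text \<open>Velocities that share the repelling point infinity differ by nilpotent upper triangular
  matrices, those that share 0 by lower triangular ones. The points 1 and -\<omega>, and likewise
  their inverses, form a real basis of the complex numbers, so all nilpotents of both kinds are
  obtained.\<close>

lemma unipotents_in_H: "mat2 1 c 0 1 \<in> H" "mat2 1 0 c 1 \<in> H"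
proof -
  have L: "None \<in> limit_set A" "Some 0 \<in> limit_set A" "Some 1 \<in> limit_set A" "Some (- \<omega>) \<in> limit_set A"
    using points_in_limit_set by auto
  have w0: "\<omega> \<noteq> 0" "Im \<omega> \<noteq> 0" using h \<omega> by auto
  let ?T = "tangent_space H"
  have up: "mat2 (-1) (2 * z) 0 1 \<in> ?T" if z: "Some z \<in> limit_set A" for z
  proof -
    obtain Y where Y: "Y \<in> ?T" "Y *v hv (Some z) = hv (Some z)" "Y *v hv None = - hv None"
      using tangent_fixing[OF z L(1)] by blast
    then have "Y = mat2 (-1) (2 * z) 0 1" by (auto simp: vec2_eq_iff mv2_nth mat2_eq_iff algebra_simps)
    then show ?thesis using Y(1) by simp
  qed
  have lo: "mat2 1 0 (2 / z) (-1) \<in> ?T" if z: "Some z \<in> limit_set A" "z \<noteq> 0" for z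
  proof -
    obtain Y where Y: "Y \<in> ?T" "Y *v hv (Some z) = hv (Some z)" "Y *v hv (Some 0) = - hv (Some 0)"
      using tangent_fixing[OF z(1) L(2)] z(2) by blast
    then have "Y = mat2 1 0 (2 / z) (-1)" using z(2)
      by (auto simp: vec2_eq_iff mv2_nth mat2_eq_iff field_simps)
    then show ?thesis using Y(1) by simp
  qed
  have lo0: "mat2 1 0 0 (-1) \<in> ?T"
  proof -
    obtain Y where Y: "Y \<in> ?T" "Y *v hv None = hv None" "Y *v hv (Some 0) = - hv (Some 0)"
      using tangent_fixing[OF L(1,2)] by blast
    then have "Y = mat2 1 0 0 (-1)" by (auto simp: vec2_eq_iff mv2_nth mat2_eq_iff)
    then show ?thesis using Y(1) by simp
  qed
  note sub = subspace_diff[OF subspace_tangent_H] subspace_add[OF subspace_tangent_H]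
    subspace_scale[OF subspace_tangent_H]
  have u: "mat2 0 (2 * z) 0 0 \<in> ?T" if "Some z \<in> limit_set A" for z
  proof -
    have "mat2 0 (2 * z) 0 0 = mat2 (-1) (2 * z) 0 1 - mat2 (-1) (2 * 0) 0 1" by (simp add: mat2_eq_iff)
    then show ?thesis using sub(1)[OF up[OF that] up[OF L(2)]] by simp
  qed
  have v: "mat2 0 0 (2 / z) 0 \<in> ?T" if "Some z \<in> limit_set A" "z \<noteq> 0" for z
  proof -
    have "mat2 0 0 (2 / z) 0 = mat2 1 0 (2 / z) (-1) - mat2 1 0 0 (-1)" by (simp add: mat2_eq_iff)
    then show ?thesis using sub(1)[OF lo[OF that] lo0] by simp
  qed
  obtain a b where ab: "c = of_real a + of_real b * (- \<omega>)" using real_combination[of "- \<omega>" c] w0 by auto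
  have "mat2 0 c 0 0 = (a / 2) *\<^sub>R mat2 0 (2 * 1) 0 0 + (b / 2) *\<^sub>R mat2 0 (2 * - \<omega>) 0 0"
    by (simp add: mat2_eq_iff ab) (simp add: scaleR_conv_of_real)
  then have T1: "mat2 0 c 0 0 \<in> ?T" using sub(2)[OF sub(3)[OF u[OF L(3)]] sub(3)[OF u[OF L(4)]]] by metis
  have "Im (1 / (- \<omega>)) \<noteq> 0" using w0 by (auto simp: Im_divide)
  then obtain a b where ab: "c = of_real a + of_real b * (1 / (- \<omega>))" using real_combination[of "1 / (- \<omega>)" c] by auto
  have "mat2 0 0 c 0 = (a / 2) *\<^sub>R mat2 0 0 (2 / 1) 0 + (b / 2) *\<^sub>R mat2 0 0 (2 / (- \<omega>)) 0"
    by (simp add: mat2_eq_iff ab) (simp add: scaleR_conv_of_real)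
  then have T2: "mat2 0 0 c 0 \<in> ?T"
    using sub(2)[OF sub(3)[OF v[OF L(3)]] sub(3)[OF v[OF L(4)]]] w0 by (metis neg_equal_0_iff_equal zero_neq_one)
  have "mat 1 + mat2 0 c 0 0 \<in> H" "mat 1 + mat2 0 0 c 0 \<in> H"
    by (rule exp_nilpotent_tangent[OF H_one H_mult closed_H T1]; simp add: mat2_simps)
      (rule exp_nilpotent_tangent[OF H_one H_mult closed_H T2]; simp add: mat2_simps)
  moreover have "mat 1 + mat2 0 c 0 0 = mat2 1 c 0 1" "mat 1 + mat2 0 0 c 0 = mat2 1 0 c 1"
    by (simp_all add: mat2_eq_iff)
  ultimately show "mat2 1 c 0 1 \<in> H" "mat2 1 0 c 1 \<in> H" by simp_all
qed

end

section \<open>The group \<open>SO_M\<close>\<close>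

text \<open>If the lower left entry is nonzero, the matrix is a product of an upper, a lower and an
  upper unipotent; otherwise one lower unipotent factor makes it nonzero.\<close>

lemma SL2_induct:
  assumes mult: "\<And>\<alpha> \<beta>. P \<alpha> \<Longrightarrow> P \<beta> \<Longrightarrow> P (\<alpha> ** \<beta>)"
    and u: "\<And>c. P (mat2 1 c 0 1)" and l: "\<And>c. P (mat2 1 0 c 1)"
    and det: "det (\<gamma> :: complex^2^2) = 1"
  shows "P \<gamma>"
proof -
  have nz: "P \<delta>" if d: "det \<delta> = 1" "\<delta>$2$1 \<noteq> 0" for \<delta> :: "complex^2^2"
  proof -
    have e: "\<delta>$1$1 * \<delta>$2$2 = 1 + \<delta>$1$2 * \<delta>$2$1" using d(1) by (simp add: det_2 algebra_simps)
    have "\<delta> = mat2 1 ((\<delta>$1$1 - 1) / \<delta>$2$1) 0 1 ** mat2 1 0 (\<delta>$2$1) 1 ** mat2 1 ((\<delta>$2$2 - 1) / \<delta>$2$1) 0 1"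
      using d(2) e by (simp add: mat2_simps field_simps)
    then show ?thesis using mult u l by metis
  qed
  show ?thesis
  proof (cases "\<gamma>$2$1 = 0")
    case False
    then show ?thesis using nz det by blast
  next
    case True
    then have "\<gamma>$1$1 \<noteq> 0" using det by (auto simp: det_2)
    moreover have "(mat2 1 0 1 1 ** \<gamma>)$2$1 = \<gamma>$1$1" using True by (simp add: matrix_mult_2_nth)
    moreover have "det (mat2 1 0 1 1 ** \<gamma>) = 1" using det by (simp add: det_mul det_2[of "mat2 _ _ _ _"])
    ultimately have "P (mat2 1 0 1 1 ** \<gamma>)" using nz by simp
    then have "P (mat2 1 0 (-1) 1 ** (mat2 1 0 1 1 ** \<gamma>))" using mult l by blast
    moreover have "mat2 1 0 (-1) 1 ** (mat2 1 0 1 1 ** \<gamma>) = \<gamma>" by (simp add: mat2_simps)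
    ultimately show ?thesis by simp
  qed
qed

lemma SL2_pair_induct:
  assumes mult: "\<And>\<alpha> \<beta> \<alpha>' \<beta>'. P \<alpha> \<beta> \<Longrightarrow> P \<alpha>' \<beta>' \<Longrightarrow> P (\<alpha> ** \<alpha>') (\<beta> ** \<beta>')"
    and u: "\<And>c d. P (mat2 1 c 0 1) (mat2 1 d 0 1)" and l: "\<And>c d. P (mat2 1 0 c 1) (mat2 1 0 d 1)"
    and det: "det (\<alpha> :: complex^2^2) = 1" "det (\<beta> :: complex^2^2) = 1"
  shows "P \<alpha> \<beta>"
proof -
  have one: "mat2 1 0 0 1 = (mat 1 :: complex^2^2)" by (simp add: mat2_eq_iff)
  have "P \<alpha> (mat 1)"
  proof (rule SL2_induct[OF _ _ _ det(1), of "\<lambda>\<alpha>. P \<alpha> (mat 1)"])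
    show "P (\<alpha> ** \<beta>) (mat 1)" if "P \<alpha> (mat 1)" "P \<beta> (mat 1)" for \<alpha> \<beta> using mult[OF that] by simp
    show "P (mat2 1 c 0 1) (mat 1)" "P (mat2 1 0 c 1) (mat 1)" for c using u[of c 0] l[of c 0] by (simp_all add: one)
  qed
  moreover have "P (mat 1) \<beta>"
  proof (rule SL2_induct[OF _ _ _ det(2), of "\<lambda>\<beta>. P (mat 1) \<beta>"])
    show "P (mat 1) (\<alpha> ** \<beta>)" if "P (mat 1) \<alpha>" "P (mat 1) \<beta>" for \<alpha> \<beta> using mult[OF that] by simp
    show "P (mat 1) (mat2 1 c 0 1)" "P (mat 1) (mat2 1 0 c 1)" for c using u[of 0 c] l[of 0 c] by (simp_all add: one)
  qed
  ultimately show ?thesis using mult by fastforce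
qed

definition polar :: "complex^4 \<Rightarrow> complex^4 \<Rightarrow> complex" where
  "polar v w = M_form (v + w) - M_form v - M_form w"

lemma polar_eq: "polar v w = 2 * (v$3 * w$3) + 2 * (v$4 * w$4) - v$1 * w$2 - v$2 * w$1"
  by (simp add: polar_def M_form_def power2_eq_square algebra_simps)

lemma polar_O_M: "g \<in> O_M \<Longrightarrow> polar (g *v v) (g *v w) = polar v w"
  by (simp add: polar_def O_M_def flip: matrix_vector_right_distrib)

text \<open>\<open>Jm (-1) 2\<close> is the Gram matrix of \<open>polar\<close>, and
  \<open>Jm (-1) (1/2)\<close> is its inverse.\<close>

definition Jm :: "complex \<Rightarrow> complex \<Rightarrow> complex^4^4" where
  "Jm a b = vector [vector [0, a, 0, 0], vector [a, 0, 0, 0], vector [0, 0, b, 0], vector [0, 0, 0, b]]"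

lemma mv_axis_nth: "((M :: 'a::semiring_1^'n^'m) *v axis j 1) $ i = M $ i $ j"
  by (simp add: matrix_vector_mult_def axis_def if_distrib cong: if_cong)

lemma det_O_M:
  assumes "g \<in> O_M" shows "det g = 1 \<or> det g = -1"
proof -
  have "(transpose g ** (Jm (-1) 2 ** g)) $ i $ j = polar (g *v axis i 1) (g *v axis j 1)" for i j
    unfolding polar_eq mv_axis_nth
    by (simp add: matrix_matrix_mult_def transpose_def sum_4 Jm_def algebra_simps)
  moreover have "polar (axis i 1) (axis j 1) = Jm (-1) 2 $ i $ j" for i j
    using exhaust_4[of i] exhaust_4[of j] by (elim disjE; simp add: polar_eq axis_def Jm_def)
  ultimately have "(transpose g ** (Jm (-1) 2 ** g)) $ i $ j = Jm (-1) 2 $ i $ j" for i j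
    by (simp only: polar_O_M[OF assms])
  then have "transpose g ** (Jm (-1) 2 ** g) = Jm (-1) 2" by (simp add: vec_eq_iff)
  then have "det g * (det (Jm (-1) 2) * det g) = det (Jm (-1) 2)"
    by (metis det_mul det_transpose)
  moreover have "det (Jm (-1) 2) \<noteq> 0"
  proof -
    have "Jm (-1) 2 ** Jm (-1) (1/2) = mat 1"
      by (simp add: vec_eq_iff forall_4 matrix_matrix_mult_def sum_4 Jm_def mat_def)
    then have "det (Jm (-1) 2) * det (Jm (-1) (1/2)) = 1" by (metis det_I det_mul)
    then show ?thesis by auto
  qed
  ultimately have "det g * det g = 1" by (simp add: mult_ac)
  then show ?thesis by (metis square_eq_1_iff)
qed

text \<open>Unipotents are squares of unipotents, and squares in O_M have determinant 1; this spares
  the explicit expansion of a 4x4 determinant.\<close>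

lemma det_Rm:
  assumes "det \<alpha> = 1" "det \<beta> = 1" shows "det (Rm \<alpha> \<beta>) = 1"
proof (rule SL2_pair_induct[where P = "\<lambda>\<alpha> \<beta>. det (Rm \<alpha> \<beta>) = 1", OF _ _ _ assms])
  show "det (Rm (\<alpha> ** \<alpha>') (\<beta> ** \<beta>')) = 1" if "det (Rm \<alpha> \<beta>) = 1" "det (Rm \<alpha>' \<beta>') = 1" for \<alpha> \<beta> \<alpha>' \<beta>'
    using that by (simp add: det_mul flip: Rm_mult)
  have sq: "det (Rm (\<alpha> ** \<alpha>) (\<beta> ** \<beta>)) = 1" if "det \<alpha> = 1" "det \<beta> = 1" for \<alpha> \<beta>
    using det_O_M[OF Rm_in_O_M[OF that]] by (auto simp: det_mul simp flip: Rm_mult)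
  show "det (Rm (mat2 1 c 0 1) (mat2 1 d 0 1)) = 1" for c d
  proof -
    have "mat2 1 (x/2) 0 1 ** mat2 1 (x/2) 0 1 = mat2 1 x 0 1" for x :: complex by (simp add: mat2_simps)
    then show ?thesis using sq[of "mat2 1 (c/2) 0 1" "mat2 1 (d/2) 0 1"] by (simp add: det_2)
  qed
  show "det (Rm (mat2 1 0 c 1) (mat2 1 0 d 1)) = 1" for c d
  proof -
    have "mat2 1 0 (x/2) 1 ** mat2 1 0 (x/2) 1 = mat2 1 0 x 1" for x :: complex by (simp add: mat2_simps)
    then show ?thesis using sq[of "mat2 1 0 (c/2) 1" "mat2 1 0 (d/2) 1"] by (simp add: det_2)
  qed
qed

lemma rank_one_2:
  fixes W :: "complex^2^2"
  assumes "det W = 0" "W \<noteq> 0"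
  obtains x :: "complex^2" and y :: "complex^2" where "x \<noteq> 0" "y \<noteq> 0" "\<And>i j. W$i$j = x$i * y$j"
proof -
  have d: "W$1$1 * W$2$2 = W$1$2 * W$2$1" using assms(1) by (simp add: det_2)
  have *: "\<exists>(x :: complex^2) (y :: complex^2). W$1$1 = x$1 * y$1 \<and> W$1$2 = x$1 * y$2 \<and> W$2$1 = x$2 * y$1 \<and> W$2$2 = x$2 * y$2"
  proof (cases "W$1$1 = 0")
    case False
    then show ?thesis using d
      by (intro exI[of _ "vector [W$1$1, W$2$1]"] exI[of _ "vector [1, W$1$2 / W$1$1]"]) (simp add: field_simps)
  next
    case True
    then have "W$1$2 = 0 \<or> W$2$1 = 0" using d by simp
    then show ?thesis
    proof
      assume "W$1$2 = 0"
      then show ?thesis using True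
        by (intro exI[of _ "vector [0, 1]"] exI[of _ "vector [W$2$1, W$2$2]"]) simp
    next
      assume "W$2$1 = 0"
      then show ?thesis using True
        by (intro exI[of _ "vector [W$1$2, W$2$2]"] exI[of _ "vector [0, 1]"]) simp
    qed
  qed
  then obtain x :: "complex^2" and y :: "complex^2" where "W$1$1 = x$1 * y$1" "W$1$2 = x$1 * y$2" "W$2$1 = x$2 * y$1" "W$2$2 = x$2 * y$2"
    by blast
  then have e: "W$i$j = x$i * y$j" for i j using exhaust_2[of i] exhaust_2[of j] by auto
  have "x \<noteq> 0" "y \<noteq> 0" using assms(2) e by (auto simp: mat2_eq_iff)
  then show thesis using that e by blast
qed

lemma det_Cm: "det Cm = -1"
proof -
  have "det Cm = (\<Prod>i\<in>UNIV. Cm$i$i)" by (rule det_diagonal) (simp add: Cm_def)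
  also have "\<dots> = Cm$1$1 * Cm$2$2 * Cm$3$3 * Cm$4$4" unfolding UNIV_4 by (simp add: mult_ac)
  finally show ?thesis by (simp add: Cm_def)
qed

text \<open>The images of the basis vectors are corrected one at a time by pairs in SL2 x SL2: a
  pair with prescribed first columns brings the first one back, unipotents the second without
  disturbing the first, and a diagonal pair the third. What remains can only change the sign of the
  fourth.\<close>

lemma SO_M_eq_Rm:
  assumes "g \<in> SO_M" obtains \<alpha> \<beta> where "det \<alpha> = 1" "det \<beta> = 1" "g = Rm \<alpha> \<beta>"
proof -
  have gO: "g \<in> O_M" and gdet: "det g = 1" using assms by (auto simp: SO_M_def)
  define e where "e i = (axis i 1 :: complex^4)" for i
  have he: "herm (e 1) = mat2 1 0 0 0" "herm (e 2) = mat2 0 0 0 1" "herm (e 3) = mat2 0 1 1 0"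
    by (simp_all add: e_def herm_def axis_def)
  have pull_back: "\<exists>\<alpha> \<beta>. det \<alpha> = 1 \<and> det \<beta> = 1 \<and> g' = Rm \<alpha> \<beta>"
    if a: "det \<alpha> = 1" "det \<beta> = 1" and R: "\<exists>\<alpha>' \<beta>'. det \<alpha>' = 1 \<and> det \<beta>' = 1 \<and> Rm (adj2 \<alpha>) (adj2 \<beta>) ** g' = Rm \<alpha>' \<beta>'"
    for \<alpha> \<beta> g'
  proof -
    obtain \<alpha>' \<beta>' where *: "det \<alpha>' = 1" "det \<beta>' = 1" "Rm (adj2 \<alpha>) (adj2 \<beta>) ** g' = Rm \<alpha>' \<beta>'" using R by blast
    have "g' = Rm \<alpha> \<beta> ** (Rm (adj2 \<alpha>) (adj2 \<beta>) ** g')"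
      using a by (simp add: matrix_mul_assoc Rm_mult adj2_mult Rm_one)
    also have "\<dots> = Rm (\<alpha> ** \<alpha>') (\<beta> ** \<beta>')" by (simp add: *(3) Rm_mult)
    finally show ?thesis using a *(1,2) by (metis det_mul mult_1)
  qed
  have inv: "Rm (adj2 \<alpha>) (adj2 \<beta>) *v (Rm \<alpha> \<beta> *v v) = v" if "det \<alpha> = 1" "det \<beta> = 1" for \<alpha> \<beta> v
    using that by (simp add: matrix_vector_mul_assoc Rm_mult adj2_mult Rm_one)
  have stays: "Rm (adj2 \<alpha>) (adj2 \<beta>) ** g' \<in> O_M \<and> det (Rm (adj2 \<alpha>) (adj2 \<beta>) ** g') = 1"
    if "det \<alpha> = 1" "det \<beta> = 1" "g' \<in> O_M" "det g' = 1" for \<alpha> \<beta> g'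
    using that by (simp add: O_M_mult Rm_in_O_M det_mul det_Rm)
  have step4: "\<exists>\<alpha> \<beta>. det \<alpha> = 1 \<and> det \<beta> = 1 \<and> g' = Rm \<alpha> \<beta>"
    if g': "g' \<in> O_M" "det g' = 1" "g' *v e 1 = e 1" "g' *v e 2 = e 2" "g' *v e 3 = e 3" for g'
  proof -
    define w where "w = g' *v e 4"
    have "polar (e i) w = polar (e i) (e 4)" if "g' *v e i = e i" for i
      using polar_O_M[OF g'(1), of "e i" "e 4"] that by (simp add: w_def)
    from this[OF g'(3)] this[OF g'(4)] this[OF g'(5)]
    have w: "w$1 = 0" "w$2 = 0" "w$3 = 0" by (auto simp: polar_eq e_def axis_def)
    have "M_form w = M_form (e 4)" using g'(1) by (simp add: w_def O_M_def)
    then have "w$4 * w$4 = 1" using w by (simp add: M_form_def e_def axis_def power2_eq_square)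
    then have pm: "w$4 = 1 \<or> w$4 = -1" by (metis square_eq_1_iff)
    have col: "g' $ i $ j = (g' *v e j) $ i" for i j
      by (simp add: e_def mv_axis_nth)
    have nth: "g' $ i $ j = (if j = 4 then w $ i else e j $ i)" for i j
      using g'(3-5) exhaust_4[of j] by (auto simp: col w_def)
    \<comment> \<open>Here the determinant enters: the value -1 would make g' the reflection
      \<open>Cm\<close>.\<close>
    have "w$4 \<noteq> -1"
    proof
      assume "w$4 = -1"
      then have "g' = Cm" using w
        by (simp add: vec_eq_iff nth forall_4 Cm_def e_def axis_def)
      then show False using g'(2) det_Cm by simp
    qed
    then have "w$4 = 1" using pm by blast
    then have "g' = mat 1" using w by (simp add: vec_eq_iff nth forall_4 e_def axis_def mat_def)
    then show ?thesis using Rm_one by (metis det_I)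
  qed
  have step3: "\<exists>\<alpha> \<beta>. det \<alpha> = 1 \<and> det \<beta> = 1 \<and> g' = Rm \<alpha> \<beta>"
    if g': "g' \<in> O_M" "det g' = 1" "g' *v e 1 = e 1" "g' *v e 2 = e 2" for g'
  proof -
    define w where "w = g' *v e 3"
    have "polar (e i) w = polar (e i) (e 3)" if "g' *v e i = e i" for i
      using polar_O_M[OF g'(1), of "e i" "e 3"] that by (simp add: w_def)
    from this[OF g'(3)] this[OF g'(4)]
    have w: "w$1 = 0" "w$2 = 0" by (auto simp: polar_eq e_def axis_def)
    have "M_form w = M_form (e 3)" using g'(1) by (simp add: w_def O_M_def)
    then have w34: "(w$3)\<^sup>2 + (w$4)\<^sup>2 = 1" using w by (simp add: M_form_def e_def axis_def)
    define z where "z = w$3 + \<i> * w$4"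
    have z: "z * (w$3 - \<i> * w$4) = 1" using w34 by (simp add: z_def power2_eq_square algebra_simps)
    have z0: "z \<noteq> 0" using z by auto
    then have zi: "w$3 - \<i> * w$4 = inverse z" using z by (simp add: field_simps)
    \<comment> \<open>A square root, because the diagonal pair multiplies the upper right entry by r
      from both sides.\<close>
    define r where "r = csqrt z"
    have r: "r * r = z" "r \<noteq> 0" using z0 by (auto simp: r_def simp flip: power2_eq_square)
    let ?\<alpha> = "mat2 r 0 0 (inverse r)" and ?\<beta> = "mat2 (inverse r) 0 0 r"
    have d: "det ?\<alpha> = 1" "det ?\<beta> = 1" using r(2) by (simp_all add: det_2)
    have "Rm ?\<alpha> ?\<beta> *v e 1 = e 1" "Rm ?\<alpha> ?\<beta> *v e 2 = e 2"
      using r(2) unfolding herm_inject[symmetric] herm_Rm he by (simp_all add: mat2_simps)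
    moreover have "Rm ?\<alpha> ?\<beta> *v e 3 = w"
    proof -
      have "inverse r * inverse r = inverse z" using r(1) by (metis inverse_mult_distrib)
      then show ?thesis using r(1) w zi
        unfolding herm_inject[symmetric] herm_Rm he by (simp add: mat2_simps herm_def z_def)
    qed
    ultimately have "Rm (adj2 ?\<alpha>) (adj2 ?\<beta>) *v e 1 = e 1" "Rm (adj2 ?\<alpha>) (adj2 ?\<beta>) *v e 2 = e 2"
      "Rm (adj2 ?\<alpha>) (adj2 ?\<beta>) *v w = e 3" using inv[OF d] by metis+
    then have fixed: "(Rm (adj2 ?\<alpha>) (adj2 ?\<beta>) ** g') *v e 1 = e 1"
      "(Rm (adj2 ?\<alpha>) (adj2 ?\<beta>) ** g') *v e 2 = e 2" "(Rm (adj2 ?\<alpha>) (adj2 ?\<beta>) ** g') *v e 3 = e 3"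
      unfolding matrix_vector_mul_assoc[symmetric] g'(3,4) w_def by blast+
    note st = stays[OF d g'(1,2)]
    have "\<exists>\<alpha>' \<beta>'. det \<alpha>' = 1 \<and> det \<beta>' = 1 \<and> Rm (adj2 ?\<alpha>) (adj2 ?\<beta>) ** g' = Rm \<alpha>' \<beta>'"
      by (rule step4[OF conjunct1[OF st] conjunct2[OF st] fixed])
    then show ?thesis by (rule pull_back[OF d])
  qed
  have step2: "\<exists>\<alpha> \<beta>. det \<alpha> = 1 \<and> det \<beta> = 1 \<and> g' = Rm \<alpha> \<beta>"
    if g': "g' \<in> O_M" "det g' = 1" "g' *v e 1 = e 1" for g'
  proof -
    define w where "w = g' *v e 2"
    have "polar (e 1) w = polar (e 1) (e 2)"
      using polar_O_M[OF g'(1), of "e 1" "e 2"] g'(3) by (simp add: w_def)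
    then have w2: "w$2 = 1" by (auto simp: polar_eq e_def axis_def)
    have "M_form w = M_form (e 2)" using g'(1) by (simp add: w_def O_M_def)
    then have "det (herm w) = 0" by (simp add: M_form_herm he det_2)
    \<comment> \<open>w is isotropic with second coordinate 1, so \<open>herm w\<close> is the
      product of the column (w3 + i w4, 1) and the row (w3 - i w4, 1); these entries give the two
      unipotents.\<close>
    then have w1: "w$1 = (w$3 + \<i> * w$4) * (w$3 - \<i> * w$4)" using w2 by (simp add: herm_def det_2)
    let ?\<alpha> = "mat2 1 (w$3 + \<i> * w$4) 0 1" and ?\<beta> = "mat2 1 (w$3 - \<i> * w$4) 0 1"
    have d: "det ?\<alpha> = 1" "det ?\<beta> = 1" by (simp_all add: det_2)
    have "Rm ?\<alpha> ?\<beta> *v e 1 = e 1"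
      unfolding herm_inject[symmetric] herm_Rm he by (simp add: mat2_simps)
    moreover have "Rm ?\<alpha> ?\<beta> *v e 2 = w"
      unfolding herm_inject[symmetric] herm_Rm he using w1 w2 by (simp add: mat2_simps herm_def)
    ultimately have "Rm (adj2 ?\<alpha>) (adj2 ?\<beta>) *v e 1 = e 1" "Rm (adj2 ?\<alpha>) (adj2 ?\<beta>) *v w = e 2"
      using inv[OF d] by metis+
    then have fixed: "(Rm (adj2 ?\<alpha>) (adj2 ?\<beta>) ** g') *v e 1 = e 1"
      "(Rm (adj2 ?\<alpha>) (adj2 ?\<beta>) ** g') *v e 2 = e 2"
      unfolding matrix_vector_mul_assoc[symmetric] g'(3) w_def by blast+
    note st = stays[OF d g'(1,2)]
    have "\<exists>\<alpha>' \<beta>'. det \<alpha>' = 1 \<and> det \<beta>' = 1 \<and> Rm (adj2 ?\<alpha>) (adj2 ?\<beta>) ** g' = Rm \<alpha>' \<beta>'"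
      by (rule step3[OF conjunct1[OF st] conjunct2[OF st] fixed])
    then show ?thesis by (rule pull_back[OF d])
  qed
  define w where "w = g *v e 1"
  have "M_form w = M_form (e 1)" using gO by (simp add: w_def O_M_def)
  then have detw: "det (herm w) = 0" by (simp add: M_form_herm he det_2)
  have "herm w \<noteq> 0"
  proof
    assume "herm w = 0"
    then have "w = unherm 0" by (metis unherm_herm)
    then have "w = 0" by (simp add: unherm_def vec4_eq_iff)
    moreover have "polar w (g *v e 2) = polar (e 1) (e 2)" unfolding w_def by (rule polar_O_M[OF gO])
    ultimately show False by (simp add: polar_eq e_def axis_def)
  qed
  then obtain x y where xy: "x \<noteq> 0" "y \<noteq> 0" "\<And>i j. herm w $ i $ j = x$i * y$j"
    using rank_one_2[OF detw] by blast
  obtain \<alpha> :: "complex^2^2" where \<alpha>: "det \<alpha> = 1" "\<alpha>$1$1 = x$1" "\<alpha>$2$1 = x$2" using SL2_first_column[OF xy(1)] by metis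
  obtain \<beta> :: "complex^2^2" where \<beta>: "det \<beta> = 1" "\<beta>$1$1 = y$1" "\<beta>$2$1 = y$2" using SL2_first_column[OF xy(2)] by metis
  have "Rm \<alpha> \<beta> *v e 1 = w"
    unfolding herm_inject[symmetric] herm_Rm he by (simp add: mat2_simps xy(3) \<alpha> \<beta>)
  then have "Rm (adj2 \<alpha>) (adj2 \<beta>) *v w = e 1" using inv[OF \<alpha>(1) \<beta>(1)] by metis
  then have fixed: "(Rm (adj2 \<alpha>) (adj2 \<beta>) ** g) *v e 1 = e 1"
    unfolding w_def matrix_vector_mul_assoc .
  note st = stays[OF \<alpha>(1) \<beta>(1) gO gdet]
  have "\<exists>\<alpha>' \<beta>'. det \<alpha>' = 1 \<and> det \<beta>' = 1 \<and> Rm (adj2 \<alpha>) (adj2 \<beta>) ** g = Rm \<alpha>' \<beta>'"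
    by (rule step2[OF conjunct1[OF st] conjunct2[OF st] fixed])
  then have "\<exists>\<alpha> \<beta>. det \<alpha> = 1 \<and> det \<beta> = 1 \<and> g = Rm \<alpha> \<beta>" by (rule pull_back[OF \<alpha>(1) \<beta>(1)])
  then show thesis using that by blast
qed

section \<open>Thinness\<close>

text \<open>With c = x + i y and d = x - i y the entries are polynomial in x and y, and real x and y
  give the hypothesis. First x and then y is allowed to be complex; x = (c + d)/2 and y = (c -
  d)/(2i) reach every pair.\<close>

lemma zariski_closure_unipotents:
  assumes N: "\<And>c. det (mat 1 + mat c ** N) = 1"
    and real: "\<And>c. Rm (mat 1 + mat c ** N) (mat 1 + mat (cnj c) ** N) \<in> zariski_closure X"
  shows "Rm (mat 1 + mat c ** N) (mat 1 + mat d ** N) \<in> zariski_closure X"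
proof -
  let ?R = "\<lambda>c d. Rm (mat 1 + mat c ** N) (mat 1 + mat d ** N)"
  have nth: "?R c d $ i $ j = Rm (mat 1) (mat 1) $ i $ j + d * Rm (mat 1) N $ i $ j
      + c * Rm N (mat 1) $ i $ j + c * d * Rm N N $ i $ j" for c d i j
    using Rm_bilinear[of 1 "mat 1" c N 1 "mat 1" d N i j] by simp
  have poly: "\<exists>P. \<forall>x. ?R (a + b * x) (a' + b' * x) $ i $ j = poly P x" for a b a' b' i j
    unfolding nth
    by (rule exI[of _ "[:Rm (mat 1) (mat 1) $ i $ j:] + smult (Rm (mat 1) N $ i $ j) [:a', b':]
      + smult (Rm N (mat 1) $ i $ j) [:a, b:] + smult (Rm N N $ i $ j) ([:a, b:] * [:a', b':])"])
      (simp add: algebra_simps)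
  have O: "?R c d \<in> O_M" for c d using N Rm_in_O_M by blast
  have step1: "?R (x + \<i> * of_real y) (x - \<i> * of_real y) \<in> zariski_closure X" for x and y :: real
  proof (rule zariski_closure_complexify[where g = "\<lambda>x. ?R (x + \<i> * of_real y) (x - \<i> * of_real y)"])
    show "\<exists>P. \<forall>x. ?R (x + \<i> * of_real y) (x - \<i> * of_real y) $ i $ j = poly P x" for i j
      using poly[of "\<i> * of_real y" 1 "- \<i> * of_real y" 1 i j] by (simp add: algebra_simps)
    show "?R (of_real x + \<i> * of_real y) (of_real x - \<i> * of_real y) \<in> zariski_closure X" for x :: real
    proof -
      have "cnj (of_real x + \<i> * of_real y) = of_real x - \<i> * of_real y" by (simp add: complex_eq_iff)
      then show ?thesis using real[of "of_real x + \<i> * of_real y"] by simp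
    qed
  qed (rule O)
  have step2: "?R (x + \<i> * y) (x - \<i> * y) \<in> zariski_closure X" for x y
  proof (rule zariski_closure_complexify[where g = "\<lambda>y. ?R (x + \<i> * y) (x - \<i> * y)"])
    show "\<exists>P. \<forall>y. ?R (x + \<i> * y) (x - \<i> * y) $ i $ j = poly P y" for i j
      using poly[of x "\<i>" x "- \<i>" i j] by simp
  qed (rule step1, rule O)
  have "(c + d) / 2 + \<i> * ((c - d) / (2 * \<i>)) = c" "(c + d) / 2 - \<i> * ((c - d) / (2 * \<i>)) = d"
    by (simp_all add: field_simps)
  then show ?thesis using step2[of "(c + d) / 2" "(c - d) / (2 * \<i>)"] by simp
qed

text \<open>Points of the sphere are the isotropic lines of the form, so \<open>\<rho>(f)\<close> determines \<open>f\<close>.\<close>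

definition null_vec :: "complex^2 \<Rightarrow> complex^4" where
  "null_vec v = unherm (mat2 (v$1 * cnj (v$1)) (v$1 * cnj (v$2)) (v$2 * cnj (v$1)) (v$2 * cnj (v$2)))"

lemma Rm_null_vec: "Rm \<gamma> (cnjm \<gamma>) *v null_vec v = null_vec (\<gamma> *v v)"
  unfolding herm_inject[symmetric] herm_Rm null_vec_def herm_unherm
  by (simp add: mat2_simps mv2_nth algebra_simps)

lemma Cm_null_vec: "Cm *v null_vec (hv z) = null_vec (hv (conjugation z))"
  unfolding herm_inject[symmetric] herm_Cm null_vec_def herm_unherm
  by (simp add: mat2_eq_iff transpose_def hv_conjugation)

lemma null_vec_eq_imp:
  assumes "null_vec v = null_vec w" "w \<noteq> 0" obtains s where "v = s *s w"
proof -
  have "herm (null_vec v) = herm (null_vec w)" using assms(1) by simp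
  then have e: "v$1 * cnj (v$1) = w$1 * cnj (w$1)" "v$1 * cnj (v$2) = w$1 * cnj (w$2)"
    "v$2 * cnj (v$1) = w$2 * cnj (w$1)" "v$2 * cnj (v$2) = w$2 * cnj (w$2)"
    by (simp_all add: null_vec_def mat2_eq_iff)
  show thesis
  proof (cases "w$1 = 0")
    case False
    then have "v$1 \<noteq> 0" using e(1) by auto
    have "v = (cnj (w$1) / cnj (v$1)) *s w"
      using e(1,3) \<open>v$1 \<noteq> 0\<close> by (simp add: vec2_eq_iff field_simps)
    then show ?thesis by (rule that)
  next
    case True
    then have "w$2 \<noteq> 0" using assms(2) by (simp add: vec2_eq_iff)
    then have "v$2 \<noteq> 0" using e(4) by auto
    have "v = (cnj (w$2) / cnj (v$2)) *s w"
      using e(2,4) \<open>v$2 \<noteq> 0\<close> by (simp add: vec2_eq_iff field_simps)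
    then show ?thesis by (rule that)
  qed
qed

lemma moebius_eq_if_null_vec:
  assumes "det \<alpha> = 1" "det \<beta> = 1" "null_vec (\<alpha> *v hv z) = null_vec (\<beta> *v hv w)"
  shows "moebius \<alpha> z = moebius \<beta> w"
proof -
  have "\<beta> *v hv w \<noteq> 0" using mult_vector_eq_0_imp[of \<beta>] hv_nonzero assms(2) by auto
  then obtain s where s: "\<alpha> *v hv z = s *s (\<beta> *v hv w)" using null_vec_eq_imp[OF assms(3)] by blast
  obtain t where "\<beta> *v hv w = t *s hv (moebius \<beta> w)" using moebius_hv[of \<beta> w] assms(2) by auto
  then have "\<alpha> *v hv z = (s * t) *s hv (moebius \<beta> w)" using s by simp
  then show ?thesis using moebius_eqI[of \<alpha>] assms(1) by simp
qed

section \<open>The Zariski closure of the image and its infinite index\<close>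

context weak_group begin

lemma Rm_in_G:
  assumes "det \<alpha> = 1" "det \<beta> = 1" shows "Rm \<alpha> \<beta> \<in> G"
proof (rule SL2_pair_induct[where P = "\<lambda>\<alpha> \<beta>. Rm \<alpha> \<beta> \<in> G", OF _ _ _ assms])
  show "Rm (\<alpha> ** \<alpha>') (\<beta> ** \<beta>') \<in> G" if "Rm \<alpha> \<beta> \<in> G" "Rm \<alpha>' \<beta>' \<in> G" for \<alpha> \<beta> \<alpha>' \<beta>'
    using G_mult[OF that] by (simp add: Rm_mult)
  have u: "mat 1 + mat c ** mat2 0 1 0 0 = mat2 1 c 0 1" and l: "mat 1 + mat c ** mat2 0 0 1 0 = mat2 1 0 c 1"
    for c :: complex by (simp_all add: mat2_simps)
  have cu: "cnjm (mat2 1 c 0 1) = mat2 1 (cnj c) 0 1" and cl: "cnjm (mat2 1 0 c 1) = mat2 1 0 (cnj c) 1"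
    for c by (simp_all add: mat2_eq_iff)
  show "Rm (mat2 1 c 0 1) (mat2 1 d 0 1) \<in> G" for c d
    using zariski_closure_unipotents[of "mat2 0 1 0 0" X c d] unipotents_in_H(1) unfolding u
    by (simp add: H_def cu det_2)
  show "Rm (mat2 1 0 c 1) (mat2 1 0 d 1) \<in> G" for c d
    using zariski_closure_unipotents[of "mat2 0 0 1 0" X c d] unipotents_in_H(2) unfolding l
    by (simp add: H_def cl det_2)
qed

lemma SO_M_subset_G: "SO_M \<subseteq> G"
proof
  fix g assume "g \<in> SO_M"
  then show "g \<in> G" using SO_M_eq_Rm Rm_in_G by metis
qed

lemma G_eq: "G = O_M \<or> G = SO_M"
proof (cases "G \<subseteq> SO_M")
  case True
  then show ?thesis using SO_M_subset_G by blast
next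
  case False
  have GO: "G \<subseteq> O_M" by (auto simp: zariski_closure_def)
  obtain x where x: "x \<in> G" "x \<notin> SO_M" using False by blast
  then have xO: "x \<in> O_M" using GO by blast
  then have dx: "det x = -1" using det_O_M x(2) by (auto simp: SO_M_def)
  then have "invertible x" by (simp add: invertible_det_nz)
  then obtain x' where x': "x ** x' = mat 1" "x' ** x = mat 1" unfolding invertible_def by blast
  have x'O: "x' \<in> O_M"
    unfolding O_M_def
  proof (intro CollectI allI)
    fix v
    have "M_form (x' *v v) = M_form (x *v (x' *v v))" using xO by (simp add: O_M_def)
    then show "M_form (x' *v v) = M_form v" by (simp add: matrix_vector_mul_assoc x')
  qed
  have "det x * det x' = 1" using x' by (metis det_I det_mul)
  then have dx': "det x' = -1" using dx by (simp add: minus_equation_iff)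
  have "O_M \<subseteq> G"
  proof
    fix y assume y: "y \<in> O_M"
    show "y \<in> G"
    proof (cases "det y = 1")
      case True
      then show ?thesis using y SO_M_subset_G by (auto simp: SO_M_def)
    next
      case False
      then have "det y = -1" using det_O_M[OF y] by blast
      then have "y ** x' \<in> SO_M" using y x'O by (simp add: SO_M_def O_M_mult det_mul dx')
      then have "y ** x' ** x \<in> G" using SO_M_subset_G G_mult x(1) by blast
      then show ?thesis by (simp add: x'(2) flip: matrix_mul_assoc)
    qed
  qed
  then show ?thesis using GO by blast
qed

abbreviation "GZ \<equiv> matrix_group\<lparr>carrier := integral_points K G\<rparr>"

lemma integral_pointsI:
  assumes "x \<in> G" "x ** y = mat 1"
    and "\<And>v. v \<in> hermitian_lattice K \<Longrightarrow> x *v v \<in> hermitian_lattice K"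
    and "\<And>v. v \<in> hermitian_lattice K \<Longrightarrow> y *v v \<in> hermitian_lattice K"
  shows "x \<in> integral_points K G"
proof -
  have "v \<in> (\<lambda>v. x *v v) ` hermitian_lattice K" if "v \<in> hermitian_lattice K" for v
    by (rule image_eqI[of _ _ "y *v v"]) (use assms that in \<open>simp_all add: matrix_vector_mul_assoc\<close>)
  then show ?thesis using assms(1,3) unfolding integral_points_def by blast
qed

lemma X_one: "mat 1 \<in> X"
proof -
  have "id \<in> A" using subgroup.one_closed[OF A_subgroup] by (simp add: Moeb_one)
  then show ?thesis unfolding rho_image_def by (metis image_eqI rhoC_id)
qed

lemma X_hermitian_lattice:
  assumes "x \<in> X" "v \<in> hermitian_lattice K" shows "x *v v \<in> hermitian_lattice K"
  using assms unfolding rho_image_eq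
  by (auto simp: Gam_def Rm_hermitian_lattice Cm_hermitian_lattice simp flip: matrix_vector_mul_assoc)

lemma X_subset_GZ: "X \<subseteq> integral_points K G"
proof
  fix x assume x: "x \<in> X"
  obtain y where y: "y \<in> X" "x ** y = mat 1" "y ** x = mat 1" using X_inverse[OF x] by blast
  show "x \<in> integral_points K G"
    by (rule integral_pointsI[OF _ y(2)]) (use x y X_subset_G X_hermitian_lattice in auto)
qed

lemma subgroup_X: "subgroup X GZ"
proof
  show "X \<subseteq> carrier GZ" using X_subset_GZ by simp
  show "x \<otimes>\<^bsub>GZ\<^esub> y \<in> X" if "x \<in> X" "y \<in> X" for x y using X_mult[OF that] by (simp add: matrix_group_def)
  show "\<one>\<^bsub>GZ\<^esub> \<in> X" using X_one by (simp add: matrix_group_def)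
  show "inv\<^bsub>GZ\<^esub> x \<in> X" if x: "x \<in> X" for x
  proof -
    obtain y where y: "y \<in> X" "x ** y = mat 1" "y ** x = mat 1" using X_inverse[OF x] by blast
    have "inv\<^bsub>GZ\<^esub> x = y"
      \<comment> \<open>\<open>GZ\<close> has not been shown to be a group, so the inverse is
        identified from its definite description.\<close>
      unfolding m_inv_def
    proof (rule the_equality)
      show "y \<in> carrier GZ \<and> x \<otimes>\<^bsub>GZ\<^esub> y = \<one>\<^bsub>GZ\<^esub> \<and> y \<otimes>\<^bsub>GZ\<^esub> x = \<one>\<^bsub>GZ\<^esub>"
        using y X_subset_GZ by (auto simp: matrix_group_def)
      fix z assume "z \<in> carrier GZ \<and> x \<otimes>\<^bsub>GZ\<^esub> z = \<one>\<^bsub>GZ\<^esub> \<and> z \<otimes>\<^bsub>GZ\<^esub> x = \<one>\<^bsub>GZ\<^esub>"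
      then have "x ** z = mat 1" by (simp add: matrix_group_def)
      then have "y ** (x ** z) = y" by simp
      then show "z = y" by (simp add: matrix_mul_assoc y(3))
    qed
    then show ?thesis using y(1) by simp
  qed
qed

lemma Rm_in_X_imp:
  assumes g: "\<gamma> \<in> SLK" and X: "Rm \<gamma> (cnjm \<gamma>) \<in> X" shows "\<gamma> \<in> Gam"
proof -
  have "moebius \<gamma> \<in> A"
    using X unfolding rho_image_eq
  proof (rule UnE)
    assume "Rm \<gamma> (cnjm \<gamma>) \<in> {Rm \<gamma> (cnjm \<gamma>) | \<gamma>. \<gamma> \<in> Gam}"
    then obtain \<delta> where d: "\<delta> \<in> Gam" "Rm \<gamma> (cnjm \<gamma>) = Rm \<delta> (cnjm \<delta>)" by blast
    have "moebius \<gamma> z = moebius \<delta> z" for z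
      by (rule moebius_eq_if_null_vec[OF SLK_det[OF g] Gam_det[OF d(1)]]) (metis d(2) Rm_null_vec)
    then have "moebius \<gamma> = moebius \<delta>" by (simp add: fun_eq_iff)
    then show ?thesis using d(1) by (simp add: Gam_def)
  next
    assume "Rm \<gamma> (cnjm \<gamma>) \<in> {Rm \<gamma> (cnjm \<gamma>) ** Cm | \<gamma>. \<gamma> \<in> SLK \<and> moebius \<gamma> \<circ> conjugation \<in> A}"
    then obtain \<delta> where d: "\<delta> \<in> SLK" "moebius \<delta> \<circ> conjugation \<in> A" "Rm \<gamma> (cnjm \<gamma>) = Rm \<delta> (cnjm \<delta>) ** Cm" by blast
    have "moebius \<gamma> z = moebius \<delta> (conjugation z)" for z
      by (rule moebius_eq_if_null_vec[OF SLK_det[OF g] SLK_det[OF d(1)]])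
        (metis d(3) Rm_null_vec Cm_null_vec matrix_vector_mul_assoc)
    then have "moebius \<gamma> = moebius \<delta> \<circ> conjugation" by (simp add: fun_eq_iff)
    then show ?thesis using d(2) by simp
  qed
  then show ?thesis using g by (simp add: Gam_def)
qed

text \<open>Powers of a parabolic element fixing the point \<open>\<omega>\<close> of the upper half plane.\<close>

definition para :: "nat \<Rightarrow> complex^2^2" where
  "para k = mat2 (1 - of_nat k * \<omega>) (of_nat k * \<omega>\<^sup>2) (- of_nat k) (1 + of_nat k * \<omega>)"

lemma para_SLK: "para k \<in> SLK"
proof -
  have k: "of_nat k \<in> OK" using OK_of_int[of "int k"] by simp
  have "det (para k) = 1" by (simp add: para_def det_2 power2_eq_square algebra_simps)
  then show ?thesis unfolding SLK_iff_mat2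
    using k \<omega>(1) by (simp add: para_def power2_eq_square OK_mult OK_add OK_diff OK_minus OK_1)
qed

lemma para_add: "para (m + n) = para m ** para n"
  by (simp add: para_def mat2_simps power2_eq_square algebra_simps)

lemma para_in_GZ: "Rm (para k) (cnjm (para k)) \<in> integral_points K G"
proof (rule integral_pointsI)
  let ?p = "para k"
  have d: "det ?p = 1" "det (cnjm ?p) = 1" using SLK_det[OF para_SLK[of k]] by simp_all
  show "Rm ?p (cnjm ?p) \<in> G" by (rule Rm_in_G[OF d])
  have "cnjm (adj2 ?p) = adj2 (cnjm ?p)" by (simp add: mat2_eq_iff)
  then show "Rm ?p (cnjm ?p) ** Rm (adj2 ?p) (cnjm (adj2 ?p)) = mat 1"
    using d by (simp add: Rm_mult adj2_mult Rm_one)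
qed (use Rm_hermitian_lattice para_SLK SLK_adj2 in auto)

text \<open>Otherwise all multiples \<open>para (j * N)\<close> would lie in \<open>Gam\<close>.
  They send infinity to \<omega> - 1/(j N), and this orbit would accumulate at \<omega>, outside the
  limit set.\<close>

lemma para_notin_X:
  assumes "N > 0" shows "Rm (para N) (cnjm (para N)) \<notin> X"
proof
  assume "Rm (para N) (cnjm (para N)) \<in> X"
  then have pN: "para N \<in> Gam" using Rm_in_X_imp para_SLK by blast
  have "para (j * N) \<in> Gam" for j
  proof (induction j)
    case 0
    have "para 0 = mat 1" by (simp add: para_def mat2_eq_iff)
    then show ?case using Gam_one by simp
  next
    case (Suc j)
    then show ?case using Gam_mult[OF pN] by (simp add: para_add)
  qed
  then have orbit: "moebius (para (j * N)) None \<in> (\<lambda>f. f None) ` A" for j by (auto simp: Gam_def)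
  have val: "moebius (para k) None = Some (\<omega> - 1 / of_nat k)" if "k > 0" for k
    using that by (simp add: moebius_def para_def field_simps)
  have "Some \<omega> \<in> sphere_topology derived_set_of ((\<lambda>f. f None) ` A)"
    unfolding in_derived_set_of
  proof (intro conjI allI impI)
    fix T assume T: "Some \<omega> \<in> T \<and> openin sphere_topology T"
    have "open {z. Some z \<in> T}"
      using openin_continuous_map_preimage[OF continuous_map_Some[of euclidean], of T] T
      by (simp add: sphere_topology_def)
    then obtain e where e: "e > 0" "ball \<omega> e \<subseteq> {z. Some z \<in> T}" using T openE by blast
    obtain j :: nat where j: "1 / e < j" using reals_Archimedean2 by blast
    have "0 < 1 / e" using e(1) by simp
    then have j0: "j > 0" using j by (metis of_nat_0_less_iff order_less_trans)
    let ?k = "j * N"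
    have k: "?k > 0" "real j \<le> real ?k" using j0 assms by (auto simp flip: of_nat_mult)
    then have "1 / e < real ?k" using j by linarith
    then have "1 / real ?k < e" using e(1) k(1) by (simp add: field_simps)
    then have "\<omega> - 1 / of_nat ?k \<in> ball \<omega> e" by (simp add: dist_norm norm_divide flip: of_nat_mult)
    then have "Some (\<omega> - 1 / of_nat ?k) \<in> T" using e(2) by blast
    moreover have "Some (\<omega> - 1 / of_nat ?k) \<noteq> Some \<omega>" using k(1) by simp
    ultimately show "\<exists>y. y \<noteq> Some \<omega> \<and> y \<in> (\<lambda>f. f None) ` A \<and> y \<in> T"
      using orbit[of j] unfolding val[OF k(1)] by blast
  qed simp
  then have "Some \<omega> \<in> limit_set A" unfolding limit_set_def by blast
  moreover have "Some \<omega> \<in> upper_half_plane" using \<omega> h by (simp add: upper_half_plane_iff)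
  ultimately show False using limit_set_upper_half_plane by blast
qed

text \<open>The elements \<open>para k\<close> represent distinct cosets: if m < n gave the same
  one, the difference \<open>para (n - m)\<close> would have its image in X.\<close>

lemma infinite_rcosets: "infinite (rcosets\<^bsub>GZ\<^esub> X)"
proof
  assume fin: "finite (rcosets\<^bsub>GZ\<^esub> X)"
  let ?F = "\<lambda>k. Rm (para k) (cnjm (para k))"
  have coset: "X #>\<^bsub>GZ\<^esub> a = (\<lambda>x. x ** a) ` X" for a by (auto simp: r_coset_def matrix_group_def)
  have "range (\<lambda>k. X #>\<^bsub>GZ\<^esub> ?F k) \<subseteq> rcosets\<^bsub>GZ\<^esub> X" using para_in_GZ by (auto simp: RCOSETS_def)
  then have "finite (range (\<lambda>k. X #>\<^bsub>GZ\<^esub> ?F k))" using fin finite_subset by blast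
  then have "\<not> inj (\<lambda>k. X #>\<^bsub>GZ\<^esub> ?F k)" using range_inj_infinite by blast
  then obtain m n where mn: "m < n" "X #>\<^bsub>GZ\<^esub> ?F m = X #>\<^bsub>GZ\<^esub> ?F n"
    unfolding inj_def by (metis linorder_neqE_nat)
  have "?F n \<in> (\<lambda>x. x ** ?F n) ` X" by (rule image_eqI[OF _ X_one]) simp
  also have "(\<lambda>x. x ** ?F n) ` X = (\<lambda>x. x ** ?F m) ` X" using mn(2) unfolding coset by (rule sym)
  finally have "?F n \<in> (\<lambda>x. x ** ?F m) ` X" .
  then obtain x where x: "x \<in> X" "?F n = x ** ?F m" by (rule imageE)
  have d: "det (para m) = 1" "det (cnjm (para m)) = 1" using SLK_det[OF para_SLK[of m]] by simp_all
  let ?inv = "Rm (adj2 (para m)) (adj2 (cnjm (para m)))"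
  have inv: "?F m ** ?inv = mat 1" using d by (simp add: Rm_mult adj2_mult Rm_one)
  have "?F n = ?F (n - m) ** ?F m"
    using mn(1) para_add[of "n - m" m] by (simp add: Rm_cnjm_mult)
  then have "?F (n - m) ** ?F m ** ?inv = x ** ?F m ** ?inv" using x(2) by simp
  then have "?F (n - m) = x" by (simp add: inv flip: matrix_mul_assoc)
  then show False using para_notin_X[of "n - m"] mn(1) x(1) by simp
qed

end

theorem theorem9p4:
  fixes K :: "complex set" and A :: "(riemann_sphere \<Rightarrow> riemann_sphere) set"
  assumes "imaginary_quadratic_field K"
    and "K \<noteq> quadratic_field (-3)"
    and "weak_apollonian_group K A"
  shows "thin K (rho_image A) \<and>
         (zariski_closure (rho_image A) = O_M \<or> zariski_closure (rho_image A) = SO_M)"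
proof -
  interpret imaginary_quadratic K by unfold_locales (rule assms(1))
  obtain h \<omega> where "h \<ge> 1" "\<omega> \<in> OK" "Im \<omega> = h" "\<And>x. x \<in> OK \<Longrightarrow> \<exists>k::int. Im x = of_int k * h"
    using OK_Im_lattice[OF assms(2)] by metis
  then interpret weak_group K h \<omega> A by unfold_locales (use assms(3) in auto)
  show ?thesis unfolding thin_def Let_def using subgroup_X infinite_rcosets G_eq by blast
qed

end
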